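(* Let $[\alpha,\beta]\subset\mathbb{R}$ be a compact interval and let $u$ be a weak solution of the Camassa-Holm equation. Then $$\lim_{t\to 0^+}\int_{[\alpha(t),\beta(t)]}(u_x^-(t,x))^2\,dx=\int_{[\alpha,\beta]}(u_x^-(0,x))^2\,dx,$$ where $\alpha(t)$ and $\beta(t)$ are arbitrary characteristics of $u$ emanating from $\alpha$ and $\beta$, respectively.
   Context: The Camassa-Holm equation is taken in the form $$u_t+uu_x=\int_{\mathbb{R}}\tfrac12\,\mathrm{sgn}(x-y)e^{-|x-y|}\left(u^2(t,y)+\tfrac12u_x^2(t,y)\right)dy,\qquad u(0,x)=u_0(x),$$ for $t\ge 0$, $x\in\mathbb{R}$. A function $u:[0,\infty)\times\mathbb{R}\to\mathbb{R}$ is a weak solution if $u\in C([0,\infty)\times\mathbb{R})$, the function $t\mapsto\int_{\mathbb{R}}(u^2(t,x)+\frac12u_x^2(t,x))dx$ belongs to $L^\infty([0,\infty))$, $u(0,x)=u_0(x)$ for $x\in\mathbb{R}$, and the equation holds in the sense of distributions. A characteristic of $u$ emanating from $\zeta\in\mathbb{R}$ is a function $\zeta:[0,\infty)\to\mathbb{R}$ with $\zeta(0)=\zeta$, $\frac{d}{dt}\zeta(t)=u(t,\zeta(t))$ and $\frac{d}{dt}u(t,\zeta(t))=\int_{\mathbb{R}}\frac12\mathrm{sgn}(\zeta(t)-y)e^{-|\zeta(t)-y|}(u^2(t,y)+\frac12u_x^2(t,y))dy$ (the last identity for a.e. $t$, with $t\mapsto u(t,\zeta(t))$ Lipschitz).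 Characteristics are in general not unique. Notation: $f^+=\max(f,0)$, $f^-=\max(-f,0)$, and $u_x^\pm=(u_x)^\pm$. *)

theory Defs
  imports "HOL-Analysis.Analysis" "HOL-Probability.Essential_Supremum"
begin

text \<open>\<open>C_k n f\<close>: the function \<open>f\<close> is of class \<open>C^n\<close>. In finite dimension, continuity of the derivative
  as a linear-map-valued function is the same as continuity of all directional derivatives.\<close>

primrec C_k :: "nat \<Rightarrow> ('a::euclidean_space \<Rightarrow> real) \<Rightarrow> bool" where
  "C_k 0 f \<longleftrightarrow> continuous_on UNIV f"
| "C_k (Suc n) f \<longleftrightarrow>
     (\<exists>f'. (\<forall>x. (f has_derivative f' x) (at x)) \<and> (\<forall>v. C_k n (\<lambda>x. f' x v)))"

definition test_function :: "'a::euclidean_space set \<Rightarrow> ('a \<Rightarrow> real) \<Rightarrow> bool" where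
  "test_function U \<phi> \<longleftrightarrow>
     (\<forall>n. C_k n \<phi>) \<and> (\<exists>K. compact K \<and> K \<subseteq> U \<and> (\<forall>x. x \<notin> K \<longrightarrow> \<phi> x = 0))"

definition has_weak_deriv :: "(real \<Rightarrow> real) \<Rightarrow> (real \<Rightarrow> real) \<Rightarrow> bool" where
  "has_weak_deriv f g \<longleftrightarrow>
     (\<forall>K. compact K \<longrightarrow> f absolutely_integrable_on K \<and> g absolutely_integrable_on K) \<and>
     (\<forall>\<phi>. test_function UNIV \<phi> \<longrightarrow>
        (LINT x|lebesgue. f x * deriv \<phi> x) = - (LINT x|lebesgue. g x * \<phi> x))"

text \<open>A representative of the weak derivative, which is unique up to null sets. All uses below are
  inside integrals over \<open>x\<close>, so they do not depend on the representative. The value is meaningful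
  only if a weak derivative exists.\<close>

definition weak_deriv :: "(real \<Rightarrow> real) \<Rightarrow> real \<Rightarrow> real" where
  "weak_deriv f = (SOME g. has_weak_deriv f g)"

definition CH_source :: "(real \<Rightarrow> real) \<Rightarrow> real \<Rightarrow> real" where
  "CH_source f x =
     (LINT y|lebesgue. 1/2 * sgn (x - y) * exp (- \<bar>x - y\<bar>) * ((f y)\<^sup>2 + 1/2 * (weak_deriv f y)\<^sup>2))"

text \<open>Functions on \<open>[0,\<infinity>) \<times> \<real>\<close> are represented as functions on \<open>\<real> \<times> \<real>\<close> whose values at negative
  times are irrelevant. Membership of the energy in \<open>L^\<infinity>\<close> includes Lebesgue measurability in time
  (\<open>esssup\<close> is \<open>\<infinity>\<close> for nonmeasurable functions). Since elements of \<open>L^\<infinity>\<close> are defined only up to null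
  sets, the weak derivative in space is required to exist for almost every time; together with the
  continuity of \<open>u\<close> and the energy bound it then exists, and lies in \<open>L^2\<close>, for every time.
  The distributional form uses \<open>u u_x = (u^2/2)_x\<close>.\<close>

definition CH_weak_solution :: "(real \<Rightarrow> real) \<Rightarrow> (real \<Rightarrow> real \<Rightarrow> real) \<Rightarrow> bool" where
  "CH_weak_solution u0 u \<longleftrightarrow>
     continuous_on ({0..} \<times> UNIV) (\<lambda>(t, x). u t x) \<and>
     (AE t in lebesgue_on {0..}. \<exists>g. has_weak_deriv (u t) g) \<and>
     esssup (lebesgue_on {0..})
       (\<lambda>t. \<integral>\<^sup>+x. ennreal ((u t x)\<^sup>2 + 1/2 * (weak_deriv (u t) x)\<^sup>2) \<partial>lebesgue) < \<infinity> \<and>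
     (\<forall>x. u 0 x = u0 x) \<and>
     (\<forall>\<phi>. test_function ({0<..} \<times> UNIV) \<phi> \<longrightarrow>
        has_bochner_integral (lebesgue_on ({0<..} \<times> UNIV))
          (\<lambda>(t, x). u t x * deriv (\<lambda>s. \<phi> (s, x)) t
                  + 1/2 * (u t x)\<^sup>2 * deriv (\<lambda>y. \<phi> (t, y)) x
                  + CH_source (u t) x * \<phi> (t, x)) 0)"

definition CH_characteristic :: "(real \<Rightarrow> real \<Rightarrow> real) \<Rightarrow> real \<Rightarrow> (real \<Rightarrow> real) \<Rightarrow> bool" where
  "CH_characteristic u z0 z \<longleftrightarrow>
     z 0 = z0 \<and>
     (\<forall>t\<ge>0. (z has_real_derivative u t (z t)) (at t within {0..})) \<and>
     (\<exists>L. L-lipschitz_on {0..} (\<lambda>t. u t (z t))) \<and>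
     (AE t in lebesgue_on {0..}.
        ((\<lambda>s. u s (z s)) has_real_derivative CH_source (u t) (z t)) (at t within {0..}))"

definition neg_part :: "real \<Rightarrow> real" where
  "neg_part r = max (- r) 0"

end

theory Submission
  imports Defs "HOL-Probability.Distributions"
begin

text \<open>
  Write \<open>v = u\<^sub>x\<close> for the slope. Differentiating the equation gives
  \<open>v\<^sub>t + u v\<^sub>x = - v\<^sup>2/2 + G\<close> with \<open>G = u\<^sup>2 - P\<close> locally bounded, where \<open>P\<close> is the convolution of
  \<open>u\<^sup>2 + v\<^sup>2/2\<close> with \<open>exp (- \<bar>x\<bar>) / 2\<close>. For a smooth solution the cubic terms cancel in the balance of
  the energy of the negative slopes,
  \<open>((v\<^sup>-)\<^sup>2)\<^sub>t + (u (v\<^sup>-)\<^sup>2)\<^sub>x = - 2 v\<^sup>- G\<close>: this energy moves with speed \<open>u\<close> and grows at a bounded rate.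
  For a weak solution \<open>v\<close> is only square integrable in space and the computation is not licit, but
  an inequality in one direction survives, and only at the initial time is the other direction needed,
  where it is weak lower semicontinuity.

  \<^emph>\<open>Upper bound.\<close> Replace \<open>(v\<^sup>-)\<^sup>2\<close> by the bounded function \<open>\<eta> = (v\<^sup>-)\<^sup>2 / (1 + \<epsilon> (v\<^sup>-)\<^sup>2)\<close>. The terms that
  no longer cancel are \<open>v \<eta> - v\<^sup>2 \<eta>' / 2\<close>, and they are nonpositive (lemma \<open>neg_sq_cubic\<close>); this is
  where it matters that the slopes are negative, since for positive slopes the sign is reversed.
  Boundedness of \<open>\<eta>\<close> makes square integrability of \<open>v\<close> sufficient for all limits. Hence, for a fixed
  cut-off \<open>\<psi>\<close>, the integral of \<open>\<psi> \<eta>\<close> grows at most linearly in time with a rate that does not depend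
  on \<open>\<epsilon>\<close>, and \<open>\<epsilon> \<rightarrow> 0\<close> gives the bound for \<open>\<psi> (v\<^sup>-)\<^sup>2\<close> (lemma \<open>neg_energy_growth\<close>).

  To justify the balance, \<open>v(t, x)\<close> is replaced by its average against a hat of width \<open>2h\<close>, which is
  the second difference quotient of a primitive of \<open>u(t, \<sqdot>)\<close>. At fixed \<open>x\<close> this average is Lipschitz
  in time, and its time derivative is a second difference quotient as well, because integrating the
  equation over rectangles involves only point values of \<open>u\<^sup>2\<close> and averages of the source (lemma
  \<open>balance\<close>). The commutator between averaging and transport is explicit (lemma \<open>second_diff_square\<close>):
  it consists of squares of one-sided difference quotients of \<open>u\<close>, which by Cauchy--Schwarz are at
  most averages of \<open>v\<^sup>2\<close>. As \<open>h \<rightarrow> 0\<close> all these averages converge to \<open>v\<^sup>2\<close> almost everywhere by Lebesgue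
  differentiation and therefore in \<open>L\<^sup>1\<close>, their total masses being convergent.

  \<^emph>\<open>Lower bound.\<close> For a fixed step, the squared negative parts of the difference quotients of
  \<open>u(t, \<sqdot>)\<close> depend continuously on \<open>t\<close> and are dominated in the integral by \<open>(v\<^sup>-)\<^sup>2\<close>; letting the step
  tend to zero at \<open>t = 0\<close> shows that no energy is lost there (lemma \<open>neg_energy_lsc\<close>).

  \<^emph>\<open>Characteristics\<close> enter only through \<open>\<alpha>(t) \<rightarrow> a\<close> and \<open>\<beta>(t) \<rightarrow> b\<close>: for small \<open>t\<close> the moving interval lies
  between a slightly smaller and a slightly larger fixed interval, and the energy of \<open>v(0, \<sqdot>)\<close> is
  absolutely continuous. All arguments need the slope, with a uniform \<open>L\<^sup>2\<close> bound, at every time and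
  not only at almost every time; it is obtained by a closure argument (lemma \<open>primitive_limit_L2\<close>).
\<close>

section \<open>Smooth cut-off functions\<close>

lemma C_k_Suc_D: "C_k (Suc n) f \<Longrightarrow> C_k n f"
proof (induction n arbitrary: f)
  case 0
  then obtain f' where "\<forall>x. (f has_derivative f' x) (at x)" by auto
  then have "\<forall>x. isCont f x" using has_derivative_continuous by blast
  then show ?case by (simp add: continuous_at_imp_continuous_on)
next
  case (Suc n)
  then obtain f' where f': "\<forall>x. (f has_derivative f' x) (at x)" "\<forall>v. C_k (Suc n) (\<lambda>x. f' x v)"
    by auto
  then have "\<forall>v. C_k n (\<lambda>x. f' x v)" using Suc.IH by blast
  then show ?case using f'(1) by auto
qed

lemma C_k_const: "C_k n (\<lambda>x. c)"
proof (induction n arbitrary: c)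
  case (Suc n)
  have "\<forall>x. ((\<lambda>x::'a. c) has_derivative (\<lambda>_. 0)) (at x)" by simp
  then show ?case using Suc.IH[of 0] unfolding C_k.simps by (intro exI[of _ "\<lambda>_ _. 0"]) auto
qed simp

lemma C_k_add: "C_k n f \<Longrightarrow> C_k n g \<Longrightarrow> C_k n (\<lambda>x. f x + g x)"
proof (induction n arbitrary: f g)
  case 0 then show ?case by (auto intro!: continuous_intros)
next
  case (Suc n)
  obtain f' g' where f: "\<forall>x. (f has_derivative f' x) (at x)" "\<forall>v. C_k n (\<lambda>x. f' x v)"
    and g: "\<forall>x. (g has_derivative g' x) (at x)" "\<forall>v. C_k n (\<lambda>x. g' x v)"
    using Suc.prems by auto
  show ?case unfolding C_k.simps
    by (rule exI[of _ "\<lambda>x v. f' x v + g' x v"]) (use f g Suc.IH in \<open>auto intro!: has_derivative_add\<close>)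
qed

lemma C_k_mult: "C_k n f \<Longrightarrow> C_k n g \<Longrightarrow> C_k n (\<lambda>x. f x * g x)"
proof (induction n arbitrary: f g)
  case 0 then show ?case by (auto intro!: continuous_intros)
next
  case (Suc n)
  obtain f' g' where f: "\<forall>x. (f has_derivative f' x) (at x)" "\<forall>v. C_k n (\<lambda>x. f' x v)"
    and g: "\<forall>x. (g has_derivative g' x) (at x)" "\<forall>v. C_k n (\<lambda>x. g' x v)"
    using Suc.prems by auto
  have "C_k n f" "C_k n g" using Suc.prems C_k_Suc_D by auto
  then show ?case unfolding C_k.simps
    by (intro exI[of _ "\<lambda>x v. f x * g' x v + f' x v * g x"])
       (use f g Suc.IH in \<open>auto intro!: has_derivative_mult C_k_add\<close>)
qed

lemma C_k_affine:
  assumes "C_k n f" "bounded_linear L" shows "C_k n (\<lambda>x. f (L x + c))"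
  using assms(1)
proof (induction n arbitrary: f)
  case 0
  have "continuous_on UNIV (\<lambda>x. L x + c)"
    using assms(2) by (intro continuous_intros linear_continuous_on)
  then show ?case using 0 by (auto intro: continuous_on_compose2)
next
  case (Suc n)
  then obtain f' where f: "\<forall>x. (f has_derivative f' x) (at x)" "\<forall>v. C_k n (\<lambda>x. f' x v)" by auto
  have "((\<lambda>x. f (L x + c)) has_derivative (\<lambda>v. f' (L x + c) (L v))) (at x)" for x
  proof -
    have "((\<lambda>x. L x + c) has_derivative L) (at x)"
      using has_derivative_add_const[OF bounded_linear_imp_has_derivative[OF assms(2)]] by blast
    then show ?thesis
      using has_derivative_compose[of "\<lambda>x. L x + c" L x UNIV f "f' (L x + c)"] f(1) by simp
  qed
  moreover have "C_k n (\<lambda>x. f' (L x + c) (L v))" for v using Suc.IH f(2) by blast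
  ultimately show ?case unfolding C_k.simps by (intro exI[of _ "\<lambda>x v. f' (L x + c) (L v)"]) auto
qed

text \<open>The form in which smoothness of \<open>flat_exp\<close> is obtained: a function followed by a chain of derivatives.\<close>

lemma C_k_derivative_sequence:
  assumes "\<And>n x. (F n has_real_derivative F (Suc n) x) (at x)"
  shows "C_k k (F n)"
proof (induction k arbitrary: n)
  case 0
  show ?case using assms DERIV_isCont continuous_at_imp_continuous_on by (metis C_k.simps(1))
next
  case (Suc k)
  have "C_k k (\<lambda>x. F (Suc n) x * v)" for v by (intro C_k_mult Suc.IH C_k_const)
  then show ?case using assms[of n] unfolding C_k.simps has_field_derivative_def
    by (intro exI[of _ "\<lambda>x v. F (Suc n) x * v"]) auto
qed

lemma C_k_antiderivative:
  assumes "\<And>x. (F has_real_derivative f x) (at x)" "\<And>n. C_k n f"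
  shows "C_k n F"
proof (cases n)
  case 0
  show ?thesis using assms(1) DERIV_isCont continuous_at_imp_continuous_on 0 by (metis C_k.simps(1))
next
  case (Suc k)
  have "C_k k (\<lambda>x. f x * v)" for v by (intro C_k_mult assms C_k_const)
  then show ?thesis using assms(1) unfolding C_k.simps has_field_derivative_def Suc
    by (intro exI[of _ "\<lambda>x v. f x * v"]) auto
qed

text \<open>The functions \<open>p(1/x) exp(-1/x)\<close>, extended by zero to \<open>x \<le> 0\<close>, are closed under differentiation;
  this makes \<open>exp(-1/x)\<close> smooth at the origin.\<close>

definition flat_exp :: "real poly \<Rightarrow> real \<Rightarrow> real" where
  "flat_exp p x = (if x > 0 then poly p (1/x) * exp (- (1/x)) else 0)"

lemma poly_times_exp_minus_tendsto_0: "((\<lambda>y::real. poly p y * exp (- y)) \<longlongrightarrow> 0) at_top"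
proof -
  have "((\<lambda>y::real. y ^ k * poly p y * exp (- y)) \<longlongrightarrow> 0) at_top" for k
  proof (induction p arbitrary: k)
    case (pCons a p)
    have "((\<lambda>y::real. a * (y ^ k / exp y) + y ^ Suc k * poly p y * exp (- y)) \<longlongrightarrow> a * 0 + 0) at_top"
      by (intro tendsto_intros tendsto_power_div_exp_0 pCons.IH)
    then show ?case by (simp add: field_simps exp_minus)
  qed simp
  from this[of 0] show ?thesis by simp
qed

lemma flat_exp_deriv:
  "(flat_exp p has_real_derivative flat_exp ([:0,0,1:] * (p - pderiv p)) x) (at x)"
proof -
  consider "x < 0" | "x = 0" | "x > 0" by linarith
  then show ?thesis
  proof cases
    case 1
    have "((\<lambda>x. 0::real) has_real_derivative 0) (at x)" by simp
    then have "(flat_exp p has_real_derivative 0) (at x)"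
      by (rule has_field_derivative_transform_within_open[of _ _ _ "{..<0}"])
         (use 1 in \<open>auto simp: flat_exp_def\<close>)
    then show ?thesis using 1 by (simp add: flat_exp_def)
  next
    case 3
    have "((\<lambda>x. poly p (1/x) * exp (- (1/x))) has_real_derivative
        flat_exp ([:0,0,1:] * (p - pderiv p)) x) (at x)"
      using 3 by (auto intro!: derivative_eq_intros poly_DERIV[THEN DERIV_chain2]
          simp: flat_exp_def field_simps power2_eq_square)
    then show ?thesis
      by (rule has_field_derivative_transform_within_open[of _ _ _ "{0<..}"])
         (use 3 in \<open>auto simp: flat_exp_def\<close>)
  next
    case 2
    have "((\<lambda>h. flat_exp p h / h) \<longlongrightarrow> 0) (at 0)"
    proof (rule filterlim_split_at)
      show "((\<lambda>h. flat_exp p h / h) \<longlongrightarrow> 0) (at_left 0)"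
        by (rule tendsto_eventually) (auto simp: flat_exp_def eventually_at_filter)
      have "((\<lambda>h::real. poly (pCons 0 p) (inverse h) * exp (- (inverse h))) \<longlongrightarrow> 0) (at_right 0)"
        by (rule filterlim_compose[OF poly_times_exp_minus_tendsto_0 filterlim_inverse_at_top_right])
      then show "((\<lambda>h. flat_exp p h / h) \<longlongrightarrow> 0) (at_right 0)"
        by (rule Lim_transform_eventually)
           (auto simp: flat_exp_def eventually_at_filter field_simps)
    qed
    then show ?thesis using 2 unfolding DERIV_def by (simp add: flat_exp_def)
  qed
qed

lemma flat_exp_smooth: "C_k n (flat_exp p)"
proof -
  define P where "P = (\<lambda>n. ((\<lambda>p. [:0,0,1:] * (p - pderiv p)) ^^ n) p)"
  have "(flat_exp (P n) has_real_derivative flat_exp (P (Suc n)) x) (at x)" for n x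
    using flat_exp_deriv[of "P n" x] by (simp add: P_def)
  from C_k_derivative_sequence[of "\<lambda>n. flat_exp (P n)", OF this, of n 0] show ?thesis by (simp add: P_def)
qed

lemma smooth_bump_exists:
  "\<exists>B::real\<Rightarrow>real. (\<forall>n. C_k n B) \<and> (\<forall>x. 0 \<le> B x) \<and> (\<forall>x. x \<notin> {0..1} \<longrightarrow> B x = 0) \<and>
     integral {0..1} B = 1"
proof -
  define b where "b = (\<lambda>x. flat_exp 1 x * flat_exp 1 (- x + 1))"
  have sm: "C_k n b" for n unfolding b_def
    by (intro C_k_mult flat_exp_smooth C_k_affine[where L="\<lambda>x. -x"])
       (simp add: bounded_linear_minus bounded_linear_ident)
  have cont: "continuous_on UNIV b" using sm[of 0] by simp
  have nn: "0 \<le> b x" for x by (simp add: b_def flat_exp_def)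
  have z: "b x = 0" if "x \<notin> {0..1}" for x using that by (auto simp: b_def flat_exp_def)
  have "integral {0..1} b \<noteq> 0"
  proof
    assume "integral {0..1} b = 0"
    moreover have "(b has_integral integral {0..1} b) (cbox 0 1)"
      using cont continuous_on_subset integrable_continuous_interval
      by (metis box_real(2) has_integral_integral subset_UNIV)
    ultimately have "b (1/2) = 0"
      by (intro has_integral_0_cbox_imp_0[of 0 1 b "1/2"])
         (use nn in \<open>auto intro: continuous_on_subset[OF cont]\<close>)
    then show False by (simp add: b_def flat_exp_def)
  qed
  moreover have "0 \<le> integral {0..1} b" by (intro integral_nonneg) (use nn in \<open>auto intro!: integrable_continuous_interval continuous_on_subset[OF cont]\<close>)
  ultimately have pos: "integral {0..1} b > 0" by simp
  have "C_k n (\<lambda>x. b x * (1 / integral {0..1} b))" for n by (intro C_k_mult sm C_k_const)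
  then show ?thesis
    by (intro exI[of _ "\<lambda>x. b x * (1 / integral {0..1} b)"]) (use pos nn z in auto)
qed

definition bump :: "real \<Rightarrow> real" where
  "bump = (SOME B. (\<forall>n. C_k n B) \<and> (\<forall>x. 0 \<le> B x) \<and> (\<forall>x. x \<notin> {0..1} \<longrightarrow> B x = 0) \<and>
     integral {0..1} B = 1)"

lemma bump_smooth: "C_k n bump" and bump_nonneg: "0 \<le> bump x"
  and bump_outside: "x \<notin> {0..1} \<Longrightarrow> bump x = 0" and bump_integral: "integral {0..1} bump = 1"
  using someI_ex[OF smooth_bump_exists] unfolding bump_def[symmetric] by blast+

lemma bump_cont: "continuous_on S bump"
  using bump_smooth[of 0] continuous_on_subset by auto

lemma bump_borel [measurable]: "bump \<in> borel_measurable borel"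
  by (intro borel_measurable_continuous_onI bump_cont)

lemma bump_le: "\<exists>C. \<forall>x. bump x \<le> C"
proof -
  have "compact (bump ` {0..1})" by (intro compact_continuous_image bump_cont) simp
  then obtain C where C: "\<And>x. x \<in> {0..1} \<Longrightarrow> norm (bump x) \<le> C"
    by (metis compact_imp_bounded bounded_iff image_eqI)
  have "bump x \<le> max C 0" for x
    using C[of x] bump_outside[of x] by (cases "x \<in> {0..1}") (auto simp: max_def)
  then show ?thesis by blast
qed

lemma bump_integrable: "integrable lborel bump" and bump_LINT: "(LINT x|lborel. bump x) = 1"
proof -
  have b: "set_integrable lborel {0..1} bump" by (intro borel_integrable_atLeastAtMost' bump_cont)
  have eq: "indicator {0..1} x *\<^sub>R bump x = bump x" for x using bump_outside[of x] by (auto simp: indicator_def)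
  show "integrable lborel bump" using b unfolding set_integrable_def eq .
  have "(LINT x:{0..1}|lborel. bump x) = 1" using set_borel_integral_eq_integral(2)[OF b] bump_integral by simp
  then show "(LINT x|lborel. bump x) = 1" unfolding set_lebesgue_integral_def eq .
qed

definition smooth_step :: "real \<Rightarrow> real" where
  "smooth_step x = (LINT z:{..x}|lborel. bump z)"

lemma smooth_step_0: "x \<le> 0 \<Longrightarrow> smooth_step x = 0"
  and smooth_step_1: "1 \<le> x \<Longrightarrow> smooth_step x = 1"
proof -
  assume x: "x \<le> 0"
  have "smooth_step x = (LINT z::real|lborel. 0)" unfolding smooth_step_def set_lebesgue_integral_def
  proof (intro integral_cong_AE)
    show "AE z in lborel. indicator {..x} z *\<^sub>R bump z = 0"
      using AE_lborel_singleton[of "0::real"] by eventually_elim (use x bump_outside in \<open>auto simp: indicator_def\<close>)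
  qed auto
  then show "smooth_step x = 0" by simp
next
  assume x: "1 \<le> x"
  have "smooth_step x = (LINT z|lborel. bump z)" unfolding smooth_step_def set_lebesgue_integral_def
    by (intro Bochner_Integration.integral_cong) (use x bump_outside in \<open>auto simp: indicator_def\<close>)
  then show "smooth_step x = 1" using bump_LINT by simp
qed

lemma smooth_step_mono: "x \<le> y \<Longrightarrow> smooth_step x \<le> smooth_step y"
  unfolding smooth_step_def set_lebesgue_integral_def
  by (intro integral_mono integrable_mult_indicator bump_integrable) (auto simp: indicator_def bump_nonneg)

lemma smooth_step_range: "0 \<le> smooth_step x" "smooth_step x \<le> 1"
  using smooth_step_mono[of "min x 0" x] smooth_step_mono[of x "max x 1"] smooth_step_0[of "min x 0"] smooth_step_1[of "max x 1"] by auto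

lemma smooth_step_deriv: "(smooth_step has_real_derivative bump x) (at x)"
proof -
  define a where "a = min (x - 1) (- 1)"
  have e: "smooth_step y = integral {a..y} bump" if "y > a" for y
  proof -
    have b: "set_integrable lborel {a..y} bump" by (intro borel_integrable_atLeastAtMost' bump_cont)
    have "smooth_step y = (LINT z:{a..y}|lborel. bump z)"
      unfolding smooth_step_def set_lebesgue_integral_def
      by (intro Bochner_Integration.integral_cong) (auto simp: indicator_def a_def min_def bump_outside split: if_splits)
    then show ?thesis using set_borel_integral_eq_integral(2)[OF b] by simp
  qed
  have "((\<lambda>y. integral {a..y} bump) has_real_derivative bump x) (at x within {a..x+1})"
    by (intro integral_has_real_derivative bump_cont) (auto simp: a_def)
  then have "((\<lambda>y. integral {a..y} bump) has_real_derivative bump x) (at x)"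
    by (subst (asm) at_within_Icc_at) (auto simp: a_def)
  then show ?thesis
    by (rule has_field_derivative_transform_within_open[of _ _ _ "{a<..}"]) (auto simp: e a_def)
qed

lemma smooth_step_smooth: "C_k n smooth_step"
  by (rule C_k_antiderivative[OF smooth_step_deriv bump_smooth])

lemma smooth_step_borel [measurable]: "smooth_step \<in> borel_measurable borel"
  using smooth_step_smooth[of 0] by (intro borel_measurable_continuous_onI) simp

text \<open>A smooth approximation of the indicator of \<open>{a<..b}\<close>: it rises on \<open>[a, a + 1/(n+1)]\<close> and falls on
  \<open>[b, b + 1/(n+1)]\<close>. Both ramps point to the right of the end points, so that a plateau over
  \<open>[s, t]\<close> with \<open>s > 0\<close> is an admissible test function in time.\<close>

definition plateau :: "real \<Rightarrow> real \<Rightarrow> nat \<Rightarrow> real \<Rightarrow> real" where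
  "plateau a b n x = smooth_step (real (Suc n) * (x - a)) - smooth_step (real (Suc n) * (x - b))"

definition plateau' :: "real \<Rightarrow> real \<Rightarrow> nat \<Rightarrow> real \<Rightarrow> real" where
  "plateau' a b n x = real (Suc n) * bump (real (Suc n) * (x - a)) - real (Suc n) * bump (real (Suc n) * (x - b))"

lemma plateau_smooth: "C_k k (plateau a b n)"
proof -
  have "C_k k (\<lambda>x. smooth_step ((\<lambda>x. real (Suc n) * x) x + (- real (Suc n) * c)))" for c
    by (intro C_k_affine smooth_step_smooth bounded_linear_mult_right)
  then have s: "C_k k (\<lambda>x. smooth_step (real (Suc n) * (x - c)))" for c by (simp add: algebra_simps)
  have "C_k k (\<lambda>x. smooth_step (real (Suc n) * (x - a)) + (-1) * smooth_step (real (Suc n) * (x - b)))"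
    by (intro C_k_add C_k_mult s C_k_const)
  then show ?thesis by (simp add: plateau_def[abs_def])
qed

lemma plateau_deriv: "(plateau a b n has_real_derivative plateau' a b n x) (at x)"
  unfolding plateau_def[abs_def] plateau'_def
  by (auto intro!: derivative_eq_intros smooth_step_deriv[THEN DERIV_chain2])

lemma plateau_range: "a \<le> b \<Longrightarrow> 0 \<le> plateau a b n x" "plateau a b n x \<le> 1"
proof -
  show "0 \<le> plateau a b n x" if "a \<le> b"
    unfolding plateau_def using that by (auto intro!: smooth_step_mono mult_left_mono)
  show "plateau a b n x \<le> 1" using smooth_step_range[of "real (Suc n) * (x - a)"] smooth_step_range[of "real (Suc n) * (x - b)"]
    unfolding plateau_def by simp
qed

lemma plateau_outside: assumes "a \<le> b" "x \<notin> {a..b + 1 / real (Suc n)}" shows "plateau a b n x = 0"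
proof (cases "x < a")
  case True
  then have "real (Suc n) * (x - a) \<le> 0" "real (Suc n) * (x - b) \<le> 0"
    using assms(1) by (auto intro!: mult_nonneg_nonpos)
  then show ?thesis by (simp add: plateau_def smooth_step_0)
next
  case False
  then have "x > b + 1 / real (Suc n)" using assms by auto
  then have "real (Suc n) * (x - b) \<ge> 1" by (simp add: field_simps)
  moreover have "real (Suc n) * (x - b) \<le> real (Suc n) * (x - a)" using assms by (intro mult_left_mono) auto
  ultimately have "real (Suc n) * (x - a) \<ge> 1" by linarith
  with \<open>real (Suc n) * (x - b) \<ge> 1\<close> show ?thesis unfolding plateau_def by (simp only: smooth_step_1)
qed

lemma plateau_outside_ge: "a \<le> b \<Longrightarrow> x \<notin> {a..b+1} \<Longrightarrow> plateau a b n x = 0"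
proof -
  assume ab: "a \<le> b" and x: "x \<notin> {a..b+1}"
  have n1: "1 / real (Suc n) \<le> 1" by simp
  show ?thesis by (intro plateau_outside[OF ab]) (use n1 x in \<open>auto simp del: of_nat_Suc intro: order_trans\<close>)
qed

lemma scaled_bump_zero: "x \<notin> {c..c+1} \<Longrightarrow> bump (real (Suc n) * (x - c)) = 0"
proof (rule bump_outside)
  assume x: "x \<notin> {c..c+1}"
  show "real (Suc n) * (x - c) \<notin> {0..1}"
  proof
    assume a: "real (Suc n) * (x - c) \<in> {0..1}"
    then have "0 \<le> x - c" by (auto simp: zero_le_mult_iff)
    moreover from this have "1 * (x - c) \<le> real (Suc n) * (x - c)" by (intro mult_right_mono) auto
    ultimately show False using a x by auto
  qed
qed

lemma plateau'_outside_ge: "a \<le> b \<Longrightarrow> x \<notin> {a..b+1} \<Longrightarrow> plateau' a b n x = 0"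
  unfolding plateau'_def using scaled_bump_zero[of x a n] scaled_bump_zero[of x b n] by auto

lemma plateau_continuous: "continuous_on S (plateau a b n)" "continuous_on S (plateau' a b n)"
proof -
  show "continuous_on S (plateau a b n)" using plateau_deriv by (metis DERIV_isCont continuous_at_imp_continuous_on)
  show "continuous_on S (plateau' a b n)" unfolding plateau'_def[abs_def]
    by (intro continuous_intros continuous_on_compose2[OF bump_cont[of UNIV]]) auto
qed

lemma plateau_inside: assumes "x \<in> {a + 1 / real (Suc n)..b}" shows "plateau a b n x = 1"
proof -
  have "real (Suc n) * (x - a) \<ge> 1" using assms by (simp add: field_simps)
  moreover have "real (Suc n) * (x - b) \<le> 0" using assms by (auto intro!: mult_nonneg_nonpos)
  ultimately show ?thesis by (simp add: plateau_def smooth_step_0 smooth_step_1)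
qed

lemma plateau_tendsto: assumes "a \<le> b"
  shows "(\<lambda>n. plateau a b n x) \<longlonglongrightarrow> indicator {a<..b} x"
proof (cases "x \<in> {a<..b}")
  case True
  then have "eventually (\<lambda>n. 1 / real (Suc n) < x - a) sequentially"
    using LIMSEQ_inverse_real_of_nat[THEN order_tendstoD(2), of "x - a"] by (simp add: inverse_eq_divide)
  then have "eventually (\<lambda>n. plateau a b n x = 1) sequentially"
    by eventually_elim (use True in \<open>auto intro!: plateau_inside\<close>)
  then show ?thesis using True by (auto intro: tendsto_eventually)
next
  case False
  show ?thesis
  proof (cases "x \<le> a")
    case True
    then have "plateau a b n x = 0" for n
      using assms by (auto simp: plateau_def intro!: smooth_step_0 smooth_step_0[symmetric] mult_nonneg_nonpos trans[OF smooth_step_0 smooth_step_0[symmetric]])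
    then show ?thesis using False by simp
  next
    case xa: False
    then have "eventually (\<lambda>n. 1 / real (Suc n) < x - b) sequentially"
      using LIMSEQ_inverse_real_of_nat[THEN order_tendstoD(2), of "x - b"] False by (simp add: inverse_eq_divide)
    then have "eventually (\<lambda>n. plateau a b n x = 0) sequentially"
      by eventually_elim (use assms in \<open>auto intro!: plateau_outside\<close>)
    then show ?thesis using False by (auto intro: tendsto_eventually)
  qed
qed

lemma plateau_borel [measurable]: "plateau a b n \<in> borel_measurable borel" "plateau' a b n \<in> borel_measurable borel"
  unfolding plateau_def[abs_def] plateau'_def[abs_def] by measurable

lemma plateau_test_function:
  assumes "a \<le> b" "{a..b + 1 / real (Suc n)} \<subseteq> U"
  shows "test_function U (plateau a b n)"
  unfolding test_function_def
  by (intro conjI allI exI[of _ "{a..b + 1 / real (Suc n)}"] plateau_smooth impI plateau_outside)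
     (use assms in auto)

section \<open>Primitives of locally integrable functions\<close>

text \<open>Absolute continuity with Borel derivative \<open>v\<close>. This replaces the weak derivative throughout,
  because it can be evaluated on intervals and does not involve test functions.\<close>

definition primitive :: "(real \<Rightarrow> real) \<Rightarrow> (real \<Rightarrow> real) \<Rightarrow> bool" where
  "primitive f v \<longleftrightarrow> v \<in> borel_measurable borel \<and>
     (\<forall>x y. x \<le> y \<longrightarrow> set_integrable lborel {x..y} v \<and> (LBINT z:{x..y}. v z) = f y - f x)"

lemma primitiveD:
  assumes "primitive f v"
  shows "v \<in> borel_measurable borel" "set_integrable lborel {x..y} v"
    "x \<le> y \<Longrightarrow> (LBINT z:{x..y}. v z) = f y - f x"
proof -
  show "set_integrable lborel {x..y} v"
    using assms by (cases "x \<le> y") (auto simp: primitive_def)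
qed (use assms in \<open>auto simp: primitive_def\<close>)

lemma primitive_integral:
  assumes "primitive f v" "x \<le> y"
  shows "v integrable_on {x..y}" "integral {x..y} v = f y - f x"
  using set_borel_integral_eq_integral[OF primitiveD(2)[OF assms(1)]] primitiveD(3)[OF assms] by auto

lemma primitive_continuous: assumes "primitive f v" shows "continuous_on S f"
proof -
  have "isCont f x" for x
  proof -
    have "continuous_on {x-1..x+1} (\<lambda>y. f (x-1) + integral {x-1..y} v)"
      by (intro continuous_intros indefinite_integral_continuous_1 primitive_integral[OF assms]) auto
    then have "continuous_on {x-1..x+1} f"
      by (rule continuous_on_eq) (use primitive_integral[OF assms] in auto)
    then show ?thesis by (rule continuous_on_interior) auto
  qed
  then show ?thesis by (simp add: continuous_at_imp_continuous_on)
qed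

lemma primitive_add:
  assumes "primitive f v" "primitive g w" shows "primitive (\<lambda>x. f x + g x) (\<lambda>x. v x + w x)"
  using assms unfolding primitive_def by (auto simp: set_integral_add)

lemma primitive_cmult:
  assumes "primitive f v" shows "primitive (\<lambda>x. c * f x) (\<lambda>x. c * v x)"
  using assms unfolding primitive_def by (auto simp: right_diff_distrib)

lemma LBINT_FTC:
  assumes "\<And>x. (F has_real_derivative f x) (at x)" "continuous_on UNIV f"
  shows "set_integrable lborel {a..b} f" "a \<le> b \<Longrightarrow> (LBINT x:{a..b}. f x) = F b - F a"
proof -
  show "set_integrable lborel {a..b} f"
    by (intro borel_integrable_atLeastAtMost' continuous_on_subset[OF assms(2)]) auto
  assume "a \<le> b"
  then have "(LBINT x. indicator {a .. b} x *\<^sub>R f x) = F b - F a"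
    by (intro integral_FTC_Icc continuous_on_subset[OF assms(2)])
       (auto simp: has_real_derivative_iff_has_vector_derivative[symmetric] intro!: has_field_derivative_at_within assms)
  then show "(LBINT x:{a..b}. f x) = F b - F a" by (simp add: set_lebesgue_integral_def)
qed

lemma primitive_C1:
  assumes "\<And>x. (F has_real_derivative f x) (at x)" "continuous_on UNIV f"
  shows "primitive F f"
  using LBINT_FTC[OF assms] assms(2) borel_measurable_continuous_onI unfolding primitive_def by blast

lemma antiderivative_exists:
  assumes "continuous_on UNIV (f::real\<Rightarrow>real)"
  obtains F where "\<And>x. (F has_real_derivative f x) (at x)"
proof -
  have "isCont f x" for x using assms by (simp add: continuous_on_eq_continuous_at)
  then have "\<exists>F. \<forall>x::real. -\<infinity> < ereal x \<longrightarrow> ereal x < \<infinity> \<longrightarrow> (F has_vector_derivative f x) (at x)"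
    by (intro einterval_antiderivative) auto
  then show ?thesis using that by (auto simp: has_real_derivative_iff_has_vector_derivative)
qed

lemma primitive_exists:
  assumes [measurable]: "v \<in> borel_measurable borel" and "\<And>x y. set_integrable lborel {x..y} (v::real\<Rightarrow>real)"
  obtains f where "primitive f v"
proof -
  define f where "f x = (if 0 \<le> x then LBINT z:{0..x}. v z else - (LBINT z:{x..0}. v z))" for x
  have add: "(LBINT z:{x..z}. v z) = (LBINT z:{x..y}. v z) + (LBINT z:{y..z}. v z)" if "x \<le> y" "y \<le> z" for x y z
  proof -
    have "(LBINT u:{x..y} \<union> {y..z}. v u) = (LBINT u:{x..y}. v u) + (LBINT u:{y..z}. v u)"
    proof (rule set_integral_Un_AE)
      show "AE u in lborel. \<not> (u \<in> {x..y} \<and> u \<in> {y..z})"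
        using AE_lborel_singleton[of y] by eventually_elim auto
    qed (use assms in auto)
    moreover have "{x..y} \<union> {y..z} = {x..z}" using that by auto
    ultimately show ?thesis by simp
  qed
  have z0: "(LBINT z:{0..0}. v z) = 0"
    using add[of 0 0 0] by simp
  have "(LBINT z:{x..y}. v z) = f y - f x" if "x \<le> y" for x y
  proof -
    consider "0 \<le> x" | "x < 0" "0 \<le> y" | "y < 0" by linarith
    then show ?thesis
    proof cases
      case 1 then show ?thesis using add[of 0 x y] that by (simp add: f_def)
    next
      case 2 then show ?thesis using add[of x 0 y] that by (simp add: f_def)
    next
      case 3 then show ?thesis using add[of x y 0] that z0 by (auto simp: f_def)
    qed
  qed
  then show ?thesis using that assms unfolding primitive_def by blast
qed

lemma primitive_of_integrable:
  assumes "integrable lborel (g::real\<Rightarrow>real)" "g \<in> borel_measurable borel"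
  obtains G where "primitive G g"
proof (rule primitive_exists[OF assms(2)])
  show "set_integrable lborel {x..y} g" for x y
    unfolding set_integrable_def using assms(1) by (intro integrable_mult_indicator) auto
qed

text \<open>This is Lebesgue's differentiation theorem for cubes with corner \<open>x\<close>; the left derivative follows
  by reflection.\<close>

lemma primitive_AE_right_deriv:
  assumes "primitive f v"
  shows "AE x in lborel. ((\<lambda>h. (f (x + h) - f x) / h) \<longlongrightarrow> v x) (at_right 0)"
proof -
  have "v integrable_on cbox a b" for a b
    using primitive_integral(1)[OF assms, of a b] by (cases "a \<le> b") auto
  then obtain N where N: "negligible N"
    "\<And>x e. \<lbrakk>x \<notin> N; 0 < e\<rbrakk> \<Longrightarrow> \<exists>d>0. \<forall>h. 0 < h \<and> h < d \<longrightarrow>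
        norm (integral (cbox x (x + h *\<^sub>R One)) v /\<^sub>R h ^ DIM(real) - v x) < e"
    by (rule integrable_ccontinuous_explicit) blast
  have "AE x in lebesgue. x \<notin> N"
    using N(1) by (intro AE_not_in) (simp add: negligible_iff_null_sets)
  then have "AE x in lborel. x \<notin> N" by (simp add: AE_completion_iff)
  then show ?thesis
  proof eventually_elim
    case (elim x)
    show ?case unfolding tendsto_iff
    proof (intro allI impI)
      fix e :: real assume "0 < e"
      from N(2)[OF elim this] obtain d where d: "d > 0" "\<And>h. 0 < h \<Longrightarrow> h < d \<Longrightarrow>
        norm (integral (cbox x (x + h *\<^sub>R One)) v /\<^sub>R h ^ DIM(real) - v x) < e" by blast
      have "dist ((f (x + h) - f x) / h) (v x) < e" if "0 < h" "h < d" for h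
        using d(2)[OF that] primitive_integral(2)[OF assms, of x "x+h"] that
        by (simp add: dist_real_def divide_inverse mult.commute)
      then show "\<forall>\<^sub>F h in at_right 0. dist ((f (x + h) - f x) / h) (v x) < e"
        unfolding eventually_at_right_field using d(1) by auto
    qed
  qed
qed

lemma primitive_reflect:
  assumes "primitive f v" shows "primitive (\<lambda>x. - f (- x)) (\<lambda>x. v (- x))"
proof -
  note [measurable] = primitiveD(1)[OF assms]
  have i: "indicator {x..y} (- z) = (indicator {-y..-x} z :: real)" for x y z :: real by (auto simp: indicator_def)
  have "set_integrable lborel {x..y} (\<lambda>x. v (- x))" for x y
    using primitiveD(2)[OF assms, of "-y" "-x"] unfolding set_integrable_def
    by (subst lborel_integrable_real_affine_iff[of "-1" _ 0, symmetric]) (simp_all add: i)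
  moreover have "(LBINT z:{x..y}. v (- z)) = - f (- y) + f (- x)" if "x \<le> y" for x y
    using primitiveD(3)[OF assms, of "-y" "-x"] that unfolding set_lebesgue_integral_def
    by (subst lborel_integral_real_affine[of "-1" _ 0]) (simp_all add: i)
  ultimately show ?thesis unfolding primitive_def by simp
qed

lemma primitive_AE_deriv:
  assumes "primitive f v"
  shows "AE x in lborel. (f has_real_derivative v x) (at x)"
proof -

  define P where "P x \<longleftrightarrow> ((\<lambda>h. (- f (- (x + h)) + f (- x)) / h) \<longlongrightarrow> v (- x)) (at_right 0)" for x
  have "AE x in lborel. P x"
    using primitive_AE_right_deriv[OF primitive_reflect[OF assms]] by (simp add: P_def)
  then obtain N where N: "N \<in> null_sets lborel" "{x \<in> space lborel. \<not> P x} \<subseteq> N"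
    unfolding eventually_ae_filter by blast
  have "negligible N" using N(1) by (simp add: negligible_iff_null_sets null_sets_completionI)
  then have "negligible (uminus ` N)"
    by (rule negligible_differentiable_image_negligible[rotated])
       (auto intro!: differentiable_on_minus differentiable_on_id[unfolded id_def] simp: differentiable_on_ident)
  then have "AE x in lborel. x \<notin> uminus ` N"
    by (metis AE_completion_iff AE_not_in negligible_iff_null_sets)
  with primitive_AE_right_deriv[OF assms] show ?thesis
  proof eventually_elim
    case (elim x)
    then have "- x \<notin> N" by (metis image_eqI minus_minus)
    then have "P (- x)" using N(2) by auto
    then have "((\<lambda>h. (- f (- (- x + h)) + f (- (- x))) / h) \<longlongrightarrow> v (- (- x))) (at_right 0)"
      unfolding P_def .
    then have l: "((\<lambda>h. (- f (x - h) + f x) / h) \<longlongrightarrow> v x) (at_right 0)" by simp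
    have "((\<lambda>h. (f (x + h) - f x) / h) \<longlongrightarrow> v x) (at_left 0)"
      unfolding filterlim_at_left_to_right using l
      by (simp, elim filterlim_cong[THEN iffD1, rotated 3]) (auto intro!: always_eventually simp: minus_divide_left)
    with elim(1) show ?case unfolding DERIV_def by (intro filterlim_split_at)
  qed
qed



text \<open>If \<open>\<Phi>'' = v\<close>, this is the average of \<open>v\<close> over \<open>[x - h, x + h]\<close> weighted by a hat function.\<close>

definition second_diff :: "real \<Rightarrow> (real \<Rightarrow> real) \<Rightarrow> real \<Rightarrow> real" where
  "second_diff h \<Phi> x = (\<Phi> (x + h) - 2 * \<Phi> x + \<Phi> (x - h)) / h\<^sup>2"

text \<open>Cauchy's mean value theorem in the variable \<open>h\<close>, comparing with \<open>h\<^sup>2\<close>. It transfers bounds and limits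
  from symmetric first differences of \<open>\<Phi>'\<close> to second differences of \<open>\<Phi>\<close>, where \<open>\<Phi>''\<close> need not exist.\<close>

lemma second_diff_mean:
  assumes d: "\<And>x. (\<Phi> has_real_derivative f x) (at x)" and h: "h > 0"
  obtains s where "0 < s" "s < h" "second_diff h \<Phi> x = (f (x + s) - f (x - s)) / (2 * s)"
proof -
  have dA: "((\<lambda>s. \<Phi> (x + s) + \<Phi> (x - s)) has_real_derivative (f (x + s) - f (x - s))) (at s)" for s
    by (auto intro!: derivative_eq_intros d[THEN DERIV_chain2])
  have dB: "((\<lambda>s. s\<^sup>2) has_real_derivative 2 * s) (at s)" for s :: real
    by (auto intro!: derivative_eq_intros)
  have "\<exists>c. 0 < c \<and> c < h \<and> ((\<Phi> (x + h) + \<Phi> (x - h)) - (\<Phi> (x + 0) + \<Phi> (x - 0))) * (2 * c)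
      = (h\<^sup>2 - 0\<^sup>2) * (f (x + c) - f (x - c))"
    by (rule GMVT') (use h dA dB in \<open>auto intro: DERIV_isCont\<close>)
  then obtain c where c: "0 < c" "c < h" "(\<Phi> (x + h) + \<Phi> (x - h) - 2 * \<Phi> x) * (2 * c)
      = h\<^sup>2 * (f (x + c) - f (x - c))" by auto
  have "second_diff h \<Phi> x = (f (x + c) - f (x - c)) / (2 * c)"
    using c h unfolding second_diff_def by (simp add: field_simps)
  with c that show ?thesis by blast
qed

lemma second_diff_tendsto:
  assumes d: "\<And>x. (\<Phi> has_real_derivative f x) (at x)" and f: "(f has_real_derivative y) (at x)"
    and h: "\<And>n. h n > 0" "h \<longlonglongrightarrow> 0"
  shows "(\<lambda>n. second_diff (h n) \<Phi> x) \<longlonglongrightarrow> y"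
proof -
  have "\<forall>n. \<exists>s. 0 < s \<and> s < h n \<and> second_diff (h n) \<Phi> x = (f (x + s) - f (x - s)) / (2 * s)"
    using second_diff_mean[OF d h(1)] by metis
  then obtain s where s: "\<And>n. 0 < s n" "\<And>n. s n < h n" "\<And>n. second_diff (h n) \<Phi> x = (f (x + s n) - f (x - s n)) / (2 * s n)"
    by metis
  have s0: "s \<longlonglongrightarrow> 0"
    by (rule tendsto_sandwich[OF _ _ tendsto_const h(2)]) (use s in \<open>auto intro!: always_eventually less_imp_le\<close>)
  have fd: "((\<lambda>h. (f (x + h) - f x) / h) \<longlongrightarrow> y) (at 0)" using f unfolding DERIV_def .
  have "filterlim s (at 0) sequentially" "filterlim (\<lambda>n. - s n) (at 0) sequentially"
    using s(1) s0 tendsto_minus[OF s0] unfolding filterlim_at by (auto intro!: always_eventually simp: less_imp_neq[symmetric] order.strict_implies_not_eq)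
  from this[THEN filterlim_compose[OF fd]]
  have "(\<lambda>n. ((f (x + s n) - f x) / s n + (f (x + - s n) - f x) / - s n) / 2) \<longlonglongrightarrow> (y + y) / 2"
    by (intro tendsto_intros) auto
  moreover have "((f (x + s n) - f x) / s n + (f (x + - s n) - f x) / - s n) / 2 = second_diff (h n) \<Phi> x" for n
    using s(1)[of n] unfolding s(3) by (simp add: field_simps)
  ultimately show ?thesis by simp
qed

lemma quot_tendsto:
  assumes f: "(f has_real_derivative y) (at x)"
    and h: "\<And>n. h n > 0" "h \<longlonglongrightarrow> 0"
  shows "(\<lambda>n. (f (x + h n) - f x) / h n) \<longlonglongrightarrow> y" "(\<lambda>n. (f x - f (x - h n)) / h n) \<longlonglongrightarrow> y"
proof -
  have fd: "((\<lambda>h. (f (x + h) - f x) / h) \<longlongrightarrow> y) (at 0)" using f unfolding DERIV_def .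
  have l: "filterlim h (at 0) sequentially" "filterlim (\<lambda>n. - h n) (at 0) sequentially"
    using h tendsto_minus[OF h(2)] unfolding filterlim_at by (auto intro!: always_eventually simp: less_imp_neq[symmetric] order.strict_implies_not_eq)
  show "(\<lambda>n. (f (x + h n) - f x) / h n) \<longlonglongrightarrow> y"
    using filterlim_compose[OF fd l(1)] .
  show "(\<lambda>n. (f x - f (x - h n)) / h n) \<longlonglongrightarrow> y"
    using filterlim_compose[OF fd l(2)] by (simp add: minus_divide_left)
qed

lemma second_diff_continuous: assumes "continuous_on UNIV \<Phi>" shows "continuous_on S (second_diff h \<Phi>)"
proof (cases "h = 0")
  case False
  have "continuous_on S (\<lambda>x. \<Phi> (x + c))" "continuous_on S (\<lambda>x. \<Phi> (x - c))" "continuous_on S \<Phi>" for c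
    by (rule continuous_on_compose2[OF assms]; auto intro!: continuous_intros)
       (rule continuous_on_compose2[OF assms]; auto intro!: continuous_intros continuous_on_subset[OF assms])+
  then show ?thesis unfolding second_diff_def[abs_def] using False by (intro continuous_intros) auto
qed (simp add: second_diff_def[abs_def])

lemma second_diff_deriv:
  assumes "\<And>x. (\<Phi> has_real_derivative f x) (at x)"
  shows "(second_diff h \<Phi> has_real_derivative second_diff h f x) (at x)"
proof -
  have "((\<lambda>x. \<Phi> (x + c)) has_real_derivative f (x + c)) (at x)" for c x
    by (rule DERIV_chain2[OF assms, THEN DERIV_cong]) (auto intro!: derivative_eq_intros)
  from this[of h] this[of "-h"] assms
  have "((\<lambda>x. \<Phi> (x + h) - 2 * \<Phi> x + \<Phi> (x - h)) has_real_derivative f (x + h) - 2 * f x + f (x - h)) (at x)"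
    by (intro DERIV_add DERIV_diff DERIV_cmult) auto
  then show ?thesis unfolding second_diff_def[abs_def] by (intro DERIV_cdivide)
qed

section \<open>Weak derivatives on the real line\<close>

lemma integrable_Icc_const: "integrable lborel (\<lambda>x::real. indicator {A..B} x * (K::real))"
  by (intro integrable_mult_left integrable_real_indicator) (auto simp: emeasure_lborel_Icc_eq)

lemma bounded_Icc_integrable:
  fixes g :: "real \<Rightarrow> real"
  assumes [measurable]: "g \<in> borel_measurable borel" and K: "\<And>x. x \<in> {A..B} \<Longrightarrow> \<bar>g x\<bar> \<le> K"
  shows "set_integrable lborel {A..B} g"
proof -
  have "norm (indicator {A..B} x *\<^sub>R g x) \<le> norm (indicator {A..B} x * K)" for x
    using order_trans[OF K abs_ge_self] by (auto simp: indicator_def)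
  then show ?thesis unfolding set_integrable_def
    by (intro Bochner_Integration.integrable_bound[OF integrable_Icc_const[of A B K]] always_eventually) auto
qed

lemma Icc_integral_abs_le:
  fixes g :: "real \<Rightarrow> real"
  assumes g: "g \<in> borel_measurable borel" and K: "\<And>x. x \<in> {A..B} \<Longrightarrow> \<bar>g x\<bar> \<le> K" and AB: "A \<le> B"
  shows "\<bar>LBINT x:{A..B}. g x\<bar> \<le> K * (B - A)"
proof -
  have "\<bar>LBINT x:{A..B}. g x\<bar> \<le> (LBINT x. \<bar>indicator {A..B} x *\<^sub>R g x\<bar>)"
    unfolding set_lebesgue_integral_def by (rule integral_abs_bound)
  also have "\<dots> \<le> (LBINT x. indicator {A..B} x * K)"
  proof (rule integral_mono)
    show "integrable lborel (\<lambda>x. \<bar>indicator {A..B} x *\<^sub>R g x\<bar>)"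
      using bounded_Icc_integrable[OF g K] unfolding set_integrable_def by (rule integrable_abs)
    show "integrable lborel (\<lambda>x. indicator {A..B} x * K)" by (rule integrable_Icc_const)
  qed (use K in \<open>auto simp: indicator_def\<close>)
  also have "\<dots> = K * (B - A)" using AB by (simp add: mult.commute)
  finally show ?thesis .
qed

lemma integrable_compact_support:
  fixes f :: "real \<Rightarrow> real"
  assumes "continuous_on UNIV f" "\<And>x. x \<notin> {a..b} \<Longrightarrow> f x = 0"
  shows "integrable lborel f" "(LBINT x. f x) = (LBINT x:{a..b}. f x)"
proof -
  have eq: "indicator {a..b} x *\<^sub>R f x = f x" for x using assms(2)[of x] by (auto simp: indicator_def)
  have "set_integrable lborel {a..b} f"
    by (intro borel_integrable_atLeastAtMost' continuous_on_subset[OF assms(1)]) auto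
  then show "integrable lborel f" unfolding set_integrable_def eq .
  show "(LBINT x. f x) = (LBINT x:{a..b}. f x)" unfolding set_lebesgue_integral_def eq ..
qed

lemma scaled_bump_integral_tendsto:
  assumes [measurable]: "g \<in> borel_measurable borel"
    and K: "\<And>x. x \<in> {a..a+1} \<Longrightarrow> \<bar>g x\<bar> \<le> K" and cont: "isCont g a"
  shows "(\<lambda>n. LBINT x. real (Suc n) * bump (real (Suc n) * (x - a)) * g x) \<longlonglongrightarrow> g a"
proof -
  have "(\<lambda>n. LBINT y. bump y * g (a + 1 / real (Suc n) * y)) \<longlonglongrightarrow> (LBINT y. bump y * g a)"
  proof (rule integral_dominated_convergence[where w="\<lambda>y. bump y * K"])
    show "integrable lborel (\<lambda>y. bump y * K)" using bump_integrable by simp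
    show "AE y in lborel. (\<lambda>n. bump y * g (a + 1 / real (Suc n) * y)) \<longlonglongrightarrow> bump y * g a"
    proof (intro always_eventually allI tendsto_intros)
      fix y :: real
      have "(\<lambda>n. a + 1 / real (Suc n) * y) \<longlonglongrightarrow> a + 0 * y"
        using LIMSEQ_inverse_real_of_nat by (intro tendsto_intros) (simp add: inverse_eq_divide)
      then show "(\<lambda>n. g (a + 1 / real (Suc n) * y)) \<longlonglongrightarrow> g a"
        using isCont_tendsto_compose[OF cont] by simp
    qed
    show "AE y in lborel. norm (bump y * g (a + 1 / real (Suc n) * y)) \<le> bump y * K" for n
    proof (intro always_eventually allI)
      fix y :: real
      show "norm (bump y * g (a + 1 / real (Suc n) * y)) \<le> bump y * K"
      proof (cases "y \<in> {0..1}")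
        case True
        have "1 / real (Suc n) * y \<le> 1 * 1" using True by (intro mult_mono) auto
        then have "\<bar>g (a + 1 / real (Suc n) * y)\<bar> \<le> K" using True by (intro K) auto
        then show ?thesis using bump_nonneg[of y] by (simp add: abs_mult mult_left_mono)
      qed (simp add: bump_outside)
    qed
  qed auto
  moreover have "(LBINT x. real (Suc n) * bump (real (Suc n) * (x - a)) * g x)
      = (LBINT y. bump y * g (a + 1 / real (Suc n) * y))" for n
    by (subst lborel_integral_real_affine[of "1 / real (Suc n)" _ a]) (auto simp flip: integral_mult_right_zero simp del: of_nat_Suc)
  ultimately show ?thesis using bump_LINT by simp
qed

lemma set_integral_Ioc_Icc:
  fixes g :: "real \<Rightarrow> real"
  shows "g \<in> borel_measurable borel \<Longrightarrow> (LBINT x:{a<..b}. g x) = (LBINT x:{a..b}. g x)"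
  unfolding set_lebesgue_integral_def
proof (rule integral_cong_AE)
  show "AE x in lborel. indicator {a<..b} x *\<^sub>R g x = indicator {a..b} x *\<^sub>R g x"
    using AE_lborel_singleton[of a] by eventually_elim (auto simp: indicator_def)
qed auto

lemma integral_plateau_tendsto:
  assumes [measurable]: "g \<in> borel_measurable borel" and g: "set_integrable lborel {a..b+1} g" and ab: "a \<le> b"
  shows "(\<lambda>n. LBINT x. g x * plateau a b n x) \<longlonglongrightarrow> (LBINT x:{a..b}. g x)"
proof -
  have "(\<lambda>n. LBINT x. g x * plateau a b n x) \<longlonglongrightarrow> (LBINT x. g x * indicator {a<..b} x)"
  proof (rule integral_dominated_convergence[where w="\<lambda>x. \<bar>indicator {a..b+1} x *\<^sub>R g x\<bar>"])
    show "integrable lborel (\<lambda>x. \<bar>indicator {a..b+1} x *\<^sub>R g x\<bar>)"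
      using g unfolding set_integrable_def by (rule integrable_abs)
    show "AE x in lborel. (\<lambda>n. g x * plateau a b n x) \<longlonglongrightarrow> g x * indicator {a<..b} x"
      by (intro always_eventually allI tendsto_intros plateau_tendsto ab)
    show "AE x in lborel. norm (g x * plateau a b n x) \<le> \<bar>indicator {a..b+1} x *\<^sub>R g x\<bar>" for n
    proof (intro always_eventually allI)
      fix x
      have "x \<notin> {a..b+1} \<Longrightarrow> plateau a b n x = 0" by (rule plateau_outside_ge[OF ab])
      moreover have "\<bar>g x\<bar> * \<bar>plateau a b n x\<bar> \<le> \<bar>g x\<bar> * 1"
        using plateau_range(1)[OF ab, of n x] plateau_range(2)[of a b n x] by (intro mult_left_mono) auto
      ultimately show "norm (g x * plateau a b n x) \<le> \<bar>indicator {a..b+1} x *\<^sub>R g x\<bar>"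
        by (auto simp: indicator_def abs_mult)
    qed
  qed auto
  moreover have "(LBINT x. g x * indicator {a<..b} x) = (LBINT x:{a..b}. g x)"
    using set_integral_Ioc_Icc[of g a b] by (simp add: set_lebesgue_integral_def mult.commute)
  ultimately show ?thesis by simp
qed

lemma integral_plateau'_tendsto:
  assumes f: "continuous_on UNIV f"
  shows "(\<lambda>n. LBINT x. f x * plateau' a b n x) \<longlonglongrightarrow> f a - f b"
proof -
  have [measurable]: "f \<in> borel_measurable borel" using f by (rule borel_measurable_continuous_onI)
  have "\<exists>K. \<forall>x\<in>{c..c+1}. \<bar>f x\<bar> \<le> K" for c
  proof -
    have "compact (f ` {c..c+1})" by (intro compact_continuous_image continuous_on_subset[OF f]) auto
    then show ?thesis using compact_imp_bounded bounded_iff by (metis image_eqI real_norm_def)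
  qed
  then have lim: "(\<lambda>n. LBINT x. real (Suc n) * bump (real (Suc n) * (x - c)) * f x) \<longlonglongrightarrow> f c" for c
    using scaled_bump_integral_tendsto[of f c] f by (metis UNIV_I continuous_on_eq_continuous_at measurable_lborel1 open_UNIV \<open>f \<in> borel_measurable borel\<close>)
  have int: "integrable lborel (\<lambda>x. real (Suc n) * bump (real (Suc n) * (x - c)) * f x)" for n c
  proof (rule integrable_compact_support(1)[of _ c "c + 1"])
    show "continuous_on UNIV (\<lambda>x. real (Suc n) * bump (real (Suc n) * (x - c)) * f x)"
      by (intro continuous_intros f continuous_on_compose2[OF bump_cont]) auto
    show "real (Suc n) * bump (real (Suc n) * (x - c)) * f x = 0" if "x \<notin> {c..c + 1}" for x
      using scaled_bump_zero[OF that, of n] by simp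
  qed
  have "(LBINT x. f x * plateau' a b n x) = (LBINT x. real (Suc n) * bump (real (Suc n) * (x - a)) * f x)
      - (LBINT x. real (Suc n) * bump (real (Suc n) * (x - b)) * f x)" for n
    by (subst Bochner_Integration.integral_diff[symmetric, OF int int]) (simp add: plateau'_def algebra_simps)
  then show ?thesis using tendsto_diff[OF lim[of a] lim[of b]] by simp
qed

text \<open>Testing with plateaus turns a weak identity into the fundamental theorem of calculus: the derivative
  of the plateau concentrates at the end points of the interval. It serves for the weak derivative in
  space and twice for the equation on rectangles.\<close>

lemma weak_identity_imp_increment:
  assumes f: "continuous_on UNIV f" and g: "g \<in> borel_measurable borel" "set_integrable lborel {a..b+1} g" and ab: "a \<le> b"
    and weak: "\<And>n. (LBINT x. f x * plateau' a b n x) = - (LBINT x. g x * plateau a b n x)"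
  shows "(LBINT x:{a..b}. g x) = f b - f a"
proof -
  have "(\<lambda>n. - (LBINT x. f x * plateau' a b n x)) \<longlonglongrightarrow> - (f a - f b)"
    by (intro tendsto_minus integral_plateau'_tendsto f)
  then have "(\<lambda>n. LBINT x. g x * plateau a b n x) \<longlonglongrightarrow> f b - f a" by (simp add: weak)
  then show ?thesis using LIMSEQ_unique[OF integral_plateau_tendsto[OF g ab]] by simp
qed

lemma deriv_plateau: "deriv (plateau a b n) = plateau' a b n"
  using plateau_deriv by (auto intro!: DERIV_imp_deriv)

lemma weak_deriv_imp_primitive:
  assumes w: "has_weak_deriv f g" and f: "continuous_on UNIV f"
    and v[measurable]: "v \<in> borel_measurable borel" and gv: "AE x in lebesgue. g x = v x"
  shows "primitive f v"
proof -
  have [measurable]: "f \<in> borel_measurable borel" using f by (rule borel_measurable_continuous_onI)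
  have iv: "set_integrable lborel {x..y} v" for x y
  proof -
    have gi: "set_integrable lebesgue {x..y} g" using w unfolding has_weak_deriv_def by auto
    have "set_integrable lebesgue {x..y} v \<longleftrightarrow> set_integrable lebesgue {x..y} g"
      unfolding set_integrable_def
    proof (rule integrable_cong_AE)
      show "(\<lambda>z. indicator {x..y} z *\<^sub>R v z) \<in> borel_measurable lebesgue"
        by (intro measurable_completion) auto
      show "(\<lambda>z. indicator {x..y} z *\<^sub>R g z) \<in> borel_measurable lebesgue"
        using gi unfolding set_integrable_def by auto
    qed (use gv in \<open>auto elim!: eventually_mono\<close>)
    with gi have "set_integrable lebesgue {x..y} v" by simp
    then show ?thesis unfolding set_integrable_def by (subst (asm) integrable_completion) auto
  qed
  have "(LBINT x:{a..b}. v x) = f b - f a" if ab: "a \<le> b" for a b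
  proof (rule weak_identity_imp_increment[OF f v iv ab])
    fix n
    have tf: "test_function UNIV (plateau a b n)" by (intro plateau_test_function ab) auto
    have "(LBINT x. f x * plateau' a b n x) = (LINT x|lebesgue. f x * plateau' a b n x)"
      by (rule integral_completion[symmetric]) auto
    also have "\<dots> = - (LINT x|lebesgue. g x * plateau a b n x)"
      using w tf unfolding has_weak_deriv_def by (metis deriv_plateau)
    also have "(LINT x|lebesgue. g x * plateau a b n x) = (LINT x|lebesgue. v x * plateau a b n x)"
    proof (rule integral_cong_AE)
      have "(\<lambda>z. v z) \<in> borel_measurable lebesgue" by (intro measurable_completion) auto
      then have "g \<in> borel_measurable lebesgue"
        by (rule borel_measurable_AE) (use gv in \<open>auto elim!: eventually_mono\<close>)
      then show "(\<lambda>x. g x * plateau a b n x) \<in> borel_measurable lebesgue"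
        by (intro borel_measurable_times) (auto intro: measurable_completion)
      show "(\<lambda>x. v x * plateau a b n x) \<in> borel_measurable lebesgue"
        by (intro measurable_completion) auto
    qed (use gv in \<open>auto elim!: eventually_mono\<close>)
    also have "\<dots> = (LBINT x. v x * plateau a b n x)" by (rule integral_completion) auto
    finally show "(LBINT x. f x * plateau' a b n x) = - (LBINT x. v x * plateau a b n x)" .
  qed
  then show ?thesis using iv unfolding primitive_def by auto
qed

lemma integrable_prod_mult:
  fixes a b :: "real \<Rightarrow> real"
  assumes "integrable lborel a" "integrable lborel b"
  shows "integrable (lborel \<Otimes>\<^sub>M lborel) (\<lambda>(x, y). a x * b y)"
proof (rule lborel_pair.Fubini_integrable)
  have [measurable]: "a \<in> borel_measurable borel" "b \<in> borel_measurable borel" using assms by auto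
  show "(\<lambda>(x, y). a x * b y) \<in> borel_measurable (lborel \<Otimes>\<^sub>M lborel)" by measurable
  show "integrable lborel (\<lambda>x. LBINT y. norm (case (x, y) of (x, y) \<Rightarrow> a x * b y))"
    using assms by (auto simp: abs_mult)
  show "AE x in lborel. integrable lborel (\<lambda>y. case (x, y) of (x, y) \<Rightarrow> a x * b y)"
    using assms by auto
qed

text \<open>Only one factor is \<open>C\<^sup>1\<close>, the other is absolutely continuous. Writing \<open>f(x) - f(A)\<close> as the integral of
  \<open>v\<close> over \<open>[A, x]\<close> reduces the claim to Fubini's theorem on the triangle \<open>A \<le> z \<le> x \<le> B\<close>.\<close>

lemma primitive_integration_by_parts:
  assumes f: "primitive f v" and p: "\<And>x. (p has_real_derivative p' x) (at x)" "continuous_on UNIV p'"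
    and z: "p A = 0" "p B = 0" and AB: "A \<le> B"
  shows "(LBINT x:{A..B}. f x * p' x) = - (LBINT x:{A..B}. v x * p x)"
proof -
  note [measurable] = primitiveD(1)[OF f]
  have [measurable]: "p' \<in> borel_measurable borel" using p(2) by (rule borel_measurable_continuous_onI)
  have pcont: "continuous_on UNIV p" using p(1) by (metis DERIV_isCont continuous_at_imp_continuous_on)
  define F where "F = (\<lambda>z x. (indicator {A..B} z * v z) * (indicator {z..B} x * p' x) :: real)"
  obtain K where K: "\<And>x. x \<in> {A..B} \<Longrightarrow> \<bar>p' x\<bar> \<le> K"
  proof -
    have "compact (p' ` {A..B})" by (intro compact_continuous_image continuous_on_subset[OF p(2)]) auto
    then show ?thesis using that compact_imp_bounded bounded_iff by (metis image_eqI real_norm_def)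
  qed
  have iF: "integrable (lborel \<Otimes>\<^sub>M lborel) (case_prod F)"
  proof (rule Bochner_Integration.integrable_bound)
    show "integrable (lborel \<Otimes>\<^sub>M lborel) (\<lambda>(z, x). (indicator {A..B} z * \<bar>v z\<bar>) * (indicator {A..B} x * K))"
    proof (rule integrable_prod_mult)
      have "integrable lborel (\<lambda>z. \<bar>indicator {A..B} z * v z\<bar>)"
        using primitiveD(2)[OF f, of A B] unfolding set_integrable_def by (intro integrable_abs) simp
      then show "integrable lborel (\<lambda>z. indicator {A..B} z * \<bar>v z\<bar>)" by (simp add: abs_mult)
      show "integrable lborel (\<lambda>x. indicator {A..B} x * K)"
        by (rule integrable_Icc_const)
    qed
    have "(\<lambda>(z, x). (indicator {A..B} z * v z) * ((if z \<le> x \<and> x \<le> B then 1 else 0) * p' x)) \<in> borel_measurable (lborel \<Otimes>\<^sub>M lborel)"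
      by measurable
    moreover have "case_prod F = (\<lambda>(z, x). (indicator {A..B} z * v z) * ((if z \<le> x \<and> x \<le> B then 1 else 0) * p' x))"
      unfolding F_def by (auto simp: fun_eq_iff indicator_def)
    ultimately show "case_prod F \<in> borel_measurable (lborel \<Otimes>\<^sub>M lborel)" by simp
    show "AE zx in lborel \<Otimes>\<^sub>M lborel. norm (case_prod F zx)
        \<le> norm (case zx of (z, x) \<Rightarrow> (indicator {A..B} z * \<bar>v z\<bar>) * (indicator {A..B} x * K))"
    proof (intro always_eventually allI, clarify)
      fix z x
      show "norm (F z x) \<le> norm ((indicator {A..B} z * \<bar>v z\<bar>) * (indicator {A..B} x * K))"
      proof (cases "A \<le> z \<and> z \<le> x \<and> x \<le> B")
        case True
        have "\<bar>v z\<bar> * \<bar>p' x\<bar> \<le> \<bar>v z\<bar> * \<bar>K\<bar>"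
          using K[of x] True by (intro mult_left_mono) auto
        then show ?thesis using True by (simp add: F_def abs_mult)
      qed (auto simp: F_def indicator_def)
    qed
  qed
  have "(LBINT x. (LBINT z. F z x)) = (LBINT z. (LBINT x. F z x))"
    by (rule lborel_pair.Fubini_integral[OF iF])
  moreover have "(LBINT z. F z x) = indicator {A..B} x * ((f x - f A) * p' x)" for x
  proof (cases "x \<in> {A..B}")
    case True
    have "(LBINT z. F z x) = (LBINT z. (indicator {A..x} z *\<^sub>R v z) * p' x)"
      by (rule Bochner_Integration.integral_cong) (use True in \<open>auto simp: F_def indicator_def\<close>)
    also have "\<dots> = (LBINT z:{A..x}. v z) * p' x" unfolding set_lebesgue_integral_def by simp
    also have "\<dots> = (f x - f A) * p' x" using primitiveD(3)[OF f] True by simp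
    finally show ?thesis using True by simp
  next
    case False
    then have "F z x = 0" for z by (auto simp: F_def indicator_def)
    then show ?thesis using False by simp
  qed
  moreover have "(LBINT x. F z x) = indicator {A..B} z * (v z * - p z)" for z
  proof (cases "z \<in> {A..B}")
    case True
    have "(LBINT x. F z x) = v z * (LBINT x:{z..B}. p' x)"
      using True by (simp add: F_def set_lebesgue_integral_def)
    also have "\<dots> = v z * - p z" using LBINT_FTC(2)[OF p] True z by simp
    finally show ?thesis using True by simp
  qed (simp add: F_def)
  ultimately have "(LBINT x:{A..B}. (f x - f A) * p' x) = (LBINT z:{A..B}. - (v z * p z))"
    by (simp add: set_lebesgue_integral_def)
  moreover have "(LBINT x:{A..B}. (f x - f A) * p' x) = (LBINT x:{A..B}. f x * p' x) - (LBINT x:{A..B}. f A * p' x)"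
    unfolding left_diff_distrib
    by (intro set_integral_diff borel_integrable_atLeastAtMost' continuous_intros primitive_continuous[OF f] continuous_on_subset[OF p(2)]) auto
  moreover have "(LBINT x:{A..B}. f A * p' x) = 0" using LBINT_FTC(2)[OF p AB] z by simp
  ultimately show ?thesis by (simp add: set_lebesgue_integral_def)
qed

lemma primitive_imp_weak_deriv:
  assumes f: "primitive f v" shows "has_weak_deriv f v"
  unfolding has_weak_deriv_def
proof (intro conjI allI impI)
  note [measurable] = primitiveD(1)[OF f]
  have cf: "continuous_on UNIV f" by (rule primitive_continuous[OF f])
  have [measurable]: "f \<in> borel_measurable borel" using cf by (rule borel_measurable_continuous_onI)
  fix K :: "real set" assume K: "compact K"
  then obtain c where "K \<subseteq> cbox (- c) c" using bounded_subset_cbox_symmetric compact_imp_bounded by blast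
  then have Kc: "K \<subseteq> {- c..c}" by simp
  have "set_integrable lebesgue {-c..c} f" "set_integrable lebesgue {-c..c} v"
    using borel_integrable_atLeastAtMost'[of "-c" c f] primitiveD(2)[OF f, of "-c" c] continuous_on_subset[OF cf, of "{-c..c}"]
    unfolding set_integrable_def by (subst integrable_completion; auto)+
  then show "f absolutely_integrable_on K" "v absolutely_integrable_on K"
    using K Kc by (auto intro!: set_integrable_subset[of lebesgue "{-c..c}" _ K] lmeasurable_compact fmeasurableD)
next
  note [measurable] = primitiveD(1)[OF f]
  have cf: "continuous_on UNIV f" by (rule primitive_continuous[OF f])
  have [measurable]: "f \<in> borel_measurable borel" using cf by (rule borel_measurable_continuous_onI)
  fix \<phi> :: "real \<Rightarrow> real" assume t: "test_function UNIV \<phi>"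
  then have "C_k (Suc 0) \<phi>" unfolding test_function_def by blast
  then obtain d where d: "\<forall>x. (\<phi> has_derivative d x) (at x)" "\<forall>v. continuous_on UNIV (\<lambda>x. d x v)" by auto
  define p' where "p' x = d x 1" for x
  have p': "(\<phi> has_real_derivative p' x) (at x)" for x
  proof -
    have "bounded_linear (d x)" using d(1) by (intro has_derivative_bounded_linear) auto
    then obtain c where "d x = (\<lambda>y. y * c)" unfolding real_bounded_linear by blast
    then have "d x = (*) (p' x)" by (auto simp: p'_def fun_eq_iff)
    then show ?thesis using d(1) unfolding has_field_derivative_def by metis
  qed
  have cp': "continuous_on UNIV p'" using d(2) unfolding p'_def by blast
  have dp: "deriv \<phi> = p'" using p' by (auto intro!: DERIV_imp_deriv)
  have cp: "continuous_on UNIV \<phi>" using p' by (metis DERIV_isCont continuous_at_imp_continuous_on)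
  have [measurable]: "p' \<in> borel_measurable borel" "\<phi> \<in> borel_measurable borel" using cp' cp by (auto intro: borel_measurable_continuous_onI)
  obtain K where K: "compact K" "\<And>x. x \<notin> K \<Longrightarrow> \<phi> x = 0" using t unfolding test_function_def by blast
  then obtain c0 where "K \<subseteq> cbox (- c0) c0" using bounded_subset_cbox_symmetric compact_imp_bounded by blast
  then have z0: "\<phi> x = 0" if "x \<notin> {-c0..c0}" for x using that K(2)[of x] by (metis box_real(2) subsetD)
  define c where "c = max (c0 + 1) 1"
  have z: "\<phi> x = 0" if "x \<notin> {-c<..<c}" for x by (rule z0) (use that in \<open>auto simp: c_def\<close>)
  have z': "p' x = 0" if "x \<notin> {-c..c}" for x
  proof -
    have "((\<lambda>x. 0::real) has_real_derivative 0) (at x)" by simp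
    then have "(\<phi> has_real_derivative 0) (at x)"
      by (rule has_field_derivative_transform_within_open[of _ _ _ "- {-c..c}"])
         (use that z in \<open>auto simp: open_Compl\<close>)
    then show ?thesis using p' DERIV_unique by blast
  qed
  have "(LINT x|lebesgue. f x * deriv \<phi> x) = (LBINT x. f x * p' x)"
    unfolding dp by (rule integral_completion) auto
  also have "\<dots> = (LBINT x:{-c..c}. f x * p' x)"
    unfolding set_lebesgue_integral_def using z' by (intro Bochner_Integration.integral_cong) (auto simp: indicator_def)
  also have "\<dots> = - (LBINT x:{-c..c}. v x * \<phi> x)"
    by (rule primitive_integration_by_parts[OF f p' cp']) (use z in \<open>auto simp: c_def\<close>)
  also have "(LBINT x:{-c..c}. v x * \<phi> x) = (LBINT x. v x * \<phi> x)"
    unfolding set_lebesgue_integral_def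
  proof (intro Bochner_Integration.integral_cong refl)
    fix x show "indicator {-c..c} x *\<^sub>R (v x * \<phi> x) = v x * \<phi> x"
      using z[of x] by (cases "x \<in> {-c..c}") auto
  qed
  also have "\<dots> = (LINT x|lebesgue. v x * \<phi> x)"
    by (rule integral_completion[symmetric]) auto
  finally show "(LINT x|lebesgue. f x * deriv \<phi> x) = - (LINT x|lebesgue. v x * \<phi> x)" .
qed

lemma primitive_AE_unique:
  assumes "primitive f v" "primitive f w" shows "AE x in lborel. v x = w x"
  using primitive_AE_deriv[OF assms(1)] primitive_AE_deriv[OF assms(2)]
  by eventually_elim (rule DERIV_unique)

section \<open>Averages of the squared slope\<close>

text \<open>Since \<open>\<bar>N - g\<bar> = N + g - 2 min N g\<close> and \<open>min N g\<close> is dominated by \<open>g\<close>, convergence of the masses upgrades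
  pointwise convergence to convergence in \<open>L\<^sup>1\<close>.\<close>

lemma Scheffe_nonneg:
  fixes g :: "'a \<Rightarrow> real"
  assumes g: "integrable M g" and N: "\<And>n::nat. integrable M (N n)"
    and nn: "\<And>x. 0 \<le> g x" "\<And>n x. 0 \<le> N n x"
    and lim: "AE x in M. (\<lambda>n. N n x) \<longlonglongrightarrow> g x"
    and int: "(\<lambda>n. LINT x|M. N n x) \<longlonglongrightarrow> (LINT x|M. g x)"
  shows "(\<lambda>n. LINT x|M. \<bar>N n x - g x\<bar>) \<longlonglongrightarrow> 0"
proof -
  have [measurable]: "g \<in> borel_measurable M" "N n \<in> borel_measurable M" for n using g N by auto
  have mi: "integrable M (\<lambda>x. min (N n x) (g x))" for n by (intro integrable_min g N)
  have "(\<lambda>n. LINT x|M. min (N n x) (g x)) \<longlonglongrightarrow> (LINT x|M. g x)"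
  proof (rule integral_dominated_convergence[where w=g])
    show "AE x in M. (\<lambda>n. min (N n x) (g x)) \<longlonglongrightarrow> g x"
      using lim
    proof eventually_elim
      case (elim x)
      show ?case using tendsto_min[OF elim tendsto_const[of "g x"]] by simp
    qed
  qed (use g nn in auto)
  then have "(\<lambda>n. (LINT x|M. N n x) + (LINT x|M. g x) - 2 * (LINT x|M. min (N n x) (g x)))
      \<longlonglongrightarrow> (LINT x|M. g x) + (LINT x|M. g x) - 2 * (LINT x|M. g x)"
    by (intro tendsto_intros int)
  moreover have "(LINT x|M. \<bar>N n x - g x\<bar>)
      = (LINT x|M. N n x) + (LINT x|M. g x) - 2 * (LINT x|M. min (N n x) (g x))" for n
  proof -
    have "(LINT x|M. \<bar>N n x - g x\<bar>) = (LINT x|M. N n x + g x - 2 * min (N n x) (g x))"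
      by (intro Bochner_Integration.integral_cong) (auto simp: min_def abs_if)
    also have "\<dots> = (LINT x|M. N n x) + (LINT x|M. g x) - 2 * (LINT x|M. min (N n x) (g x))"
      using g N mi by simp
    finally show ?thesis .
  qed
  ultimately show ?thesis by simp
qed

lemma primitive_nonneg_mono:
  assumes "primitive Q g" "\<And>x. 0 \<le> g x" "x \<le> y" shows "Q x \<le> Q y"
proof -
  have "0 \<le> (LBINT z:{x..y}. g z)" unfolding set_lebesgue_integral_def
    using assms(2) by (intro integral_nonneg_AE) auto
  then show ?thesis using primitiveD(3)[OF assms(1,3)] by simp
qed

text \<open>Scheffe's lemma for approximations that are themselves derivatives, so that their masses on an interval
  can be read off from their antiderivatives. It is applied to three averages of the squared slope.\<close>

lemma primitive_L1_approx:
  assumes Q: "primitive Q g" and g: "\<And>x. 0 \<le> g x" and AB: "A \<le> B"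
    and N: "\<And>n::nat. continuous_on UNIV (N n)" "\<And>n x. 0 \<le> N n x"
    and M: "\<And>n x. (M n has_real_derivative N n x) (at x)"
    and lim: "AE x in lborel. (\<lambda>n. N n x) \<longlonglongrightarrow> g x" and limM: "\<And>x. (\<lambda>n. M n x) \<longlonglongrightarrow> Q x"
  shows "(\<lambda>n. LBINT x:{A..B}. \<bar>N n x - g x\<bar>) \<longlonglongrightarrow> 0"
proof -
  have "(\<lambda>n. LBINT x. \<bar>indicator {A..B} x * N n x - indicator {A..B} x * g x\<bar>) \<longlonglongrightarrow> 0"
  proof (rule Scheffe_nonneg)
    show "integrable lborel (\<lambda>x. indicator {A..B} x * g x)"
      using primitiveD(2)[OF Q, of A B] by (simp add: set_integrable_def)
    show "integrable lborel (\<lambda>x. indicator {A..B} x * N n x)" for n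
      using LBINT_FTC(1)[OF M N(1), of A B n] by (simp add: set_integrable_def)
    have "(\<lambda>n. M n B - M n A) \<longlonglongrightarrow> Q B - Q A" by (intro tendsto_intros limM)
    then show "(\<lambda>n. LBINT x. indicator {A..B} x * N n x) \<longlonglongrightarrow> (LBINT x. indicator {A..B} x * g x)"
      using LBINT_FTC(2)[OF M N(1) AB] primitiveD(3)[OF Q AB] by (simp add: set_lebesgue_integral_def)
    show "AE x in lborel. (\<lambda>n. indicator {A..B} x * N n x) \<longlonglongrightarrow> indicator {A..B} x * g x"
      using lim by eventually_elim (intro tendsto_intros)
  qed (use g N in auto)
  moreover have "\<bar>indicator {A..B} x * N n x - indicator {A..B} x * g x\<bar> = indicator {A..B} x *\<^sub>R \<bar>N n x - g x\<bar>" for n x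
    by (auto simp: indicator_def)
  ultimately show ?thesis by (simp add: set_lebesgue_integral_def)
qed

text \<open>The function compared at \<open>x\<close> and \<open>y\<close> is a primitive of \<open>(v - c)\<^sup>2\<close>. Choosing \<open>c\<close> as the average in
  question yields the Cauchy--Schwarz inequality for that average; it is used for box and hat averages.\<close>

lemma sq_dist_monotone:
  assumes f: "primitive f v" and Q: "primitive Q (\<lambda>x. (v x)\<^sup>2)" and xy: "x \<le> y"
  shows "Q x - 2 * c * f x + c\<^sup>2 * x \<le> Q y - 2 * c * f y + c\<^sup>2 * y"
proof -
  have id: "primitive (\<lambda>x. x) (\<lambda>x. 1)" by (rule primitive_C1) auto
  have "primitive (\<lambda>x. (Q x + (- 2 * c) * f x) + c\<^sup>2 * x) (\<lambda>x. ((v x)\<^sup>2 + (- 2 * c) * v x) + c\<^sup>2 * 1)"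
    by (intro primitive_add primitive_cmult f Q id)
  moreover have "0 \<le> ((v x)\<^sup>2 + (- 2 * c) * v x) + c\<^sup>2 * 1" for x
    using zero_le_power2[of "v x - c"] by (simp add: power2_diff algebra_simps)
  ultimately have "(Q x + (- 2 * c) * f x) + c\<^sup>2 * x \<le> (Q y + (- 2 * c) * f y) + c\<^sup>2 * y"
    using xy by (rule primitive_nonneg_mono)
  then show ?thesis by simp
qed

lemma quotient_sq_le:
  assumes f: "primitive f v" and Q: "primitive Q (\<lambda>x. (v x)\<^sup>2)" and xy: "x < y"
  shows "((f y - f x) / (y - x))\<^sup>2 \<le> (Q y - Q x) / (y - x)"
proof -
  \<comment> \<open>The mean slope is the optimal constant in \<open>sq_dist_monotone\<close>.\<close>
  define c where "c = (f y - f x) / (y - x)"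
  have fc: "f y - f x = c * (y - x)" using xy by (simp add: c_def)
  have "0 \<le> Q y - Q x - 2 * c * (f y - f x) + c\<^sup>2 * (y - x)"
    using sq_dist_monotone[OF f Q, of x y c] xy by (simp add: algebra_simps)
  then have "c\<^sup>2 * (y - x) \<le> Q y - Q x" unfolding fc by (simp add: power2_eq_square algebra_simps)
  then show ?thesis using xy unfolding c_def[symmetric] by (simp add: pos_le_divide_eq)
qed

lemma second_diff_sq_le:
  assumes f: "primitive f v" and Q: "primitive Q (\<lambda>x. (v x)\<^sup>2)" and h: "h > 0"
    and \<Phi>: "\<And>x. (\<Phi> has_real_derivative f x) (at x)" and \<Psi>: "\<And>x. (\<Psi> has_real_derivative Q x) (at x)"
  shows "(second_diff h \<Phi> x)\<^sup>2 \<le> second_diff h \<Psi> x"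
proof -
  define c where "c = second_diff h \<Phi> x"
  have "((\<lambda>x. \<Psi> x - 2 * c * \<Phi> x + c\<^sup>2 * (x\<^sup>2 / 2)) has_real_derivative (Q x - 2 * c * f x + c\<^sup>2 * x)) (at x)" for x
    by (auto intro!: derivative_eq_intros \<Phi> \<Psi>)
  then obtain s where s: "0 < s" "second_diff h (\<lambda>x. \<Psi> x - 2 * c * \<Phi> x + c\<^sup>2 * (x\<^sup>2 / 2)) x
      = ((Q (x + s) - 2 * c * f (x + s) + c\<^sup>2 * (x + s)) - (Q (x - s) - 2 * c * f (x - s) + c\<^sup>2 * (x - s))) / (2 * s)"
    using second_diff_mean[of "\<lambda>x. \<Psi> x - 2 * c * \<Phi> x + c\<^sup>2 * (x\<^sup>2 / 2)" "\<lambda>x. Q x - 2 * c * f x + c\<^sup>2 * x" h x] h by blast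
  have "0 \<le> second_diff h (\<lambda>x. \<Psi> x - 2 * c * \<Phi> x + c\<^sup>2 * (x\<^sup>2 / 2)) x"
    unfolding s(2) using s(1) sq_dist_monotone[OF f Q, of "x - s" "x + s" c] by simp
  also have "second_diff h (\<lambda>x. \<Psi> x - 2 * c * \<Phi> x + c\<^sup>2 * (x\<^sup>2 / 2)) x = second_diff h \<Psi> x - 2 * c * second_diff h \<Phi> x + c\<^sup>2"
    using h unfolding second_diff_def by (simp add: field_simps power2_eq_square)
  finally show ?thesis unfolding c_def[symmetric] by (simp add: power2_eq_square)
qed

lemma second_diff_lipschitz_bound:
  assumes d: "\<And>x. (\<Phi> has_real_derivative f x) (at x)" and h: "h > 0"
    and L: "\<And>y z. x - h \<le> y \<Longrightarrow> y \<le> z \<Longrightarrow> z \<le> x + h \<Longrightarrow> \<bar>f z - f y\<bar> \<le> C * (z - y)"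
  shows "\<bar>second_diff h \<Phi> x\<bar> \<le> C"
proof -
  obtain s where s: "0 < s" "s < h" "second_diff h \<Phi> x = (f (x + s) - f (x - s)) / (2 * s)"
    using second_diff_mean[OF d h] by blast
  have "\<bar>f (x + s) - f (x - s)\<bar> \<le> C * (2 * s)" using L[of "x - s" "x + s"] s by simp
  then show ?thesis using s by (simp add: pos_divide_le_eq abs_divide)
qed

text \<open>Transport of a hat average: with \<open>\<Phi>' = f\<close>, the quotient \<open>second_diff h f\<close> is the space derivative of the
  average \<open>second_diff h \<Phi>\<close> of the slope. What remains is a sum of squares, the exact commutator between
  averaging and transport by \<open>f\<close>.\<close>

lemma second_diff_square:
  assumes "h \<noteq> 0"
  shows "second_diff h (\<lambda>x. (f x)\<^sup>2 / 2) x = f x * second_diff h f x + (((f (x + h) - f x) / h)\<^sup>2 + ((f x - f (x - h)) / h)\<^sup>2) / 2"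
  using assms unfolding second_diff_def by (simp add: field_simps power2_eq_square)

section \<open>The truncated square of the negative part\<close>

text \<open>A bounded substitute for \<open>(w\<^sup>-)\<^sup>2\<close> that increases to it as \<open>\<epsilon> \<rightarrow> 0\<close>. The square of \<open>w\<close> would require
  cubes of slopes to be integrable.\<close>

definition neg_sq :: "real \<Rightarrow> real \<Rightarrow> real" where
  "neg_sq \<epsilon> w = (neg_part w)\<^sup>2 / (1 + \<epsilon> * (neg_part w)\<^sup>2)"

definition neg_sq' :: "real \<Rightarrow> real \<Rightarrow> real" where
  "neg_sq' \<epsilon> w = - 2 * neg_part w / (1 + \<epsilon> * (neg_part w)\<^sup>2)\<^sup>2"

lemma neg_part_simps: "w \<le> 0 \<Longrightarrow> neg_part w = - w" "0 \<le> w \<Longrightarrow> neg_part w = 0" "0 \<le> neg_part w" "neg_part w \<le> \<bar>w\<bar>"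
  by (auto simp: neg_part_def)

lemma neg_part_sq_le: "(neg_part w)\<^sup>2 \<le> w\<^sup>2"
  using power_mono[OF neg_part_simps(4,3), of w 2] by simp

lemma continuous_neg_part [continuous_intros]: "continuous_on S f \<Longrightarrow> continuous_on S (\<lambda>x. neg_part (f x))"
  unfolding neg_part_def by (intro continuous_intros)

context fixes \<epsilon> :: real assumes e: "0 < \<epsilon>" "\<epsilon> \<le> 1" begin

lemma neg_sq_den: "1 \<le> 1 + \<epsilon> * (neg_part w)\<^sup>2" using e by simp

lemma neg_sq_nonneg: "0 \<le> neg_sq \<epsilon> w"
proof -
  have "0 < 1 + \<epsilon> * (neg_part w)\<^sup>2" using neg_sq_den[of w] by linarith
  then show ?thesis unfolding neg_sq_def by (intro divide_nonneg_pos) auto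
qed

lemma neg_sq_le_sq: "neg_sq \<epsilon> w \<le> (neg_part w)\<^sup>2"
proof -
  have "0 < 1 + \<epsilon> * (neg_part w)\<^sup>2" using neg_sq_den[of w] by linarith
  then show ?thesis unfolding neg_sq_def
    using mult_left_mono[OF neg_sq_den[of w], of "(neg_part w)\<^sup>2"] by (simp only: pos_divide_le_eq) simp
qed

lemma neg_sq_bounded: "neg_sq \<epsilon> w \<le> 1 / \<epsilon>"
proof -
  have "0 < 1 + \<epsilon> * (neg_part w)\<^sup>2" using neg_sq_den[of w] by linarith
  then show ?thesis unfolding neg_sq_def using e by (simp add: divide_simps)
qed

lemma neg_sq'_nonpos: "neg_sq' \<epsilon> w \<le> 0"
  unfolding neg_sq'_def using neg_part_simps(3)[of w] by (simp add: divide_nonpos_nonneg)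

lemma neg_sq'_abs: "\<bar>neg_sq' \<epsilon> w\<bar> = 2 * neg_part w / (1 + \<epsilon> * (neg_part w)\<^sup>2)\<^sup>2"
  unfolding neg_sq'_def using neg_part_simps(3)[of w] by (simp add: abs_divide)

lemma neg_sq'_le_abs: "\<bar>neg_sq' \<epsilon> w\<bar> \<le> 2 * \<bar>w\<bar>"
proof -
  have "2 * neg_part w / (1 + \<epsilon> * (neg_part w)\<^sup>2)\<^sup>2 \<le> 2 * neg_part w / 1"
    using neg_sq_den[of w] neg_part_simps(3)[of w] by (intro divide_left_mono) (auto intro: one_le_power)
  then show ?thesis unfolding neg_sq'_abs using neg_part_simps(4)[of w] by simp
qed

lemma neg_sq'_bounded: "\<bar>neg_sq' \<epsilon> w\<bar> \<le> 1 / \<epsilon>"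
proof -
  define m where "m = neg_part w"
  have m: "0 \<le> m" using neg_part_simps(3) by (simp add: m_def)
  have d: "1 \<le> 1 + \<epsilon> * m\<^sup>2" using neg_sq_den[of w] by (simp add: m_def)
  have "2 * m \<le> 1 + m\<^sup>2" using zero_le_power2[of "m - 1"] by (simp add: power2_diff)
  then have "\<epsilon> * (2 * m) \<le> \<epsilon> * (1 + m\<^sup>2)" using e by (intro mult_left_mono) auto
  also have "\<dots> \<le> 1 + \<epsilon> * m\<^sup>2" using e by (simp add: algebra_simps)
  also have "\<dots> \<le> (1 + \<epsilon> * m\<^sup>2)\<^sup>2" using d by (intro self_le_power) auto
  finally have "2 * m \<le> (1 + \<epsilon> * m\<^sup>2)\<^sup>2 * (1 / \<epsilon>)" using e by (simp add: field_simps)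
  moreover have "0 < (1 + \<epsilon> * m\<^sup>2)\<^sup>2" using d by (intro zero_less_power) simp
  ultimately show ?thesis unfolding neg_sq'_abs m_def[symmetric] by (simp add: pos_divide_le_eq mult.commute)
qed

text \<open>The cubic terms cancel exactly for \<open>(w\<^sup>-)\<^sup>2\<close>, which is homogeneous of degree two. The truncation grows
  more slowly, and for \<open>w < 0\<close> the excess has the favourable sign.\<close>

lemma neg_sq_cubic: "w * neg_sq \<epsilon> w - w\<^sup>2 * neg_sq' \<epsilon> w / 2 \<le> 0"
proof (cases "w \<le> 0")
  case True
  define d where "d = 1 + \<epsilon> * w\<^sup>2"
  have d: "1 \<le> d" using neg_sq_den[of w] True by (simp add: d_def neg_part_simps)
  have "(- w) ^ 3 / d\<^sup>2 \<le> (- w) ^ 3 / d"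
    using d True by (intro divide_left_mono self_le_power mult_pos_pos zero_less_power) auto
  then have "w * (w\<^sup>2 / d) - w\<^sup>2 * (2 * w / d\<^sup>2) / 2 \<le> 0"
    by (simp add: power2_eq_square power3_eq_cube)
  then show ?thesis using True unfolding neg_sq_def neg_sq'_def
    by (simp add: neg_part_simps d_def[symmetric])
next
  case False then show ?thesis by (simp add: neg_sq_def neg_sq'_def neg_part_simps)
qed

lemma neg_sq_deriv: "(neg_sq \<epsilon> has_real_derivative neg_sq' \<epsilon> w) (at w)"
proof -
  have sq: "((\<lambda>w. (neg_part w)\<^sup>2) has_real_derivative - 2 * neg_part w) (at w)" for w
  proof -
    consider "w < 0" | "w = 0" | "w > 0" by linarith
    then show ?thesis
    proof cases
      case 1
      have "((\<lambda>w. w\<^sup>2) has_real_derivative - 2 * neg_part w) (at w)"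
        using 1 by (auto intro!: derivative_eq_intros simp: neg_part_simps)
      then show ?thesis
        by (rule has_field_derivative_transform_within_open[of _ _ _ "{..<0}"]) (use 1 in \<open>auto simp: neg_part_simps\<close>)
    next
      case 3
      have "((\<lambda>w. 0) has_real_derivative - 2 * neg_part w) (at w)"
        using 3 by (simp add: neg_part_simps)
      then show ?thesis
        by (rule has_field_derivative_transform_within_open[of _ _ _ "{0<..}"]) (use 3 in \<open>auto simp: neg_part_simps\<close>)
    next
      case 2
      have "((\<lambda>h. (neg_part h)\<^sup>2 / h) \<longlongrightarrow> 0) (at 0)"
      proof (rule Lim_null_comparison[where g="\<lambda>h. \<bar>h\<bar>"])
        show "\<forall>\<^sub>F h in at 0. norm ((neg_part h)\<^sup>2 / h) \<le> \<bar>h\<bar>"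
        proof (intro always_eventually allI)
          fix h :: real
          show "norm ((neg_part h)\<^sup>2 / h) \<le> \<bar>h\<bar>"
            by (cases "h \<le> 0") (auto simp: neg_part_simps power2_eq_square)
        qed
      qed (auto intro!: tendsto_eq_intros)
      then show ?thesis using 2 unfolding DERIV_def by (simp add: neg_part_def)
    qed
  qed
  have nz: "1 + \<epsilon> * (neg_part w)\<^sup>2 \<noteq> 0" using neg_sq_den[of w] by linarith
  have "((\<lambda>w. 1 + \<epsilon> * (neg_part w)\<^sup>2) has_real_derivative 0 + \<epsilon> * (- 2 * neg_part w)) (at w)"
    by (intro DERIV_add DERIV_const DERIV_cmult sq)
  from DERIV_divide[OF sq[of w] this nz] show ?thesis unfolding neg_sq_def[abs_def] neg_sq'_def
    by (rule DERIV_cong) (simp add: algebra_simps power2_eq_square)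
qed

lemma neg_sq'_cont: "continuous_on S (neg_sq' \<epsilon>)"
proof -
  have "(1 + \<epsilon> * (neg_part w)\<^sup>2)\<^sup>2 \<noteq> 0" for w using neg_sq_den[of w] by simp
  then show ?thesis unfolding neg_sq'_def[abs_def]
    by (intro continuous_intros) auto
qed

lemma neg_sq_cont: "continuous_on S (neg_sq \<epsilon>)"
  using neg_sq_deriv by (metis DERIV_isCont continuous_at_imp_continuous_on)

lemma neg_sq_borel [measurable]: "neg_sq \<epsilon> \<in> borel_measurable borel" "neg_sq' \<epsilon> \<in> borel_measurable borel"
  by (auto intro: borel_measurable_continuous_onI neg_sq_cont neg_sq'_cont)

end

section \<open>The energy balance at a fixed time\<close>

lemma set_integrable_mult_continuous:
  fixes v c :: "real \<Rightarrow> real"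
  assumes v: "v \<in> borel_measurable borel" "set_integrable lborel {A..B} v" and c: "continuous_on UNIV c"
  shows "set_integrable lborel {A..B} (\<lambda>x. v x * c x)"
proof -
  note [measurable] = v(1)
  have [measurable]: "c \<in> borel_measurable borel" using c by (rule borel_measurable_continuous_onI)
  have "compact (c ` {A..B})" by (intro compact_continuous_image continuous_on_subset[OF c]) auto
  then obtain K where K: "\<And>x. x \<in> {A..B} \<Longrightarrow> \<bar>c x\<bar> \<le> K"
    using compact_imp_bounded bounded_iff by (metis image_eqI real_norm_def)
  have "set_integrable lborel {A..B} (\<lambda>x. K * v x)" using v(2) by simp
  then show ?thesis unfolding set_integrable_def
  proof (rule Bochner_Integration.integrable_bound)
    show "AE x in lborel. norm (indicator {A..B} x *\<^sub>R (v x * c x)) \<le> norm (indicator {A..B} x *\<^sub>R (K * v x))"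
    proof (intro always_eventually allI)
      fix x
      have "\<bar>v x\<bar> * \<bar>c x\<bar> \<le> \<bar>K\<bar> * \<bar>v x\<bar>" if "x \<in> {A..B}"
        using mult_right_mono[OF order_trans[OF K[OF that] abs_ge_self] abs_ge_zero[of "v x"]] by (simp add: mult.commute)
      then show "norm (indicator {A..B} x *\<^sub>R (v x * c x)) \<le> norm (indicator {A..B} x *\<^sub>R (K * v x))"
        by (auto simp: indicator_def abs_mult)
    qed
  qed auto
qed

lemma set_integrable_cts: "continuous_on UNIV (c::real\<Rightarrow>real) \<Longrightarrow> set_integrable lborel {A..B} c"
  by (rule borel_integrable_atLeastAtMost', erule continuous_on_subset, simp)

lemma set_integral_le_AE:
  fixes f g :: "real \<Rightarrow> real"
  assumes "set_integrable lborel A f" "set_integrable lborel A g" "AE x in lborel. x \<in> A \<longrightarrow> f x \<le> g x"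
  shows "(LBINT x:A. f x) \<le> (LBINT x:A. g x)"
  unfolding set_lebesgue_integral_def
proof (rule integral_mono_AE)
  show "AE x in lborel. indicator A x *\<^sub>R f x \<le> indicator A x *\<^sub>R g x"
    using assms(3) by eventually_elim (auto simp: indicator_def)
qed (use assms(1,2) in \<open>simp_all add: set_integrable_def\<close>)

text \<open>The situation at one time: \<open>f = u(t, \<sqdot>)\<close> with slope \<open>v\<close> and total squared slope at most \<open>E\<close>, and the
  source \<open>F\<close>, which differs from half the primitive \<open>Q\<close> of \<open>v\<^sup>2\<close> by a Lipschitz function. The functions
  \<open>\<Phi>\<close>, \<open>\<Psi>\<close>, \<open>\<Theta>\<close> are antiderivatives whose second differences are the averages of \<open>v\<close>, \<open>v\<^sup>2\<close> and of the
  derivative of the source.\<close>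

locale frozen_time =
  fixes f v Q F \<Phi> \<Psi> \<Theta> \<psi> \<psi>' :: "real \<Rightarrow> real" and E U C D R \<epsilon> :: real
  assumes f: "primitive f v" and Q: "primitive Q (\<lambda>x. (v x)\<^sup>2)"
    and \<Phi>: "\<And>x. (\<Phi> has_real_derivative f x) (at x)"
    and \<Psi>: "\<And>x. (\<Psi> has_real_derivative Q x) (at x)"
    and \<Theta>: "\<And>x. (\<Theta> has_real_derivative F x) (at x)" and contF: "continuous_on UNIV F"
    and E: "\<And>x y. Q y - Q x \<le> E"
    and U: "\<And>x. x \<in> {-R..R} \<Longrightarrow> \<bar>f x\<bar> \<le> U"
    and C: "\<And>x y. -R-1 \<le> x \<Longrightarrow> x \<le> y \<Longrightarrow> y \<le> R+1 \<Longrightarrow> \<bar>F y - F x - (Q y - Q x) / 2\<bar> \<le> C * (y - x)"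
    and \<psi>: "\<And>x. (\<psi> has_real_derivative \<psi>' x) (at x)" "continuous_on UNIV \<psi>'"
    and \<psi>_range: "\<And>x. 0 \<le> \<psi> x" "\<And>x. \<psi> x \<le> 1" and \<psi>': "\<And>x. \<bar>\<psi>' x\<bar> \<le> D"
    and \<psi>_ends: "\<psi> (-R) = 0" "\<psi> R = 0" and R: "0 < R"
    and eps: "0 < \<epsilon>" "\<epsilon> \<le> 1"
begin

text \<open>The time derivative of the integral of \<open>\<psi> neg_sq \<epsilon> w\<close>, where \<open>w = second_diff h \<Phi>\<close> is the averaged slope:
  the last factor is the time derivative of \<open>w\<close> that the equation prescribes.\<close>

definition rate :: "real \<Rightarrow> real" where
  "rate h = (LBINT x:{-R..R}. \<psi> x * neg_sq' \<epsilon> (second_diff h \<Phi> x) * (second_diff h \<Theta> x - second_diff h (\<lambda>x. (f x)\<^sup>2 / 2) x))"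

text \<open>The averages of \<open>v\<^sup>2\<close> over \<open>[x, x + h]\<close> and \<open>[x - h, x]\<close>.\<close>

definition fwd :: "real \<Rightarrow> real \<Rightarrow> real" where "fwd h x = (Q (x + h) - Q x) / h"
definition bwd :: "real \<Rightarrow> real \<Rightarrow> real" where "bwd h x = (Q x - Q (x - h)) / h"

lemma contf: "continuous_on S f" by (rule primitive_continuous[OF f])
lemma contQ: "continuous_on S Q" by (rule primitive_continuous[OF Q])
lemma cont\<Phi>: "continuous_on S \<Phi>" and cont\<Psi>: "continuous_on S \<Psi>" and cont\<Theta>: "continuous_on S \<Theta>" and cont\<psi>: "continuous_on S \<psi>"
  using \<Phi> \<Psi> \<Theta> \<psi>(1) by (metis DERIV_isCont continuous_at_imp_continuous_on)+

lemma Q_mono: "x \<le> y \<Longrightarrow> Q x \<le> Q y" by (rule primitive_nonneg_mono[OF Q]) auto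
lemma U_nonneg: "0 \<le> U" using U[of 0] R by auto
lemma C_nonneg: "0 \<le> C" using C[of 0 1] R by (auto intro: order_trans[OF abs_ge_zero])
lemma D_nonneg: "0 \<le> D" using \<psi>'[of 0] by (auto intro: order_trans[OF abs_ge_zero])

lemma cont_shift: "continuous_on UNIV g \<Longrightarrow> continuous_on S (\<lambda>x::real. (g::real\<Rightarrow>real) (x + c))"
  "continuous_on UNIV g \<Longrightarrow> continuous_on S (\<lambda>x::real. (g::real\<Rightarrow>real) (x - c))"
  by (rule continuous_on_compose2[of UNIV g]; auto intro!: continuous_intros)+

lemma cont_fwd: "continuous_on S (fwd h)" and cont_bwd: "continuous_on S (bwd h)"
  unfolding fwd_def[abs_def] bwd_def[abs_def] by (cases "h = 0"; auto intro!: continuous_intros cont_shift contQ)+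

lemma fwd_nonneg: "h > 0 \<Longrightarrow> 0 \<le> fwd h x" and bwd_nonneg: "h > 0 \<Longrightarrow> 0 \<le> bwd h x"
  unfolding fwd_def bwd_def by (auto intro!: divide_nonneg_pos Q_mono)

lemma hat_avg_ge: "h > 0 \<Longrightarrow> (second_diff h \<Phi> x)\<^sup>2 \<le> second_diff h \<Psi> x"
  by (rule second_diff_sq_le[OF f Q _ \<Phi> \<Psi>])

lemma hat_avg_nonneg: "h > 0 \<Longrightarrow> 0 \<le> second_diff h \<Psi> x"
  using order_trans[OF zero_le_power2 hat_avg_ge] by blast

lemma fwd_deriv: "((\<lambda>x. (\<Psi> (x + h) - \<Psi> x) / h) has_real_derivative fwd h x) (at x)"
  unfolding fwd_def
by (intro DERIV_cdivide DERIV_diff \<Psi> DERIV_shift[THEN iffD1])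

lemma bwd_deriv: "((\<lambda>x. (\<Psi> x - \<Psi> (x - h)) / h) has_real_derivative bwd h x) (at x)"
  unfolding bwd_def
using DERIV_shift[of \<Psi> "Q (x - h)" x "- h"] by (intro DERIV_cdivide DERIV_diff \<Psi>) (simp add: \<Psi>)

text \<open>Averages of \<open>Q\<close> are values of \<open>Q\<close>. Hence integrals of averages of \<open>v\<^sup>2\<close>, being differences of averages
  of \<open>Q\<close>, are bounded by \<open>E\<close>.\<close>

lemma quotient_between:
  assumes "h > 0" obtains z where "(\<Psi> (x + h) - \<Psi> x) / h = Q z"
proof -
  obtain z where "\<Psi> (x + h) - \<Psi> x = h * Q z"
    using MVT2[of x "x + h" \<Psi> Q] \<Psi> assms by auto
  then show ?thesis using that[of z] assms by simp
qed

lemma fwd_int: assumes "h > 0" "A \<le> B" shows "(LBINT x:{A..B}. fwd h x) \<le> E"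
proof -
  obtain z1 z2 where "(\<Psi> (B + h) - \<Psi> B) / h = Q z1" "(\<Psi> (A + h) - \<Psi> A) / h = Q z2"
    using quotient_between assms by metis
  then show ?thesis using LBINT_FTC(2)[OF fwd_deriv cont_fwd assms(2)] E by simp
qed

lemma bwd_int: assumes "h > 0" "A \<le> B" shows "(LBINT x:{A..B}. bwd h x) \<le> E"
proof -
  obtain z1 z2 where "(\<Psi> (B - h + h) - \<Psi> (B - h)) / h = Q z1" "(\<Psi> (A - h + h) - \<Psi> (A - h)) / h = Q z2"
    using quotient_between assms by metis
  then show ?thesis using LBINT_FTC(2)[OF bwd_deriv cont_bwd assms(2)] E by simp
qed

lemma hat_avg_int: assumes "h > 0" "A \<le> B" shows "(LBINT x:{A..B}. second_diff h \<Psi> x) \<le> E"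
proof -
  obtain \<Xi> where \<Xi>: "\<And>x. (\<Xi> has_real_derivative \<Psi> x) (at x)" using antiderivative_exists[OF cont\<Psi>] by blast
  have "\<exists>z. second_diff h \<Xi> x = Q z" for x
  proof -
    obtain s where s: "0 < s" "second_diff h \<Xi> x = (\<Psi> (x + s) - \<Psi> (x - s)) / (2 * s)"
      using second_diff_mean[OF \<Xi> assms(1)] by blast
    obtain z where "(\<Psi> (x - s + 2 * s) - \<Psi> (x - s)) / (2 * s) = Q z"
      using quotient_between[of "2 * s"] s(1) by (metis mult_pos_pos zero_less_numeral)
    then have "second_diff h \<Xi> x = Q z" using s(2) by (simp add: algebra_simps)
    then show ?thesis by blast
  qed
  then obtain z1 z2 where "second_diff h \<Xi> B = Q z1" "second_diff h \<Xi> A = Q z2" by metis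
  then show ?thesis
    using LBINT_FTC(2)[OF second_diff_deriv[OF \<Xi>] second_diff_continuous[OF cont\<Psi>] assms(2)] E by simp
qed

lemma vsq_int: "A \<le> B \<Longrightarrow> (LBINT x:{A..B}. (v x)\<^sup>2) \<le> E"
  using primitiveD(3)[OF Q] E by simp

lemma vsq_integrable: "set_integrable lborel {A..B} (\<lambda>x. (v x)\<^sup>2)" by (rule primitiveD(2)[OF Q])



text \<open>The integrand of \<open>rate\<close> after the transport term, which contains the derivative of the averaged slope,
  has been integrated by parts.\<close>

definition rate_density :: "real \<Rightarrow> real \<Rightarrow> real" where
  "rate_density h x = \<psi> x * neg_sq' \<epsilon> (second_diff h \<Phi> x) *
       (second_diff h \<Theta> x - (((f (x + h) - f x) / h)\<^sup>2 + ((f x - f (x - h)) / h)\<^sup>2) / 2)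
     + v x * (\<psi> x * neg_sq \<epsilon> (second_diff h \<Phi> x)) + f x * (\<psi>' x * neg_sq \<epsilon> (second_diff h \<Phi> x))"

lemma cont_eta_sd: "continuous_on UNIV (\<lambda>x. neg_sq \<epsilon> (second_diff h \<Phi> x))" "continuous_on UNIV (\<lambda>x. neg_sq' \<epsilon> (second_diff h \<Phi> x))"
proof -
  have "continuous_on UNIV (second_diff h \<Phi>)" by (rule second_diff_continuous[OF cont\<Phi>])
  then show "continuous_on UNIV (\<lambda>x. neg_sq \<epsilon> (second_diff h \<Phi> x))" "continuous_on UNIV (\<lambda>x. neg_sq' \<epsilon> (second_diff h \<Phi> x))"
    using continuous_on_compose2[OF neg_sq_cont[OF eps, of UNIV]] continuous_on_compose2[OF neg_sq'_cont[OF eps, of UNIV]] by auto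
qed

lemma rate_density_integrable: assumes "h > 0" shows "set_integrable lborel {A..B} (rate_density h)"
proof -
  have "set_integrable lborel {A..B} (\<lambda>x. \<psi> x * neg_sq' \<epsilon> (second_diff h \<Phi> x) *
       (second_diff h \<Theta> x - (((f (x + h) - f x) / h)\<^sup>2 + ((f x - f (x - h)) / h)\<^sup>2) / 2))"
    using assms by (intro set_integrable_cts continuous_intros cont\<psi> cont_eta_sd second_diff_continuous cont\<Theta> contf cont_shift) auto
  moreover have "set_integrable lborel {A..B} (\<lambda>x. v x * (\<psi> x * neg_sq \<epsilon> (second_diff h \<Phi> x)))"
    by (intro set_integrable_mult_continuous primitiveD[OF f] continuous_intros cont\<psi> cont_eta_sd)
  moreover have "set_integrable lborel {A..B} (\<lambda>x. f x * (\<psi>' x * neg_sq \<epsilon> (second_diff h \<Phi> x)))"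
    by (intro set_integrable_cts continuous_intros contf \<psi>(2) cont_eta_sd)
  ultimately show ?thesis unfolding rate_density_def[abs_def] by (intro set_integral_add)
qed

lemma rate_eq: assumes h: "h > 0" shows "rate h = (LBINT x:{-R..R}. rate_density h x)"
proof -
  define p where "p x = \<psi> x * neg_sq \<epsilon> (second_diff h \<Phi> x)" for x
  define p' where "p' x = \<psi>' x * neg_sq \<epsilon> (second_diff h \<Phi> x) + \<psi> x * (neg_sq' \<epsilon> (second_diff h \<Phi> x) * second_diff h f x)" for x
  have cp': "continuous_on UNIV p'" unfolding p'_def
    by (intro continuous_intros \<psi>(2) cont_eta_sd cont\<psi> second_diff_continuous contf)
  have cp: "continuous_on UNIV p" unfolding p_def by (intro continuous_intros cont_eta_sd cont\<psi>)
  have dp: "(p has_real_derivative p' x) (at x)" for x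
  proof -
    have "((\<lambda>x. neg_sq \<epsilon> (second_diff h \<Phi> x)) has_real_derivative neg_sq' \<epsilon> (second_diff h \<Phi> x) * second_diff h f x) (at x)"
      by (rule DERIV_chain2[OF neg_sq_deriv[OF eps] second_diff_deriv[OF \<Phi>]])
    from DERIV_mult[OF \<psi>(1) this] show ?thesis
      unfolding p_def[abs_def] p'_def by (rule DERIV_cong) simp
  qed
  have "(LBINT x:{-R..R}. f x * p' x) = - (LBINT x:{-R..R}. v x * p x)"
    by (rule primitive_integration_by_parts[OF f dp cp']) (use \<psi>_ends R in \<open>auto simp: p_def\<close>)
  moreover have "rate h = (LBINT x:{-R..R}. rate_density h x - (v x * p x + f x * p' x))"
    unfolding rate_def using h
    by (intro set_lebesgue_integral_cong) (auto simp: rate_density_def p_def p'_def second_diff_square algebra_simps)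
  moreover have "(LBINT x:{-R..R}. rate_density h x - (v x * p x + f x * p' x))
      = (LBINT x:{-R..R}. rate_density h x) - ((LBINT x:{-R..R}. v x * p x) + (LBINT x:{-R..R}. f x * p' x))"
  proof -
    have 1: "set_integrable lborel {-R..R} (\<lambda>x. v x * p x)"
      by (intro set_integrable_mult_continuous primitiveD[OF f] cp)
    have 2: "set_integrable lborel {-R..R} (\<lambda>x. f x * p' x)"
      by (intro set_integrable_cts continuous_intros contf cp')
    show ?thesis
      by (simp add: set_integral_diff(2)[OF rate_density_integrable[OF h] set_integral_add(1)[OF 1 2]] set_integral_add(2)[OF 1 2])
  qed
  ultimately show ?thesis by simp
qed

text \<open>The quadratic part of the source is kept, since it has to compensate the commutator and the transport
  term; the rest is bounded.\<close>

lemma source_split: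
  assumes "0 < h" "h \<le> 1" "x \<in> {-R..R}"
  shows "\<bar>second_diff h \<Theta> x - second_diff h \<Psi> x / 2\<bar> \<le> C"
proof -
  have "\<bar>second_diff h (\<lambda>x. \<Theta> x - \<Psi> x / 2) x\<bar> \<le> C"
  proof (rule second_diff_lipschitz_bound)
    show "((\<lambda>x. \<Theta> x - \<Psi> x / 2) has_real_derivative F x - Q x / 2) (at x)" for x
      by (intro DERIV_diff DERIV_cdivide \<Theta> \<Psi>)
    fix y z assume "x - h \<le> y" "y \<le> z" "z \<le> x + h"
    then have "\<bar>F z - F y - (Q z - Q y) / 2\<bar> \<le> C * (z - y)" using assms by (intro C) auto
    then show "\<bar>F z - Q z / 2 - (F y - Q y / 2)\<bar> \<le> C * (z - y)" by (simp add: diff_divide_distrib algebra_simps)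
  qed (use assms in auto)
  moreover have "second_diff h (\<lambda>x. \<Theta> x - \<Psi> x / 2) x = second_diff h \<Theta> x - second_diff h \<Psi> x / 2"
  proof -
    have "(\<Theta> (x + h) - \<Psi> (x + h) / 2) - 2 * (\<Theta> x - \<Psi> x / 2) + (\<Theta> (x - h) - \<Psi> (x - h) / 2)
      = (\<Theta> (x + h) - 2 * \<Theta> x + \<Theta> (x - h)) - (\<Psi> (x + h) - 2 * \<Psi> x + \<Psi> (x - h)) / 2"
      by (simp add: field_simps)
    from arg_cong[OF this, of "\<lambda>z. z / h\<^sup>2"] show ?thesis
      unfolding second_diff_def by (simp only: diff_divide_distrib[of _ _ "h\<^sup>2"] divide_divide_eq_left mult.commute[of 2])
  qed
  ultimately show ?thesis by simp
qed

lemma dq_le: assumes "h > 0"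
  shows "((f (x + h) - f x) / h)\<^sup>2 \<le> fwd h x" "((f x - f (x - h)) / h)\<^sup>2 \<le> bwd h x"
  using quotient_sq_le[OF f Q, of x "x + h"] quotient_sq_le[OF f Q, of "x - h" x] assms
  by (auto simp: fwd_def bwd_def)

text \<open>Everything by which the averages in \<open>rate_density\<close> differ from the slope itself. Each factor next to a
  difference is bounded thanks to the truncation, so this tends to zero in \<open>L\<^sup>1\<close>.\<close>

definition rem :: "real \<Rightarrow> real \<Rightarrow> real" where
  "rem h x = \<bar>v x * (neg_sq \<epsilon> (second_diff h \<Phi> x) - neg_sq \<epsilon> (v x))\<bar>
     + 1 / \<epsilon> * (\<bar>fwd h x - (v x)\<^sup>2\<bar> + \<bar>bwd h x - (v x)\<^sup>2\<bar> + \<bar>second_diff h \<Psi> x - (v x)\<^sup>2\<bar>)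
     + \<bar>(v x)\<^sup>2 * (neg_sq' \<epsilon> (second_diff h \<Phi> x) - neg_sq' \<epsilon> (v x))\<bar>"

text \<open>With all averages replaced by \<open>v\<close> and \<open>v\<^sup>2\<close>, the quadratic and the divergence terms form the nonpositive
  expression of \<open>neg_sq_cubic\<close>. The flux and the bounded part of the source are estimated without
  passing to the limit, by \<open>w\<^sup>2 \<le> second_diff h \<Psi>\<close>, and so do not depend on \<open>\<epsilon>\<close>.\<close>

lemma rate_density_le:
  assumes h: "0 < h" "h \<le> 1" and x: "x \<in> {-R..R}"
  shows "rate_density h x \<le> (U * D + 1) * second_diff h \<Psi> x + C\<^sup>2 + rem h x"
proof -
  define w where "w = second_diff h \<Phi> x"
  define b where "b = - (\<psi> x * neg_sq' \<epsilon> w)"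
  define S where "S = second_diff h \<Psi> x"
  have w2: "w\<^sup>2 \<le> S" using hat_avg_ge[OF h(1)] by (simp add: w_def S_def)
  have b0: "0 \<le> b" unfolding b_def using \<psi>_range neg_sq'_nonpos[OF eps] by (simp add: mult_nonneg_nonpos)
  have b1: "b \<le> \<bar>neg_sq' \<epsilon> w\<bar>"
    unfolding b_def using mult_right_mono[OF \<psi>_range(2), of "\<bar>neg_sq' \<epsilon> w\<bar>" x] neg_sq'_nonpos[OF eps, of w] by simp
  have b2: "b \<le> 1 / \<epsilon>" using b1 neg_sq'_bounded[OF eps, of w] by simp
  have b3: "b \<le> 2 * \<bar>w\<bar>" using b1 neg_sq'_le_abs[OF eps, of w] by simp
  \<comment> \<open>Young's inequality: the bounded part of the source costs energy \<open>w\<^sup>2\<close> and a constant, independently of \<open>\<epsilon>\<close>\<close>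
  have "- b * (second_diff h \<Theta> x - S / 2) \<le> b * C"
    using mult_left_mono[OF _ b0, of "- (second_diff h \<Theta> x - S / 2)" C] source_split[OF h x]
    by (simp add: S_def abs_le_iff right_diff_distrib)
  also have "b * C \<le> 2 * \<bar>w\<bar> * C" using b3 C_nonneg by (intro mult_right_mono)
  also have "2 * \<bar>w\<bar> * C \<le> w\<^sup>2 + C\<^sup>2"
    using zero_le_power2[of "\<bar>w\<bar> - C"] by (simp add: power2_diff)
  finally have s1: "- b * (second_diff h \<Theta> x - S / 2) \<le> S + C\<^sup>2" using w2 by simp

  have "f x * (\<psi>' x * neg_sq \<epsilon> w) \<le> \<bar>f x * (\<psi>' x * neg_sq \<epsilon> w)\<bar>" by simp
  also have "\<dots> = \<bar>f x\<bar> * (\<bar>\<psi>' x\<bar> * neg_sq \<epsilon> w)" using neg_sq_nonneg[OF eps, of w] by (simp add: abs_mult)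
  also have "\<dots> \<le> U * (D * S)"
    using U[OF x] \<psi>'[of x] U_nonneg D_nonneg neg_sq_le_sq[OF eps, of w] neg_part_sq_le[of w] w2 neg_sq_nonneg[OF eps, of w]
    by (intro mult_mono mult_nonneg_nonneg) auto
  finally have s2: "f x * (\<psi>' x * neg_sq \<epsilon> w) \<le> U * (D * S)" .
  \<comment> \<open>the commutator exceeds half of the averaged \<open>v\<^sup>2\<close> from the source by at most \<open>v\<^sup>2/2\<close> up to errors that vanish as \<open>h \<rightarrow> 0\<close>\<close>
  have "b * ((((f (x + h) - f x) / h)\<^sup>2 + ((f x - f (x - h)) / h)\<^sup>2) / 2 - S / 2)
      \<le> b * ((fwd h x + bwd h x) / 2 - S / 2)"
    using dq_le[OF h(1), of x] b0 by (intro mult_left_mono) auto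
  also have "\<dots> = b * (v x)\<^sup>2 / 2 + b / 2 * ((fwd h x - (v x)\<^sup>2) + (bwd h x - (v x)\<^sup>2) - (S - (v x)\<^sup>2))"
    by (simp add: field_simps)
  also have "b / 2 * ((fwd h x - (v x)\<^sup>2) + (bwd h x - (v x)\<^sup>2) - (S - (v x)\<^sup>2))
      \<le> 1 / \<epsilon> * (\<bar>fwd h x - (v x)\<^sup>2\<bar> + \<bar>bwd h x - (v x)\<^sup>2\<bar> + \<bar>S - (v x)\<^sup>2\<bar>)"
  proof -
    have "b / 2 * ((fwd h x - (v x)\<^sup>2) + (bwd h x - (v x)\<^sup>2) - (S - (v x)\<^sup>2))
      \<le> b / 2 * (\<bar>fwd h x - (v x)\<^sup>2\<bar> + \<bar>bwd h x - (v x)\<^sup>2\<bar> + \<bar>S - (v x)\<^sup>2\<bar>)"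
      using b0 by (intro mult_left_mono) auto
    also have "\<dots> \<le> 1 / \<epsilon> * (\<bar>fwd h x - (v x)\<^sup>2\<bar> + \<bar>bwd h x - (v x)\<^sup>2\<bar> + \<bar>S - (v x)\<^sup>2\<bar>)"
      using b0 b2 by (intro mult_right_mono) auto
    finally show ?thesis .
  qed
  finally have s3: "b * ((((f (x + h) - f x) / h)\<^sup>2 + ((f x - f (x - h)) / h)\<^sup>2) / 2 - S / 2)
      \<le> b * (v x)\<^sup>2 / 2 + 1 / \<epsilon> * (\<bar>fwd h x - (v x)\<^sup>2\<bar> + \<bar>bwd h x - (v x)\<^sup>2\<bar> + \<bar>S - (v x)\<^sup>2\<bar>)" by simp
  have s4: "v x * (\<psi> x * neg_sq \<epsilon> w) + b * (v x)\<^sup>2 / 2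
      \<le> \<bar>v x * (neg_sq \<epsilon> w - neg_sq \<epsilon> (v x))\<bar> + \<bar>(v x)\<^sup>2 * (neg_sq' \<epsilon> w - neg_sq' \<epsilon> (v x))\<bar>"
  proof -
    have "v x * (\<psi> x * neg_sq \<epsilon> w) + b * (v x)\<^sup>2 / 2
       = \<psi> x * (v x * neg_sq \<epsilon> (v x) - (v x)\<^sup>2 * neg_sq' \<epsilon> (v x) / 2)
         + \<psi> x * (v x * (neg_sq \<epsilon> w - neg_sq \<epsilon> (v x)) - (v x)\<^sup>2 * (neg_sq' \<epsilon> w - neg_sq' \<epsilon> (v x)) / 2)"
      unfolding b_def by (simp add: field_simps)
    also have "\<psi> x * (v x * neg_sq \<epsilon> (v x) - (v x)\<^sup>2 * neg_sq' \<epsilon> (v x) / 2) \<le> 0"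
      using neg_sq_cubic[OF eps] \<psi>_range(1) by (simp add: mult_nonneg_nonpos)
    also have "\<psi> x * (v x * (neg_sq \<epsilon> w - neg_sq \<epsilon> (v x)) - (v x)\<^sup>2 * (neg_sq' \<epsilon> w - neg_sq' \<epsilon> (v x)) / 2)
        \<le> \<psi> x * (\<bar>v x * (neg_sq \<epsilon> w - neg_sq \<epsilon> (v x))\<bar> + \<bar>(v x)\<^sup>2 * (neg_sq' \<epsilon> w - neg_sq' \<epsilon> (v x))\<bar>)"
      using \<psi>_range(1) by (intro mult_left_mono) (auto simp: abs_if)
    also have "\<dots> \<le> 1 * (\<bar>v x * (neg_sq \<epsilon> w - neg_sq \<epsilon> (v x))\<bar> + \<bar>(v x)\<^sup>2 * (neg_sq' \<epsilon> w - neg_sq' \<epsilon> (v x))\<bar>)"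
      using \<psi>_range(2) by (intro mult_right_mono) auto
    finally show ?thesis by simp
  qed
  have alg: "p * e * (T - X) = - (- (p * e)) * (T - S / 2) + (- (p * e)) * (X - S / 2)" for p e T X :: real
    by (simp add: algebra_simps)
  have "rate_density h x = - b * (second_diff h \<Theta> x - S / 2)
      + b * ((((f (x + h) - f x) / h)\<^sup>2 + ((f x - f (x - h)) / h)\<^sup>2) / 2 - S / 2)
      + v x * (\<psi> x * neg_sq \<epsilon> w) + f x * (\<psi>' x * neg_sq \<epsilon> w)"
    unfolding rate_density_def w_def[symmetric] b_def alg ..
  moreover have "(U * D + 1) * S = U * (D * S) + S" by (simp add: algebra_simps)
  ultimately show ?thesis using s1 s2 s3 s4 unfolding rem_def w_def[symmetric] S_def[symmetric]
    by linarith
qed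

lemma cts_integrable:
  "set_integrable lborel {A..B} (fwd h)" "set_integrable lborel {A..B} (bwd h)" "set_integrable lborel {A..B} (second_diff h \<Psi>)"
  by (intro set_integrable_cts cont_fwd cont_bwd second_diff_continuous cont\<Psi>)+

lemma borels [measurable]: "v \<in> borel_measurable borel" "fwd h \<in> borel_measurable borel" "bwd h \<in> borel_measurable borel"
  "second_diff h \<Psi> \<in> borel_measurable borel" "second_diff h \<Phi> \<in> borel_measurable borel"
  by (auto intro!: primitiveD(1)[OF f] borel_measurable_continuous_onI cont_fwd cont_bwd second_diff_continuous cont\<Psi> cont\<Phi>)

lemma neg_sq_diff: "\<bar>neg_sq \<epsilon> a - neg_sq \<epsilon> b\<bar> \<le> 1 / \<epsilon>" "\<bar>neg_sq' \<epsilon> a - neg_sq' \<epsilon> b\<bar> \<le> 2 / \<epsilon>"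
  using neg_sq_nonneg[OF eps, of a] neg_sq_nonneg[OF eps, of b] neg_sq_bounded[OF eps, of a] neg_sq_bounded[OF eps, of b]
    neg_sq'_bounded[OF eps, of a] neg_sq'_bounded[OF eps, of b] by auto

lemma neg_sq_borels [measurable]: "neg_sq \<epsilon> \<in> borel_measurable borel" "neg_sq' \<epsilon> \<in> borel_measurable borel"
  using neg_sq_borel[OF eps] by auto

definition rem1 where "rem1 h x = \<bar>v x * (neg_sq \<epsilon> (second_diff h \<Phi> x) - neg_sq \<epsilon> (v x))\<bar>"
definition rem2 where "rem2 h x = \<bar>(v x)\<^sup>2 * (neg_sq' \<epsilon> (second_diff h \<Phi> x) - neg_sq' \<epsilon> (v x))\<bar>"

lemma rem_borels [measurable]: "rem1 h \<in> borel_measurable borel" "rem2 h \<in> borel_measurable borel"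
  unfolding rem1_def[abs_def] rem2_def[abs_def] by measurable

lemma abs_v_integrable: "set_integrable lborel {A..B} (\<lambda>x. \<bar>v x\<bar>)"
  by (rule set_integrable_abs[OF primitiveD(2)[OF f]])

lemma rem1_le: "rem1 h x \<le> 1 / \<epsilon> * \<bar>v x\<bar>"
  unfolding rem1_def abs_mult using mult_left_mono[OF neg_sq_diff(1) abs_ge_zero[of "v x"]] by (simp add: mult.commute)

lemma rem2_le: "rem2 h x \<le> 2 / \<epsilon> * (v x)\<^sup>2"
  unfolding rem2_def abs_mult using mult_left_mono[OF neg_sq_diff(2) zero_le_power2[of "v x"]] by (simp add: mult.commute)

lemma rem12_nonneg: "0 \<le> rem1 h x" "0 \<le> rem2 h x" unfolding rem1_def rem2_def by auto

lemma rem12_integrable: "set_integrable lborel {A..B} (rem1 h)" "set_integrable lborel {A..B} (rem2 h)"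
proof -
  have "set_integrable lborel {A..B} (\<lambda>x. 1 / \<epsilon> * \<bar>v x\<bar>)" by (intro set_integrable_mult_right abs_v_integrable)
  then show "set_integrable lborel {A..B} (rem1 h)"
    unfolding set_integrable_def
    by (rule Bochner_Integration.integrable_bound)
       (use rem1_le rem12_nonneg eps in \<open>auto intro!: always_eventually simp: indicator_def abs_mult\<close>)
  have "set_integrable lborel {A..B} (\<lambda>x. 2 / \<epsilon> * (v x)\<^sup>2)" by (intro set_integrable_mult_right vsq_integrable)
  then show "set_integrable lborel {A..B} (rem2 h)"
    unfolding set_integrable_def
    by (rule Bochner_Integration.integrable_bound)
       (use rem2_le rem12_nonneg eps in \<open>auto intro!: always_eventually simp: indicator_def abs_mult\<close>)
qed

lemma dev_integrable:
  "set_integrable lborel {A..B} (\<lambda>x. \<bar>fwd h x - (v x)\<^sup>2\<bar>)"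
  "set_integrable lborel {A..B} (\<lambda>x. \<bar>bwd h x - (v x)\<^sup>2\<bar>)"
  "set_integrable lborel {A..B} (\<lambda>x. \<bar>second_diff h \<Psi> x - (v x)\<^sup>2\<bar>)"
  by (intro set_integrable_abs set_integral_diff cts_integrable vsq_integrable)+

lemma rem_split: "rem h x = rem1 h x + 1 / \<epsilon> * (\<bar>fwd h x - (v x)\<^sup>2\<bar> + \<bar>bwd h x - (v x)\<^sup>2\<bar> + \<bar>second_diff h \<Psi> x - (v x)\<^sup>2\<bar>) + rem2 h x"
  unfolding rem_def rem1_def rem2_def by simp

lemma rem_integrable: "set_integrable lborel {A..B} (rem h)"
  unfolding rem_split[abs_def]
  by (intro set_integral_add(1) rem12_integrable set_integrable_mult_right dev_integrable)

lemma rem_integral: "(LBINT x:{A..B}. rem h x) = (LBINT x:{A..B}. rem1 h x) + 1 / \<epsilon> *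
   ((LBINT x:{A..B}. \<bar>fwd h x - (v x)\<^sup>2\<bar>) + (LBINT x:{A..B}. \<bar>bwd h x - (v x)\<^sup>2\<bar>) + (LBINT x:{A..B}. \<bar>second_diff h \<Psi> x - (v x)\<^sup>2\<bar>))
   + (LBINT x:{A..B}. rem2 h x)"
  unfolding rem_split
  by (subst set_integral_add(2); (intro set_integral_add(1) rem12_integrable set_integrable_mult_right dev_integrable)?)+
     (subst set_integral_mult_right, (subst set_integral_add(2); (intro set_integral_add(1) dev_integrable)?)+, rule refl)

lemma AE_w_tendsto:
  assumes h: "\<And>n. h n > 0" "h \<longlonglongrightarrow> 0"
  shows "AE x in lborel. (\<lambda>n. second_diff (h n) \<Phi> x) \<longlonglongrightarrow> v x"
  using primitive_AE_deriv[OF f] by eventually_elim (rule second_diff_tendsto[OF \<Phi> _ h])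

lemma rem_tendsto:
  assumes h: "\<And>n. h n > 0" "h \<longlonglongrightarrow> 0" and AB: "A \<le> B"
  shows "(\<lambda>n. LBINT x:{A..B}. rem (h n) x) \<longlonglongrightarrow> 0"
proof -
  have 1: "(\<lambda>n. LBINT x:{A..B}. rem1 (h n) x) \<longlonglongrightarrow> (LBINT x:{A..B}. 0)"
    unfolding set_lebesgue_integral_def
  proof (rule integral_dominated_convergence[where w="\<lambda>x. indicator {A..B} x *\<^sub>R (1 / \<epsilon> * \<bar>v x\<bar>)"])
    show "integrable lborel (\<lambda>x. indicator {A..B} x *\<^sub>R (1 / \<epsilon> * \<bar>v x\<bar>))"
      using set_integrable_mult_right[of "1/\<epsilon>", OF abs_v_integrable] unfolding set_integrable_def by blast
    show "AE x in lborel. (\<lambda>n. indicator {A..B} x *\<^sub>R rem1 (h n) x) \<longlonglongrightarrow> indicator {A..B} x *\<^sub>R 0"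
      using AE_w_tendsto[OF h]
    proof eventually_elim
      case (elim x)
      have "isCont (neg_sq \<epsilon>) (v x)" using neg_sq_deriv[OF eps] DERIV_isCont by blast
      from isCont_tendsto_compose[OF this elim]
      have "(\<lambda>n. \<bar>v x * (neg_sq \<epsilon> (second_diff (h n) \<Phi> x) - neg_sq \<epsilon> (v x))\<bar>) \<longlonglongrightarrow> \<bar>v x * (neg_sq \<epsilon> (v x) - neg_sq \<epsilon> (v x))\<bar>"
        by (intro tendsto_intros)
      then show ?case unfolding rem1_def by (intro tendsto_intros) simp
    qed
  qed (use rem1_le rem12_nonneg in \<open>auto intro!: always_eventually simp: indicator_def\<close>)
  have 2: "(\<lambda>n. LBINT x:{A..B}. rem2 (h n) x) \<longlonglongrightarrow> (LBINT x:{A..B}. 0)"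
    unfolding set_lebesgue_integral_def
  proof (rule integral_dominated_convergence[where w="\<lambda>x. indicator {A..B} x *\<^sub>R (2 / \<epsilon> * (v x)\<^sup>2)"])
    show "integrable lborel (\<lambda>x. indicator {A..B} x *\<^sub>R (2 / \<epsilon> * (v x)\<^sup>2))"
      using set_integrable_mult_right[of "2/\<epsilon>", OF vsq_integrable] unfolding set_integrable_def by blast
    show "AE x in lborel. (\<lambda>n. indicator {A..B} x *\<^sub>R rem2 (h n) x) \<longlonglongrightarrow> indicator {A..B} x *\<^sub>R 0"
      using AE_w_tendsto[OF h]
    proof eventually_elim
      case (elim x)
      have "isCont (neg_sq' \<epsilon>) (v x)" using neg_sq'_cont[OF eps, of UNIV] by (simp add: continuous_on_eq_continuous_at)
      from isCont_tendsto_compose[OF this elim]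
      have "(\<lambda>n. \<bar>(v x)\<^sup>2 * (neg_sq' \<epsilon> (second_diff (h n) \<Phi> x) - neg_sq' \<epsilon> (v x))\<bar>) \<longlonglongrightarrow> \<bar>(v x)\<^sup>2 * (neg_sq' \<epsilon> (v x) - neg_sq' \<epsilon> (v x))\<bar>"
        by (intro tendsto_intros)
      then show ?case unfolding rem2_def by (intro tendsto_intros) simp
    qed
  qed (use rem2_le rem12_nonneg in \<open>auto intro!: always_eventually simp: indicator_def\<close>)
  have 3: "(\<lambda>n. LBINT x:{A..B}. \<bar>fwd (h n) x - (v x)\<^sup>2\<bar>) \<longlonglongrightarrow> 0"
  proof (rule primitive_L1_approx[OF Q _ AB cont_fwd _ fwd_deriv])
    show "AE x in lborel. (\<lambda>n. fwd (h n) x) \<longlonglongrightarrow> (v x)\<^sup>2"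
      using primitive_AE_deriv[OF Q] unfolding fwd_def by eventually_elim (rule quot_tendsto(1)[OF _ h])
    show "(\<lambda>n. (\<Psi> (x + h n) - \<Psi> x) / h n) \<longlonglongrightarrow> Q x" for x by (rule quot_tendsto(1)[OF \<Psi> h])
  qed (use fwd_nonneg h in auto)
  have 4: "(\<lambda>n. LBINT x:{A..B}. \<bar>bwd (h n) x - (v x)\<^sup>2\<bar>) \<longlonglongrightarrow> 0"
  proof (rule primitive_L1_approx[OF Q _ AB cont_bwd _ bwd_deriv])
    show "AE x in lborel. (\<lambda>n. bwd (h n) x) \<longlonglongrightarrow> (v x)\<^sup>2"
      using primitive_AE_deriv[OF Q] unfolding bwd_def by eventually_elim (rule quot_tendsto(2)[OF _ h])
    show "(\<lambda>n. (\<Psi> x - \<Psi> (x - h n)) / h n) \<longlonglongrightarrow> Q x" for x by (rule quot_tendsto(2)[OF \<Psi> h])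
  qed (use bwd_nonneg h in auto)
  obtain \<Xi> where \<Xi>: "\<And>x. (\<Xi> has_real_derivative \<Psi> x) (at x)" using antiderivative_exists[OF cont\<Psi>] by blast
  have 5: "(\<lambda>n. LBINT x:{A..B}. \<bar>second_diff (h n) \<Psi> x - (v x)\<^sup>2\<bar>) \<longlonglongrightarrow> 0"
  proof (rule primitive_L1_approx[OF Q _ AB _ _ second_diff_deriv[OF \<Xi>]])
    show "AE x in lborel. (\<lambda>n. second_diff (h n) \<Psi> x) \<longlonglongrightarrow> (v x)\<^sup>2"
      using primitive_AE_deriv[OF Q] by eventually_elim (rule second_diff_tendsto[OF \<Psi> _ h])
    show "(\<lambda>n. second_diff (h n) \<Xi> x) \<longlonglongrightarrow> Q x" for x by (rule second_diff_tendsto[OF \<Xi> \<Psi> h])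
  qed (use hat_avg_nonneg h second_diff_continuous[OF cont\<Psi>] in auto)
  have "(\<lambda>n. LBINT x:{A..B}. rem (h n) x) \<longlonglongrightarrow> 0 + 1 / \<epsilon> * (0 + 0 + 0) + 0"
    unfolding rem_integral using 1 2 by (intro tendsto_intros 3 4 5) simp_all
  then show ?thesis by simp
qed

text \<open>The limiting growth rate. It must not depend on \<open>\<epsilon>\<close>.\<close>

definition bound :: real where "bound = (U * D + 1) * E + 2 * R * C\<^sup>2"

lemma const_int: "(LBINT x:{-R..R}. c) = 2 * R * (c::real)"
  using R by (simp add: set_integral_const)

lemma rate_le:
  assumes h: "0 < h" "h \<le> 1"
  shows "rate h \<le> bound + (LBINT x:{-R..R}. rem h x)"
proof -
  have ci: "set_integrable lborel {-R..R} (\<lambda>x. C\<^sup>2)" by (intro set_integrable_cts continuous_intros)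
  have Si: "set_integrable lborel {-R..R} (\<lambda>x. (U * D + 1) * second_diff h \<Psi> x)"
    by (intro set_integrable_mult_right cts_integrable)
  have "rate h \<le> (LBINT x:{-R..R}. (U * D + 1) * second_diff h \<Psi> x + C\<^sup>2 + rem h x)"
    unfolding rate_eq[OF h(1)]
    by (intro set_integral_le_AE rate_density_integrable h set_integral_add(1) Si ci rem_integrable always_eventually)
       (use rate_density_le[OF h] in auto)
  also have "\<dots> = (U * D + 1) * (LBINT x:{-R..R}. second_diff h \<Psi> x) + 2 * R * C\<^sup>2 + (LBINT x:{-R..R}. rem h x)"
    by (simp add: set_integral_add(2)[OF set_integral_add(1)[OF Si ci] rem_integrable] set_integral_add(2)[OF Si ci] const_int)
  also have "(U * D + 1) * (LBINT x:{-R..R}. second_diff h \<Psi> x) \<le> (U * D + 1) * E"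
    using U_nonneg D_nonneg R by (intro mult_left_mono hat_avg_int h) auto
  finally show ?thesis by (simp add: bound_def)
qed

text \<open>A bound for \<open>rate\<close> that is uniform in \<open>h\<close> but not in \<open>\<epsilon>\<close>; it only serves as a dominating constant when
  \<open>h \<rightarrow> 0\<close> under the time integral.\<close>

definition crude_bound :: real where "crude_bound = 1 / \<epsilon> * (2 * R * (C + 1) + 4 * E) + U * D * E"

lemma rate_density_abs:
  assumes h: "0 < h" "h \<le> 1" and x: "x \<in> {-R..R}"
  shows "\<bar>rate_density h x\<bar> \<le> 1 / \<epsilon> * ((C + 1) + (second_diff h \<Psi> x + fwd h x + bwd h x + (v x)\<^sup>2)) + U * D * second_diff h \<Psi> x"
proof -
  define w where "w = second_diff h \<Phi> x"
  have w2: "w\<^sup>2 \<le> second_diff h \<Psi> x" using hat_avg_ge[OF h(1)] by (simp add: w_def)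
  \<comment> \<open>The time derivative of the averaged slope without its transport term.\<close>
  define K where "K = second_diff h \<Theta> x - (((f (x + h) - f x) / h)\<^sup>2 + ((f x - f (x - h)) / h)\<^sup>2) / 2"
  have S0: "0 \<le> second_diff h \<Psi> x" by (rule hat_avg_nonneg[OF h(1)])
  have K: "\<bar>K\<bar> \<le> C + second_diff h \<Psi> x + fwd h x + bwd h x"
  proof -
    have "\<bar>T - (P + M) / 2\<bar> \<le> C + S + p + m"
      if "\<bar>T - S / 2\<bar> \<le> C" "P \<le> p" "M \<le> m" "0 \<le> S" "0 \<le> p" "0 \<le> m" "0 \<le> P" "0 \<le> M" for T P M S p m :: real
    proof -
      have T: "T - S / 2 \<le> C" "S / 2 - T \<le> C" using that(1) by auto
      have "T - (P + M) / 2 \<le> C + S + p + m" using T that(2-) by argo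
      moreover have "- (T - (P + M) / 2) \<le> C + S + p + m" using T that(2-) by argo
      ultimately show ?thesis by (rule abs_leI)
    qed
    from this[OF source_split[OF h x] dq_le[OF h(1), of x] S0 fwd_nonneg[OF h(1), of x] bwd_nonneg[OF h(1), of x] zero_le_power2 zero_le_power2]
    show ?thesis unfolding K_def .
  qed
  have a1: "\<bar>\<psi> x * neg_sq' \<epsilon> w * K\<bar> \<le> 1 / \<epsilon> * (C + second_diff h \<Psi> x + fwd h x + bwd h x)"
  proof -
    have "\<bar>\<psi> x * neg_sq' \<epsilon> w\<bar> \<le> 1 * (1 / \<epsilon>)"
      unfolding abs_mult using \<psi>_range neg_sq'_bounded[OF eps, of w] by (intro mult_mono) auto
    then show ?thesis unfolding abs_mult[of "\<psi> x * neg_sq' \<epsilon> w"] using K eps by (intro mult_mono) auto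
  qed
  have a2: "\<bar>v x * (\<psi> x * neg_sq \<epsilon> w)\<bar> \<le> 1 / \<epsilon> * (1 + (v x)\<^sup>2)"
  proof -
    have "\<bar>\<psi> x * neg_sq \<epsilon> w\<bar> \<le> 1 * (1 / \<epsilon>)"
      unfolding abs_mult using \<psi>_range neg_sq_nonneg[OF eps, of w] neg_sq_bounded[OF eps, of w] by (intro mult_mono) auto
    moreover have "\<bar>v x\<bar> \<le> 1 + (v x)\<^sup>2"
      using zero_le_power2[of "\<bar>v x\<bar> - 1"] by (simp add: power2_diff)
    ultimately have "\<bar>v x\<bar> * \<bar>\<psi> x * neg_sq \<epsilon> w\<bar> \<le> (1 + (v x)\<^sup>2) * (1 / \<epsilon>)"
      by (intro mult_mono) auto
    then show ?thesis by (simp add: abs_mult mult.commute)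
  qed
  have "\<bar>f x * (\<psi>' x * neg_sq \<epsilon> w)\<bar> = \<bar>f x\<bar> * (\<bar>\<psi>' x\<bar> * neg_sq \<epsilon> w)" using neg_sq_nonneg[OF eps, of w] by (simp add: abs_mult)
  also have "\<dots> \<le> U * (D * second_diff h \<Psi> x)"
    using U[OF x] \<psi>'[of x] U_nonneg D_nonneg neg_sq_le_sq[OF eps, of w] neg_part_sq_le[of w] w2 neg_sq_nonneg[OF eps, of w]
    by (intro mult_mono mult_nonneg_nonneg) auto
  finally have a3: "\<bar>f x * (\<psi>' x * neg_sq \<epsilon> w)\<bar> \<le> U * D * second_diff h \<Psi> x" by simp
  have "rate_density h x = \<psi> x * neg_sq' \<epsilon> w * K + v x * (\<psi> x * neg_sq \<epsilon> w) + f x * (\<psi>' x * neg_sq \<epsilon> w)"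
    unfolding rate_density_def w_def K_def by simp
  then have "\<bar>rate_density h x\<bar> \<le> \<bar>\<psi> x * neg_sq' \<epsilon> w * K\<bar> + \<bar>v x * (\<psi> x * neg_sq \<epsilon> w)\<bar> + \<bar>f x * (\<psi>' x * neg_sq \<epsilon> w)\<bar>" by linarith
  also have "\<dots> \<le> 1 / \<epsilon> * (C + second_diff h \<Psi> x + fwd h x + bwd h x) + 1 / \<epsilon> * (1 + (v x)\<^sup>2) + U * D * second_diff h \<Psi> x"
    using a1 a2 a3 by linarith
  finally show ?thesis by (simp add: algebra_simps)
qed

lemma rate_abs:
  assumes h: "0 < h" "h \<le> 1" shows "\<bar>rate h\<bar> \<le> crude_bound"
proof -
  have ci: "set_integrable lborel {-R..R} (\<lambda>x. C + 1)" by (intro set_integrable_cts continuous_intros)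
  note i4 = set_integral_add(1)[OF set_integral_add(1)[OF set_integral_add(1)[OF cts_integrable(3)[of "-R" R h] cts_integrable(1)[of "-R" R h]] cts_integrable(2)[of "-R" R h]] vsq_integrable[of "-R" R]]
  note i5 = set_integrable_mult_right[of "1 / \<epsilon>", OF set_integral_add(1)[OF ci i4]]
  note i6 = set_integrable_mult_right[of "U * D", OF cts_integrable(3)[of "-R" R h]]
  have "\<bar>rate h\<bar> \<le> (LBINT x:{-R..R}. \<bar>rate_density h x\<bar>)"
    unfolding rate_eq[OF h(1)] set_lebesgue_integral_def
    by (rule order_trans[OF integral_abs_bound]) (simp add: abs_mult)
  also have "\<dots> \<le> (LBINT x:{-R..R}. 1 / \<epsilon> * ((C + 1) + (second_diff h \<Psi> x + fwd h x + bwd h x + (v x)\<^sup>2)) + U * D * second_diff h \<Psi> x)"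
    by (intro set_integral_le_AE set_integrable_abs rate_density_integrable h always_eventually)
       (use rate_density_abs[OF h] set_integral_add(1)[OF i5 i6] in auto)
  also have "\<dots> = 1 / \<epsilon> * (2 * R * (C + 1) + ((LBINT x:{-R..R}. second_diff h \<Psi> x) + (LBINT x:{-R..R}. fwd h x)
      + (LBINT x:{-R..R}. bwd h x) + (LBINT x:{-R..R}. (v x)\<^sup>2))) + U * D * (LBINT x:{-R..R}. second_diff h \<Psi> x)"
    unfolding set_integral_add(2)[OF i5 i6] set_integral_mult_right set_integral_add(2)[OF ci i4]
      set_integral_add(2)[OF set_integral_add(1)[OF set_integral_add(1)[OF cts_integrable(3) cts_integrable(1)] cts_integrable(2)] vsq_integrable]
      set_integral_add(2)[OF set_integral_add(1)[OF cts_integrable(3) cts_integrable(1)] cts_integrable(2)]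
      set_integral_add(2)[OF cts_integrable(3) cts_integrable(1)] const_int by simp
  also have "\<dots> \<le> 1 / \<epsilon> * (2 * R * (C + 1) + (E + E + E + E)) + U * D * E"
    using R eps U_nonneg D_nonneg
    by (intro add_mono mult_left_mono order_refl hat_avg_int fwd_int bwd_int vsq_int h) auto
  finally show ?thesis by (simp add: crude_bound_def)
qed

end

section \<open>Limits of primitives with bounded energy\<close>

lemma L2_Fatou:
  fixes w :: "nat \<Rightarrow> real \<Rightarrow> real"
  assumes [measurable]: "\<And>n. w n \<in> borel_measurable borel" "v \<in> borel_measurable borel"
    and lim: "AE x in lborel. (\<lambda>n. w n x) \<longlonglongrightarrow> v x"
    and int: "\<And>n. integrable lborel (\<lambda>x. (w n x)\<^sup>2)"
    and le: "\<forall>\<^sub>F n in sequentially. (LBINT x. (w n x)\<^sup>2) \<le> c"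
  shows "integrable lborel (\<lambda>x. (v x)\<^sup>2)" "(LBINT x. (v x)\<^sup>2) \<le> c"
proof -
  have "(\<integral>\<^sup>+x. ennreal ((v x)\<^sup>2) \<partial>lborel) = (\<integral>\<^sup>+x. liminf (\<lambda>n. ennreal ((w n x)\<^sup>2)) \<partial>lborel)"
  proof (rule nn_integral_cong_AE)
    show "AE x in lborel. ennreal ((v x)\<^sup>2) = liminf (\<lambda>n. ennreal ((w n x)\<^sup>2))"
      using lim
    proof eventually_elim
      case (elim x)
      have "(\<lambda>n. ennreal ((w n x)\<^sup>2)) \<longlonglongrightarrow> ennreal ((v x)\<^sup>2)"
        by (intro tendsto_ennrealI tendsto_intros elim)
      then show ?case using lim_imp_Liminf trivial_limit_sequentially by metis
    qed
  qed
  also have "\<dots> \<le> liminf (\<lambda>n. \<integral>\<^sup>+x. ennreal ((w n x)\<^sup>2) \<partial>lborel)"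
    by (rule nn_integral_liminf) auto
  also have "\<dots> = liminf (\<lambda>n. ennreal (LBINT x. (w n x)\<^sup>2))"
    by (subst nn_integral_eq_integral[OF int]) auto
  also have "\<dots> \<le> liminf (\<lambda>n::nat. ennreal c)"
    by (rule Liminf_mono) (use le in \<open>auto elim!: eventually_mono intro: ennreal_leI\<close>)
  also have "\<dots> = ennreal c" by (simp add: Liminf_const)
  finally have b: "(\<integral>\<^sup>+x. ennreal ((v x)\<^sup>2) \<partial>lborel) \<le> ennreal c" .
  have "0 \<le> c"
  proof -
    obtain n where "(LBINT x. (w n x)\<^sup>2) \<le> c" using le by (meson eventually_happens trivial_limit_sequentially)
    moreover have "0 \<le> (LBINT x. (w n x)\<^sup>2)" by (rule integral_nonneg_AE) auto
    ultimately show ?thesis by linarith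
  qed
  show i: "integrable lborel (\<lambda>x. (v x)\<^sup>2)"
    using b by (intro integrableI_bounded) (auto simp: top_unique less_top[symmetric] intro: le_less_trans)
  show "(LBINT x. (v x)\<^sup>2) \<le> c"
    using b nn_integral_eq_integral[OF i] \<open>0 \<le> c\<close> by simp
qed

lemma integrable_diff_sq:
  fixes a b :: "real \<Rightarrow> real"
  assumes [measurable]: "a \<in> borel_measurable borel" "b \<in> borel_measurable borel"
    and "integrable lborel (\<lambda>x. (a x)\<^sup>2)" "integrable lborel (\<lambda>x. (b x)\<^sup>2)"
  shows "integrable lborel (\<lambda>x. (a x - b x)\<^sup>2)" "integrable lborel (\<lambda>x. (a x + b x)\<^sup>2)"
proof -
  have s: "integrable lborel (\<lambda>x. 2 * (a x)\<^sup>2 + 2 * (b x)\<^sup>2)" using assms by simp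
  have "(p - q)\<^sup>2 \<le> 2 * p\<^sup>2 + 2 * q\<^sup>2" "(p + q)\<^sup>2 \<le> 2 * p\<^sup>2 + 2 * q\<^sup>2" for p q :: real
    using zero_le_power2[of "p + q"] zero_le_power2[of "p - q"] by (auto simp: power2_sum power2_diff)
  then show "integrable lborel (\<lambda>x. (a x - b x)\<^sup>2)" "integrable lborel (\<lambda>x. (a x + b x)\<^sup>2)"
    by (auto intro!: Bochner_Integration.integrable_bound[OF s] always_eventually)
qed

lemma set_integral_abs_le_L2:
  fixes z :: "real \<Rightarrow> real"
  assumes [measurable]: "z \<in> borel_measurable borel" and z: "integrable lborel (\<lambda>x. (z x)\<^sup>2)" and d: "d > 0" and xy: "x \<le> y"
  shows "set_integrable lborel {x..y} z" "\<bar>LBINT u:{x..y}. z u\<bar> \<le> d * (y - x) + (LBINT u. (z u)\<^sup>2) / d"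
proof -
  have b: "\<bar>r\<bar> \<le> d + r\<^sup>2 / d" for r
  proof -
    have "\<bar>r\<bar> * d \<le> d\<^sup>2 + r\<^sup>2"
    proof -
      have "0 \<le> \<bar>r\<bar> * d" using d by simp
      moreover have "2 * (\<bar>r\<bar> * d) \<le> d\<^sup>2 + r\<^sup>2"
        using zero_le_power2[of "\<bar>r\<bar> - d"] by (simp add: power2_diff)
      ultimately show ?thesis by linarith
    qed
    then show ?thesis using d by (simp add: field_simps power2_eq_square)
  qed
  have i: "integrable lborel (\<lambda>u. indicator {x..y} u * d + (z u)\<^sup>2 / d)"
    by (intro Bochner_Integration.integrable_add integrable_mult_left integrable_real_indicator)
       (use z in \<open>auto simp: emeasure_lborel_Icc_eq\<close>)
  have le: "\<bar>indicator {x..y} u *\<^sub>R z u\<bar> \<le> indicator {x..y} u * d + (z u)\<^sup>2 / d" for u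
    using b[of "z u"] d by (auto simp: indicator_def)
  show zi: "set_integrable lborel {x..y} z" unfolding set_integrable_def
    by (rule Bochner_Integration.integrable_bound[OF i]) (use le in \<open>auto intro!: always_eventually intro: order_trans[OF _ abs_ge_self]\<close>)
  have "\<bar>LBINT u:{x..y}. z u\<bar> \<le> (LBINT u. \<bar>indicator {x..y} u *\<^sub>R z u\<bar>)"
    unfolding set_lebesgue_integral_def by (rule integral_abs_bound)
  also have "\<dots> \<le> (LBINT u. indicator {x..y} u * d + (z u)\<^sup>2 / d)"
    using zi i le unfolding set_integrable_def by (intro integral_mono integrable_abs) auto
  also have "\<dots> = d * (y - x) + (LBINT u. (z u)\<^sup>2) / d"
    using z xy by (subst Bochner_Integration.integral_add) (auto simp: emeasure_lborel_Icc_eq)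
  finally show "\<bar>LBINT u:{x..y}. z u\<bar> \<le> d * (y - x) + (LBINT u. (z u)\<^sup>2) / d" .
qed

text \<open>Multiplication by a square integrable positive weight turns a Cauchy sequence in \<open>L\<^sup>2\<close> into one in \<open>L\<^sup>1\<close>,
  for which almost everywhere convergent subsequences are available.\<close>

lemma AE_convergent_subseq_L2:
  fixes w :: "nat \<Rightarrow> real \<Rightarrow> real"
  assumes [measurable]: "\<And>n. w n \<in> borel_measurable borel"
    and int: "\<And>n. integrable lborel (\<lambda>x. (w n x)\<^sup>2)"
    and cau: "\<And>e. e > 0 \<Longrightarrow> \<exists>N. \<forall>i\<ge>N. \<forall>j\<ge>N. (LBINT x. (w i x - w j x)\<^sup>2) < e"
  obtains r where "strict_mono r" "AE x in lborel. convergent (\<lambda>n. w (r n) x)"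
proof -
  define \<rho> where "\<rho> x = sqrt (std_normal_density x)" for x
  have \<rho>: "\<rho> x > 0" "(\<rho> x)\<^sup>2 = std_normal_density x" for x
    using normal_density_pos[of 1 0 x] by (auto simp: \<rho>_def)
  have [measurable]: "\<rho> \<in> borel_measurable borel" unfolding \<rho>_def[abs_def] by measurable
  have \<rho>i: "integrable lborel (\<lambda>x. (\<rho> x)\<^sup>2)" "(LBINT x. (\<rho> x)\<^sup>2) = 1"
    unfolding \<rho> using integrable_normal_density[of 1 0] integral_normal_density[of 1 0] by auto
  have b: "\<bar>p * q\<bar> \<le> d * q\<^sup>2 + p\<^sup>2 / d" if "d > 0" for p q d :: real
  proof -
    have "2 * (\<bar>p\<bar> * (d * \<bar>q\<bar>)) \<le> p\<^sup>2 + (d * \<bar>q\<bar>)\<^sup>2"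
      using zero_le_power2[of "\<bar>p\<bar> - d * \<bar>q\<bar>"] by (simp add: power2_diff)
    moreover have "0 \<le> \<bar>p\<bar> * (d * \<bar>q\<bar>)" using that by simp
    ultimately have "\<bar>p * q\<bar> * d \<le> p\<^sup>2 + d\<^sup>2 * q\<^sup>2" by (simp add: abs_mult power_mult_distrib mult_ac)
    then show ?thesis using that by (simp add: field_simps power2_eq_square)
  qed
  have pi: "integrable lborel (\<lambda>x. z x * \<rho> x)" "(LBINT x. norm (z x * \<rho> x)) \<le> d + (LBINT x. (z x)\<^sup>2) / d"
    if [measurable]: "z \<in> borel_measurable borel" and z: "integrable lborel (\<lambda>x. (z x)\<^sup>2)" and d: "d > 0" for z d
  proof -
    have i: "integrable lborel (\<lambda>x. d * (\<rho> x)\<^sup>2 + (z x)\<^sup>2 / d)" using z \<rho>i by simp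
    show zi: "integrable lborel (\<lambda>x. z x * \<rho> x)"
      by (rule Bochner_Integration.integrable_bound[OF i]) (use b[OF d] in \<open>auto intro!: always_eventually intro: order_trans[OF _ abs_ge_self]\<close>)
    have "(LBINT x. norm (z x * \<rho> x)) \<le> (LBINT x. d * (\<rho> x)\<^sup>2 + (z x)\<^sup>2 / d)"
      using zi i b[OF d] by (intro integral_mono) auto
    then show "(LBINT x. norm (z x * \<rho> x)) \<le> d + (LBINT x. (z x)\<^sup>2) / d" using z \<rho>i by simp
  qed
  obtain r where r: "strict_mono r" "AE x in lborel. Cauchy (\<lambda>i. w (r i) x * \<rho> x)"
  proof (rule cauchy_L1_AE_cauchy_subseq[of lborel "\<lambda>n x. w n x * \<rho> x"])
    show "integrable lborel (\<lambda>x. w n x * \<rho> x)" for n by (rule pi(1)[of "w n" 1]) (use int in auto)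
    fix e :: real assume e: "e > 0"
    define d where "d = e / 2"
    have d: "d > 0" using e by (simp add: d_def)
    obtain N where N: "\<forall>i\<ge>N. \<forall>j\<ge>N. (LBINT x. (w i x - w j x)\<^sup>2) < d * d" using cau[of "d * d"] d by auto
    have "(LBINT x. norm (w i x * \<rho> x - w j x * \<rho> x)) < e" if "i \<ge> N" "j \<ge> N" for i j
    proof -
      have "(LBINT x. norm ((w i x - w j x) * \<rho> x)) \<le> d + (LBINT x. (w i x - w j x)\<^sup>2) / d"
        by (rule pi(2)) (use d int in \<open>auto intro!: integrable_diff_sq\<close>)
      also have "\<dots> < d + d" using N that d by (simp add: pos_divide_less_eq)
      finally show ?thesis by (simp add: d_def left_diff_distrib)
    qed
    then show "\<exists>N. \<forall>i\<ge>N. \<forall>j\<ge>N. (LBINT x. norm (w i x * \<rho> x - w j x * \<rho> x)) < e" by blast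
  qed (use that in blast)
  have "AE x in lborel. convergent (\<lambda>n. w (r n) x)"
    using r(2)
  proof eventually_elim
    case (elim x)
    then obtain l where "(\<lambda>n. w (r n) x * \<rho> x) \<longlonglongrightarrow> l" using real_Cauchy_convergent convergent_def by blast
    then have "(\<lambda>n. w (r n) x * \<rho> x / \<rho> x) \<longlonglongrightarrow> l / \<rho> x" using \<rho>(1)[of x] by (intro tendsto_intros) auto
    then have "(\<lambda>n. w (r n) x) \<longlonglongrightarrow> l / \<rho> x" using \<rho>(1)[of x] by (simp add: less_imp_neq[symmetric])
    then show ?case unfolding convergent_def by blast
  qed
  with r(1) show ?thesis by (rule that)
qed

lemma L2_complete:
  fixes w :: "nat \<Rightarrow> real \<Rightarrow> real"
  assumes m[measurable]: "\<And>n. w n \<in> borel_measurable borel"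
    and int: "\<And>n. integrable lborel (\<lambda>x. (w n x)\<^sup>2)"
    and cau: "\<And>e. e > 0 \<Longrightarrow> \<exists>N. \<forall>i\<ge>N. \<forall>j\<ge>N. (LBINT x. (w i x - w j x)\<^sup>2) < e"
    and le: "\<And>e. e > 0 \<Longrightarrow> \<forall>\<^sub>F n in sequentially. (LBINT x. (w n x)\<^sup>2) \<le> c + e"
  obtains v where "v \<in> borel_measurable borel" "integrable lborel (\<lambda>x. (v x)\<^sup>2)" "(LBINT x. (v x)\<^sup>2) \<le> c"
    "\<And>e. e > 0 \<Longrightarrow> \<forall>\<^sub>F n in sequentially. (LBINT x. (v x - w n x)\<^sup>2) \<le> e"
proof -
  obtain r where r: "strict_mono r" "AE x in lborel. convergent (\<lambda>n. w (r n) x)"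
    using AE_convergent_subseq_L2[OF m int cau] by blast
  define v where "v x = lim (\<lambda>n. w (r n) x)" for x
  have vm[measurable]: "v \<in> borel_measurable borel" unfolding v_def[abs_def] by measurable
  have lim: "AE x in lborel. (\<lambda>n. w (r n) x) \<longlonglongrightarrow> v x"
    using r(2) by eventually_elim (simp add: v_def convergent_LIMSEQ_iff)
  have sub: "filterlim r sequentially sequentially" using r(1) by (rule filterlim_subseq)
  have c: "integrable lborel (\<lambda>x. (v x)\<^sup>2)" "(LBINT x. (v x)\<^sup>2) \<le> c + e" if "e > 0" for e
    using L2_Fatou[of "\<lambda>n. w (r n)" v "c + e"] lim int eventually_compose_filterlim[OF le[OF that] sub] by auto
  have "(LBINT x. (v x)\<^sup>2) \<le> c" by (rule field_le_epsilon) (use c in auto)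
  moreover have "\<forall>\<^sub>F n in sequentially. (LBINT x. (v x - w n x)\<^sup>2) \<le> e" if e: "e > 0" for e
  proof -
    obtain N where N: "\<And>i j. i \<ge> N \<Longrightarrow> j \<ge> N \<Longrightarrow> (LBINT x. (w i x - w j x)\<^sup>2) < e" using cau[OF e] by blast
    have "(LBINT x. (v x - w n x)\<^sup>2) \<le> e" if "n \<ge> N" for n
    proof (rule L2_Fatou(2)[of "\<lambda>k x. w (r k) x - w n x"])
      show "AE x in lborel. (\<lambda>k. w (r k) x - w n x) \<longlonglongrightarrow> v x - w n x"
        using lim by eventually_elim (intro tendsto_intros)
      show "\<forall>\<^sub>F k in sequentially. (LBINT x. (w (r k) x - w n x)\<^sup>2) \<le> e"
        using eventually_compose_filterlim[OF eventually_ge_at_top[of N] sub]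
        by eventually_elim (use N that in \<open>auto intro: less_imp_le\<close>)
    qed (use int in \<open>auto intro!: integrable_diff_sq\<close>)
    then show ?thesis unfolding eventually_sequentially by blast
  qed
  ultimately show ?thesis using that[OF vm c(1)[of 1]] by auto
qed

text \<open>A closure theorem in place of weak compactness of balls in \<open>L\<^sup>2\<close>. The admissible slopes for accuracy
  \<open>n\<close> form a decreasing sequence of sets closed under midpoints. Elements that almost minimise the \<open>L\<^sup>2\<close>
  norm are then a Cauchy sequence by the parallelogram identity, and their limit is a slope of \<open>f\<close>.\<close>

lemma primitive_limit_L2:
  fixes f :: "real \<Rightarrow> real"
  assumes approx: "\<And>n::nat. \<exists>g v. primitive g v \<and> integrable lborel (\<lambda>x. (v x)\<^sup>2) \<and> (LBINT x. (v x)\<^sup>2) \<le> E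
      \<and> (\<forall>x\<in>{- real n..real n}. \<bar>g x - f x\<bar> \<le> 1 / real (Suc n))"
  obtains v where "primitive f v" "integrable lborel (\<lambda>x. (v x)\<^sup>2)" "(LBINT x. (v x)\<^sup>2) \<le> E"
proof -
  define S where "S n = {v. \<exists>g. primitive g v \<and> integrable lborel (\<lambda>x. (v x)\<^sup>2)
      \<and> (\<forall>x\<in>{- real n..real n}. \<bar>g x - f x\<bar> \<le> 1 / real (Suc n))}" for n
  define I where "I v = (LBINT x. (v x)\<^sup>2)" for v :: "real \<Rightarrow> real"
  have I0: "0 \<le> I v" for v unfolding I_def by (rule integral_nonneg_AE) auto
  have bdd: "bdd_below (I ` S n)" for n using I0 by (auto intro!: bdd_belowI[of _ 0])
  define d where "d n = Inf (I ` S n)" for n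
  have ex: "\<exists>v\<in>S n. I v \<le> E" for n using approx[of n] unfolding S_def I_def by blast
  have d_le: "d n \<le> I v" if "v \<in> S n" for n v unfolding d_def by (rule cINF_lower[OF bdd that])
  have dE: "d n \<le> E" for n using ex[of n] d_le by (meson order_trans)
  have S_anti: "S m \<subseteq> S n" if "n \<le> m" for n m
  proof -
    have le: "1 / real (Suc m) \<le> 1 / real (Suc n)" using that by (simp add: frac_le)
    have sub: "{- real n..real n} \<subseteq> {- real m..real m}" using that by auto
    show ?thesis
    proof
      fix v assume "v \<in> S m"
      then obtain g where g: "primitive g v" "integrable lborel (\<lambda>x. (v x)\<^sup>2)"
        "\<And>x. x \<in> {- real m..real m} \<Longrightarrow> \<bar>g x - f x\<bar> \<le> 1 / real (Suc m)" unfolding S_def by blast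
      have "\<bar>g x - f x\<bar> \<le> 1 / real (Suc n)" if "x \<in> {- real n..real n}" for x
        by (rule order_trans[OF g(3) le]) (use sub that in blast)
      then show "v \<in> S n" unfolding S_def using g(1,2) by blast
    qed
  qed
  have d_mono: "d n \<le> d m" if "n \<le> m" for n m
  proof -
    have "I ` S m \<noteq> {}" using ex[of m] by blast
    then show ?thesis unfolding d_def by (rule cInf_superset_mono[OF _ bdd]) (use S_anti[OF that] in blast)
  qed
  have "\<exists>w. w \<in> S n \<and> I w < d n + 1 / real (Suc n)" for n
    using cInf_lessD[of "I ` S n" "d n + 1 / real (Suc n)"] ex[of n] unfolding d_def by (auto simp del: of_nat_Suc)
  then obtain w where w: "\<And>n. w n \<in> S n" "\<And>n. I (w n) < d n + 1 / real (Suc n)" by metis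
  obtain g where g: "\<And>n. primitive (g n) (w n)" "\<And>n. integrable lborel (\<lambda>x. (w n x)\<^sup>2)"
      "\<And>n x. x \<in> {- real n..real n} \<Longrightarrow> \<bar>g n x - f x\<bar> \<le> 1 / real (Suc n)"
    using w(1) unfolding S_def mem_Collect_eq by metis
  have [measurable]: "w n \<in> borel_measurable borel" for n by (rule primitiveD(1)[OF g(1)])
  have mid: "(\<lambda>x. 1/2 * w n x + 1/2 * w m x) \<in> S n" if "n \<le> m" for n m
    unfolding S_def
  proof (intro CollectI exI conjI ballI)
    show "primitive (\<lambda>x. 1/2 * g n x + 1/2 * g m x) (\<lambda>x. 1/2 * w n x + 1/2 * w m x)"
      by (intro primitive_add primitive_cmult g)
    have "integrable lborel (\<lambda>x. (1/2)\<^sup>2 * (w n x + w m x)\<^sup>2)" by (intro integrable_mult_right integrable_diff_sq g) auto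
    then show "integrable lborel (\<lambda>x. (1/2 * w n x + 1/2 * w m x)\<^sup>2)"
      by (simp add: power_mult_distrib[symmetric] distrib_left)
    fix x assume x: "x \<in> {- real n..real n}"
    have "1 / real (Suc m) \<le> 1 / real (Suc n)" using that by (simp add: frac_le)
    moreover have "\<bar>g n x - f x\<bar> \<le> 1 / real (Suc n)" "\<bar>g m x - f x\<bar> \<le> 1 / real (Suc m)"
      using g(3)[of x n] g(3)[of x m] x that by auto
    ultimately show "\<bar>1/2 * g n x + 1/2 * g m x - f x\<bar> \<le> 1 / real (Suc n)" by (simp add: abs_le_iff del: of_nat_Suc)
  qed
  have par: "(LBINT x. (w n x - w m x)\<^sup>2) \<le> 2 * (d m - d n) + 4 / real (Suc n)" if nm: "n \<le> m" for n m
  proof -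
    have "(LBINT x. (w n x - w m x)\<^sup>2) = (LBINT x. 2 * (w n x)\<^sup>2 + 2 * (w m x)\<^sup>2 - (w n x + w m x)\<^sup>2)"
      by (intro Bochner_Integration.integral_cong) (auto simp: power2_sum power2_diff)
    also have "\<dots> = 2 * I (w n) + 2 * I (w m) - (LBINT x. (w n x + w m x)\<^sup>2)"
      unfolding I_def using g(2) by (subst Bochner_Integration.integral_diff) (auto intro!: integrable_diff_sq)
    also have "(LBINT x. (w n x + w m x)\<^sup>2) = 4 * I (\<lambda>x. 1/2 * w n x + 1/2 * w m x)"
      unfolding I_def integral_mult_right_zero[symmetric]
      by (intro Bochner_Integration.integral_cong) (auto simp: power2_sum field_simps power2_eq_square)
    finally have "(LBINT x. (w n x - w m x)\<^sup>2) = 2 * I (w n) + 2 * I (w m) - 4 * I (\<lambda>x. 1/2 * w n x + 1/2 * w m x)" .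
    moreover have "1 / real (Suc m) \<le> 1 / real (Suc n)" using nm by (simp add: frac_le)
    moreover have "X \<le> 2 * (dm - dn) + 4 * p"
      if "X = 2 * a + 2 * b - 4 * c" "q \<le> p" "a < dn + p" "b < dm + q" "dn \<le> c" for X a b c p q dn dm :: real
      using that by argo
    ultimately have "(LBINT x. (w n x - w m x)\<^sup>2) \<le> 2 * (d m - d n) + 4 * (1 / real (Suc n))"
      using w(2)[of n] w(2)[of m] d_le[OF mid[OF nm]] by blast
    then show ?thesis by simp
  qed
  have "norm (d n) \<le> max \<bar>d 0\<bar> \<bar>E\<bar>" for n using dE[of n] d_mono[of 0 n] by (auto simp: abs_le_iff)
  then have d_conv: "convergent d" using d_mono by (intro Bseq_mono_convergent BseqI'[of d "max \<bar>d 0\<bar> \<bar>E\<bar>"]) auto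
  have cau1: "\<exists>N. \<forall>n\<ge>N. \<forall>m\<ge>n. (LBINT x. (w n x - w m x)\<^sup>2) < e" if e: "e > 0" for e
  proof -
    have "Cauchy d" using d_conv convergent_Cauchy by blast
    then obtain N1 where N1: "\<And>m n. m \<ge> N1 \<Longrightarrow> n \<ge> N1 \<Longrightarrow> dist (d m) (d n) < e / 4"
      using metric_CauchyD[of d "e/4"] e by auto
    have "(\<lambda>n. 4 / real (Suc n)) \<longlonglongrightarrow> 0" using LIMSEQ_inverse_real_of_nat[THEN tendsto_mult_left, of 4] by (simp add: divide_inverse)
    then have "\<forall>\<^sub>F n in sequentially. 4 / real (Suc n) < e / 2" using e by (intro order_tendstoD) auto
    then obtain N2 where N2: "\<And>n. n \<ge> N2 \<Longrightarrow> 4 / real (Suc n) < e / 2" unfolding eventually_sequentially by blast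
    have "(LBINT x. (w n x - w m x)\<^sup>2) < e" if "n \<ge> max N1 N2" "m \<ge> n" for n m
    proof -
      have "dist (d m) (d n) < e / 4" using N1[of m n] that by simp
      then have "d m - d n < e / 4" unfolding dist_real_def by (rule le_less_trans[OF abs_ge_self])
      moreover have "4 / real (Suc n) < e / 2" using N2[of n] that by simp
      ultimately show ?thesis using par[OF that(2)] by argo
    qed
    then show ?thesis by blast
  qed
  have cau: "\<exists>N. \<forall>i\<ge>N. \<forall>j\<ge>N. (LBINT x. (w i x - w j x)\<^sup>2) < e" if e: "e > 0" for e
  proof -
    obtain N where N: "\<And>n m. n \<ge> N \<Longrightarrow> m \<ge> n \<Longrightarrow> (LBINT x. (w n x - w m x)\<^sup>2) < e" using cau1[OF e] by blast
    have "(LBINT x. (w i x - w j x)\<^sup>2) < e" if "i \<ge> N" "j \<ge> N" for i j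
      using N[of i j] N[of j i] that by (cases "i \<le> j") (auto simp: power2_commute[of "w i _"])
    then show ?thesis by blast
  qed
  have le: "\<forall>\<^sub>F n in sequentially. (LBINT x. (w n x)\<^sup>2) \<le> E + e" if e: "e > 0" for e
  proof -
    have "\<forall>\<^sub>F n in sequentially. 1 / real (Suc n) < e"
      using LIMSEQ_inverse_real_of_nat[THEN order_tendstoD(2), of e] e by (simp add: inverse_eq_divide)
    then show ?thesis
    proof eventually_elim
      case (elim n)
      have "I (w n) \<le> E + e" using w(2)[of n] dE[of n] elim by argo
      then show ?case by (simp add: I_def)
    qed
  qed
  obtain v where v: "v \<in> borel_measurable borel" "integrable lborel (\<lambda>x. (v x)\<^sup>2)" "(LBINT x. (v x)\<^sup>2) \<le> E"
    "\<And>e. e > 0 \<Longrightarrow> \<forall>\<^sub>F n in sequentially. (LBINT x. (v x - w n x)\<^sup>2) \<le> e"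
  proof (rule L2_complete[of w E, OF _ g(2) cau le])
    show "w n \<in> borel_measurable borel" for n by measurable
  qed (assumption | rule that)+
  note [measurable] = v(1)
  have vi: "set_integrable lborel {x..y} v" if "x \<le> y" for x y
    using set_integral_abs_le_L2(1)[OF v(1,2) zero_less_one that] .
  have "(LBINT u:{x..y}. v u) = f y - f x" if xy: "x \<le> y" for x y
  proof -
    have "\<bar>(LBINT u:{x..y}. v u) - (f y - f x)\<bar> \<le> 0 + e" if e: "e > 0" for e
    proof -
      define \<delta> where "\<delta> = e / (4 * (y - x + 1))"
      have \<delta>: "\<delta> > 0" "\<delta> * (y - x) \<le> e / 4"
        using e xy by (auto simp: \<delta>_def field_simps)
      have "\<forall>\<^sub>F n in sequentially. 1 / real (Suc n) < e / 4"
        using LIMSEQ_inverse_real_of_nat[THEN order_tendstoD(2), of "e/4"] e by (simp add: inverse_eq_divide)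
      moreover have "\<forall>\<^sub>F n in sequentially. max \<bar>x\<bar> \<bar>y\<bar> \<le> real n"
        using eventually_ge_at_top[of "nat \<lceil>max \<bar>x\<bar> \<bar>y\<bar>\<rceil>"] by eventually_elim linarith
      moreover have "\<forall>\<^sub>F n in sequentially. (LBINT x. (v x - w n x)\<^sup>2) \<le> \<delta> * (e / 4)" by (rule v(4)) (use \<delta> e in simp)
      ultimately have "\<forall>\<^sub>F n in sequentially. \<bar>(LBINT u:{x..y}. v u) - (f y - f x)\<bar> \<le> e"
      proof eventually_elim
        case (elim n)
        have "\<bar>LBINT u:{x..y}. v u - w n u\<bar> \<le> \<delta> * (y - x) + (LBINT u. (v u - w n u)\<^sup>2) / \<delta>"
          by (rule set_integral_abs_le_L2(2)) (use \<delta> xy v(2) g(2) in \<open>auto intro!: integrable_diff_sq\<close>)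
        also have "\<dots> \<le> e / 4 + e / 4" using \<delta> elim by (intro add_mono) (auto simp: pos_divide_le_eq mult.commute)
        finally have "\<bar>(LBINT u:{x..y}. v u) - (g n y - g n x)\<bar> \<le> e / 2"
          using primitiveD(3)[OF g(1) xy] set_integral_diff(2)[OF vi[OF xy] primitiveD(2)[OF g(1)], of n] by simp
        moreover have "x \<in> {- real n..real n}" "y \<in> {- real n..real n}" using elim(2) by (auto simp: abs_le_iff)
        then have "\<bar>g n y - f y\<bar> \<le> 1 / real (Suc n)" "\<bar>g n x - f x\<bar> \<le> 1 / real (Suc n)"
          by (blast intro: g(3))+
        moreover have "\<bar>V - (a - b)\<bar> \<le> e"
          if "\<bar>V - (a' - b')\<bar> \<le> e / 2" "\<bar>a' - a\<bar> \<le> q" "\<bar>b' - b\<bar> \<le> q" "q < e / 4" for V a b a' b' q :: real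
        proof -
          have "V - (a' - b') \<le> e / 2" "- (V - (a' - b')) \<le> e / 2" "a' - a \<le> q" "- (a' - a) \<le> q" "b' - b \<le> q" "- (b' - b) \<le> q"
            using that unfolding abs_le_iff by blast+
          then show ?thesis using that(4) by (intro abs_leI) argo+
        qed
        ultimately show ?case using elim(1) by blast
      qed
      then show ?thesis by simp
    qed
    then have "\<bar>(LBINT u:{x..y}. v u) - (f y - f x)\<bar> \<le> 0" by (rule field_le_epsilon)
    then show ?thesis by simp
  qed
  then have "primitive f v" using v(1) vi unfolding primitive_def by blast
  then show ?thesis using v that by blast
qed

section \<open>Slopes and source of a weak solution\<close>

lemma AE_lebesgue_on_ge0: "(AE t in lebesgue_on {0..}. P t) \<longleftrightarrow> (AE t in lborel. 0 \<le> (t::real) \<longrightarrow> P t)"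
  by (subst AE_restrict_space_iff) (auto simp: AE_completion_iff)

lemma AE_imp_dense:
  fixes P :: "real \<Rightarrow> bool"
  assumes "AE t in lborel. P t" "d > 0" shows "\<exists>s\<in>{t..t+d}. P s"
proof (rule ccontr)
  assume "\<not> ?thesis"
  then have "AE s in lborel. s \<notin> {t..t+d}" using assms(1) by (auto elim!: eventually_mono)
  then have "{t..t+d} \<in> null_sets lborel"
    by (subst (asm) AE_iff_null_sets[symmetric]) auto
  then show False using assms(2) by (auto simp: null_sets_def emeasure_lborel_Icc_eq)
qed

lemma has_weak_deriv_borel_rep:
  assumes "has_weak_deriv f g" "continuous_on UNIV f"
  obtains v where "primitive f v" "AE x in lebesgue. g x = v x"
proof -
  have loc: "(\<lambda>x. indicator {- real n..real n} x *\<^sub>R g x) \<in> borel_measurable lebesgue" for n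
    using assms(1) unfolding has_weak_deriv_def set_integrable_def by (metis borel_measurable_integrable compact_Icc)
  have "g \<in> borel_measurable lebesgue"
  proof (rule borel_measurable_LIMSEQ_real[OF _ loc])
    fix x :: real
    have "\<forall>\<^sub>F n in sequentially. \<bar>x\<bar> \<le> real n"
      using eventually_ge_at_top[of "nat \<lceil>\<bar>x\<bar>\<rceil>"] by eventually_elim linarith
    then have "\<forall>\<^sub>F n in sequentially. indicator {- real n..real n} x *\<^sub>R g x = g x"
      by eventually_elim (auto simp: indicator_def)
    then show "(\<lambda>n. indicator {- real n..real n} x *\<^sub>R g x) \<longlonglongrightarrow> g x" by (rule tendsto_eventually)
  qed
  then obtain v where v: "v \<in> borel_measurable lborel" "AE x in lborel. g x = v x"
    using completion_ex_borel_measurable_real by blast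
  then have ae: "AE x in lebesgue. g x = v x" by (simp add: AE_completion)
  show ?thesis
    using that[OF weak_deriv_imp_primitive[OF assms _ ae] ae] v(1) by simp
qed

text \<open>Existence makes the choice in \<open>weak_deriv\<close> meaningful, and Lebesgue differentiation makes it unique.\<close>

lemma weak_deriv_of_primitive:
  assumes "primitive f v" shows "AE x in lebesgue. weak_deriv f x = v x"
proof -
  have "has_weak_deriv f (weak_deriv f)"
    unfolding weak_deriv_def by (rule someI[of "has_weak_deriv f" v, OF primitive_imp_weak_deriv[OF assms]])
  from has_weak_deriv_borel_rep[OF this primitive_continuous[OF assms]]
  obtain w where w: "primitive f w" "AE x in lebesgue. weak_deriv f x = w x" .
  have "AE x in lebesgue. w x = v x" using primitive_AE_unique[OF w(1) assms] by (rule AE_completion)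
  with w(2) show ?thesis by eventually_elim simp
qed

lemma nn_integral_energy:
  assumes f: "continuous_on UNIV f" and v: "v \<in> borel_measurable borel" "AE x in lebesgue. weak_deriv f x = v x"
    and e: "(\<integral>\<^sup>+x. ennreal ((f x)\<^sup>2 + 1/2 * (weak_deriv f x)\<^sup>2) \<partial>lebesgue) \<le> ennreal M" and M: "0 \<le> M"
  shows "integrable lborel (\<lambda>x. (f x)\<^sup>2 + 1/2 * (v x)\<^sup>2)" "(LBINT x. (f x)\<^sup>2 + 1/2 * (v x)\<^sup>2) \<le> M"
    "integrable lborel (\<lambda>x. (v x)\<^sup>2)" "(LBINT x. (v x)\<^sup>2) \<le> 2 * M"
proof -
  note [measurable] = v(1)
  have [measurable]: "f \<in> borel_measurable borel" using f by (rule borel_measurable_continuous_onI)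
  have "(\<integral>\<^sup>+x. ennreal ((f x)\<^sup>2 + 1/2 * (weak_deriv f x)\<^sup>2) \<partial>lebesgue) = (\<integral>\<^sup>+x. ennreal ((f x)\<^sup>2 + 1/2 * (v x)\<^sup>2) \<partial>lebesgue)"
    by (rule nn_integral_cong_AE) (use v(2) in \<open>auto elim!: eventually_mono\<close>)
  also have "\<dots> = (\<integral>\<^sup>+x. ennreal ((f x)\<^sup>2 + 1/2 * (v x)\<^sup>2) \<partial>lborel)"
    by (rule nn_integral_completion)
  finally have le: "(\<integral>\<^sup>+x. ennreal ((f x)\<^sup>2 + 1/2 * (v x)\<^sup>2) \<partial>lborel) \<le> ennreal M" using e by simp
  show i: "integrable lborel (\<lambda>x. (f x)\<^sup>2 + 1/2 * (v x)\<^sup>2)"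
    using le by (intro integrableI_bounded) (auto simp: top_unique less_top[symmetric] intro: le_less_trans)
  show l: "(LBINT x. (f x)\<^sup>2 + 1/2 * (v x)\<^sup>2) \<le> M"
    using le nn_integral_eq_integral[OF i] M by simp
  have "integrable lborel (\<lambda>x. 1/2 * (v x)\<^sup>2)"
    by (rule Bochner_Integration.integrable_bound[OF i]) (auto intro!: always_eventually)
  from integrable_mult_right[of 2, OF this] show vi: "integrable lborel (\<lambda>x. (v x)\<^sup>2)" by simp
  have "(LBINT x. 1/2 * (v x)\<^sup>2) \<le> (LBINT x. (f x)\<^sup>2 + 1/2 * (v x)\<^sup>2)"
    using vi i by (intro integral_mono) auto
  then show "(LBINT x. (v x)\<^sup>2) \<le> 2 * M" using l by simp
qed

lemma continuous_slice:
  assumes "continuous_on ({0..} \<times> UNIV) (\<lambda>(t::real, x::real). (u t x :: real))" "0 \<le> t"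
  shows "continuous_on S (u t)"
proof -
  have "continuous_on S (\<lambda>x. (\<lambda>(t, x). u t x) (t, x))"
    by (rule continuous_on_compose2[OF assms(1)]) (use assms(2) in \<open>auto intro!: continuous_intros\<close>)
  then show ?thesis by simp
qed

text \<open>The energy bound is assumed for almost every time. Every other time is a limit of such times, and
  continuity of \<open>u\<close> gives locally uniform convergence of the profiles.\<close>

proposition weak_solution_H1:
  assumes sol: "CH_weak_solution u0 u"
  obtains M where "0 \<le> M"
    "AE t in lborel. 0 \<le> t \<longrightarrow> (\<integral>\<^sup>+x. ennreal ((u t x)\<^sup>2 + 1/2 * (weak_deriv (u t) x)\<^sup>2) \<partial>lebesgue) \<le> ennreal M"
    "\<And>t. 0 \<le> t \<Longrightarrow> \<exists>v. primitive (u t) v \<and> (AE x in lebesgue. weak_deriv (u t) x = v x)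
        \<and> integrable lborel (\<lambda>x. (v x)\<^sup>2) \<and> (LBINT x. (v x)\<^sup>2) \<le> 2 * M"
proof -
  let ?en = "\<lambda>t. \<integral>\<^sup>+x. ennreal ((u t x)\<^sup>2 + 1/2 * (weak_deriv (u t) x)\<^sup>2) \<partial>lebesgue"
  define E where "E = esssup (lebesgue_on {0..}) ?en"
  have cont: "continuous_on ({0..} \<times> UNIV) (\<lambda>(t, x). u t x)" and wd: "AE t in lebesgue_on {0..}. \<exists>g. has_weak_deriv (u t) g"
    and E: "E < \<infinity>" using sol unfolding CH_weak_solution_def E_def by auto
  define M where "M = enn2real E"
  have M: "0 \<le> M" "ennreal M = E" using E by (auto simp: M_def less_top)
  have en: "AE t in lborel. 0 \<le> t \<longrightarrow> ?en t \<le> ennreal M"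
    using esssup_AE[of ?en "lebesgue_on {0..}"] unfolding AE_lebesgue_on_ge0 E_def[symmetric] M(2) .
  have good: "AE t in lborel. 0 \<le> t \<longrightarrow> ?en t \<le> ennreal M \<and> (\<exists>g. has_weak_deriv (u t) g)"
    using en wd[unfolded AE_lebesgue_on_ge0] by eventually_elim auto
  have all: "\<exists>v. primitive (u t) v \<and> (AE x in lebesgue. weak_deriv (u t) x = v x)
        \<and> integrable lborel (\<lambda>x. (v x)\<^sup>2) \<and> (LBINT x. (v x)\<^sup>2) \<le> 2 * M" if t: "0 \<le> t" for t
  proof -
    have "\<exists>g v. primitive g v \<and> integrable lborel (\<lambda>x. (v x)\<^sup>2) \<and> (LBINT x. (v x)\<^sup>2) \<le> 2 * M
      \<and> (\<forall>x\<in>{- real n..real n}. \<bar>g x - u t x\<bar> \<le> 1 / real (Suc n))" for n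
    proof -
      have "uniformly_continuous_on ({t..t+1} \<times> {-real n..real n}) (\<lambda>(t, x). u t x)"
        using t by (intro compact_uniformly_continuous continuous_on_subset[OF cont] compact_Times) auto
      then obtain d where d: "d > 0" "\<And>p q. p \<in> {t..t+1} \<times> {-real n..real n} \<Longrightarrow> q \<in> {t..t+1} \<times> {-real n..real n} \<Longrightarrow>
          dist q p < d \<Longrightarrow> dist ((\<lambda>(t, x). u t x) q) ((\<lambda>(t, x). u t x) p) < 1 / real (Suc n)"
      proof (rule uniformly_continuous_onE)
        show "0 < 1 / real (Suc n)" by simp
      qed (use that in blast)
      obtain s where s: "s \<in> {t..t + min 1 (d/2)}" "0 \<le> s \<longrightarrow> ?en s \<le> ennreal M \<and> (\<exists>g. has_weak_deriv (u s) g)"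
      proof -
        have "0 < min 1 (d / 2)" using d(1) by simp
        from AE_imp_dense[OF good this, of t] show ?thesis using that by blast
      qed
      have s0: "0 \<le> s" using s t by auto
      then obtain g where g: "has_weak_deriv (u s) g" "?en s \<le> ennreal M" using s by blast
      obtain v where v: "primitive (u s) v" "AE x in lebesgue. g x = v x"
        using has_weak_deriv_borel_rep[OF g(1) continuous_slice[OF cont s0]] .
      have "\<bar>u s x - u t x\<bar> \<le> 1 / real (Suc n)" if "x \<in> {- real n..real n}" for x
      proof -
        have "dist (s, x) (t, x) < d" using s(1) d(1) by (auto simp: dist_Pair_Pair dist_real_def)
        then have "dist (u s x) (u t x) < 1 / real (Suc n)" using d(2)[of "(t, x)" "(s, x)"] that s(1) by auto
        then show ?thesis unfolding dist_real_def by simp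
      qed
      then show ?thesis
        using v(1) nn_integral_energy(3,4)[OF continuous_slice[OF cont s0] primitiveD(1)[OF v(1)] weak_deriv_of_primitive[OF v(1)] g(2) M(1)]
        by blast
    qed
    then obtain v where "primitive (u t) v" "integrable lborel (\<lambda>x. (v x)\<^sup>2)" "(LBINT x. (v x)\<^sup>2) \<le> 2 * M"
      using primitive_limit_L2 by blast
    then show ?thesis using weak_deriv_of_primitive by blast
  qed
  show ?thesis by (rule that[OF M(1) en all])
qed



lemma exp_neg_lipschitz: assumes "0 \<le> a" "a \<le> b" shows "exp (- a) - exp (- b) \<le> (b - a :: real)" "exp (- b) \<le> exp (- a :: real)"
proof -
  have "1 - exp (- (b - a)) \<le> b - a" using exp_ge_add_one_self[of "- (b - a)"] by linarith
  moreover have "exp (- a) - exp (- b) = exp (- a) * (1 - exp (- (b - a)))"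
    by (simp add: right_diff_distrib exp_add[symmetric] flip: exp_minus)
  moreover have "exp (- a) * (1 - exp (- (b - a))) \<le> 1 * (1 - exp (- (b - a)))"
    using assms by (intro mult_right_mono) auto
  ultimately show "exp (- a) - exp (- b) \<le> b - a" by simp
qed (use assms in simp)

text \<open>The kernel \<open>sgn(s) exp(-\<bar>s\<bar>)/2\<close> is the Heaviside function, up to a function with Lipschitz constant \<open>1/2\<close>.\<close>

lemma kernel_increment:
  fixes x z y :: real
  assumes "x \<le> z" "y \<noteq> x" "y \<noteq> z"
  shows "\<bar>1/2 * sgn (z - y) * exp (- \<bar>z - y\<bar>) - 1/2 * sgn (x - y) * exp (- \<bar>x - y\<bar>) - indicator {x..z} y\<bar> \<le> (z - x) / 2"
proof -
  consider "y < x" | "x < y" "y < z" | "z < y" using assms by linarith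
  then show ?thesis
  proof cases
    case 1
    then show ?thesis using assms exp_neg_lipschitz[of "x - y" "z - y"] by (simp add: abs_le_iff)
  next
    case 2
    then have eq: "1/2 * sgn (z - y) * exp (- \<bar>z - y\<bar>) - 1/2 * sgn (x - y) * exp (- \<bar>x - y\<bar>) - indicator {x..z} y
        = (exp (- (z - y)) + exp (- (y - x)) - 2) / 2"
      by (simp add: field_simps)
    have "exp (- (z - y)) \<le> 1" "exp (- (y - x)) \<le> 1" using 2 by auto
    then show ?thesis unfolding eq
    proof (intro abs_leI)
      show "(exp (- (z - y)) + exp (- (y - x)) - 2) / 2 \<le> (z - x) / 2"
        using \<open>exp (- (z - y)) \<le> 1\<close> \<open>exp (- (y - x)) \<le> 1\<close> 2 by argo
      show "- ((exp (- (z - y)) + exp (- (y - x)) - 2) / 2) \<le> (z - x) / 2"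
        using exp_ge_add_one_self[of "- (z - y)"] exp_ge_add_one_self[of "- (y - x)"] 2 by argo
    qed
  next
    case 3
    then show ?thesis using assms exp_neg_lipschitz[of "y - z" "y - x"] by (simp add: abs_le_iff)
  qed
qed

text \<open>By \<open>kernel_increment\<close> the source is a primitive of the energy density \<open>f\<^sup>2 + v\<^sup>2/2\<close> up to a Lipschitz
  function, the pressure being absorbed into the latter.\<close>

lemma CH_source_props:
  assumes f: "primitive f v" and wd: "AE x in lebesgue. weak_deriv f x = v x"
    and e: "(\<integral>\<^sup>+x. ennreal ((f x)\<^sup>2 + 1/2 * (weak_deriv f x)\<^sup>2) \<partial>lebesgue) \<le> ennreal M" and M: "0 \<le> M"
    and Q: "primitive Q (\<lambda>x. (v x)\<^sup>2)"
  shows "\<bar>CH_source f x\<bar> \<le> M / 2"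
    "x \<le> z \<Longrightarrow> (\<And>y. y \<in> {x..z} \<Longrightarrow> \<bar>f y\<bar> \<le> U) \<Longrightarrow>
       \<bar>CH_source f z - CH_source f x - (Q z - Q x) / 2\<bar> \<le> (U\<^sup>2 + M / 2) * (z - x)"
    "continuous_on UNIV (CH_source f)"
proof -
  note [measurable] = primitiveD(1)[OF f]
  have cf: "continuous_on UNIV f" by (rule primitive_continuous[OF f])
  have [measurable]: "f \<in> borel_measurable borel" using cf by (rule borel_measurable_continuous_onI)
  define k where "k x y = 1/2 * sgn (x - y) * exp (- \<bar>x - y\<bar>)" for x y :: real
  define g where "g y = (f y)\<^sup>2 + 1/2 * (v y)\<^sup>2" for y
  have gi: "integrable lborel g" "(LBINT y. g y) \<le> M"
    unfolding g_def[abs_def] using nn_integral_energy[OF cf _ wd e M] by auto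
  have g0: "0 \<le> g y" for y unfolding g_def by simp
  have [measurable]: "g \<in> borel_measurable borel" "k x \<in> borel_measurable borel" for x unfolding g_def[abs_def] k_def[abs_def] by measurable
  have kb: "\<bar>k x y\<bar> \<le> 1/2" for x y unfolding k_def by (simp add: abs_mult abs_sgn_eq)
  have kg: "\<bar>k x y * g y\<bar> \<le> 1/2 * g y" for x y
    unfolding abs_mult using mult_right_mono[OF kb g0[of y]] g0[of y] by simp
  have ki: "integrable lborel (\<lambda>y. k x y * g y)" for x
    by (rule Bochner_Integration.integrable_bound[of _ "\<lambda>y. 1/2 * g y"]) (use gi kg g0 in \<open>auto intro!: always_eventually\<close>)
  have src: "CH_source f x = (LBINT y. k x y * g y)" for x
  proof -
    have "CH_source f x = (LINT y|lebesgue. k x y * g y)"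
      unfolding CH_source_def
    proof (rule integral_cong_AE)
      show b: "(\<lambda>y. k x y * g y) \<in> borel_measurable lebesgue" by (intro measurable_completion) measurable
      show ae: "AE y in lebesgue. 1/2 * sgn (x - y) * exp (- \<bar>x - y\<bar>) * ((f y)\<^sup>2 + 1/2 * (weak_deriv f y)\<^sup>2) = k x y * g y"
        using wd by eventually_elim (simp add: k_def g_def)
      show "(\<lambda>y. 1/2 * sgn (x - y) * exp (- \<bar>x - y\<bar>) * ((f y)\<^sup>2 + 1/2 * (weak_deriv f y)\<^sup>2)) \<in> borel_measurable lebesgue"
        by (rule borel_measurable_AE[OF b]) (use ae in \<open>auto elim!: eventually_mono\<close>)
    qed
    also have "\<dots> = (LBINT y. k x y * g y)" by (rule integral_completion) auto
    finally show ?thesis .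
  qed
  have ab: "\<bar>CH_source f x\<bar> \<le> M / 2" for x
  proof -
    have "\<bar>CH_source f x\<bar> \<le> (LBINT y. \<bar>k x y * g y\<bar>)" unfolding src by (rule integral_abs_bound)
    also have "\<dots> \<le> (LBINT y. 1/2 * g y)" using ki gi kg by (intro integral_mono integrable_abs) auto
    finally show ?thesis using gi(2) by simp
  qed
  then show "\<bar>CH_source f x\<bar> \<le> M / 2" .
  have gx: "integrable lborel (\<lambda>y. indicator {x..z} y * g y)" for x z
    using integrable_mult_indicator[OF _ gi(1), of "{x..z}"] by simp
  have inc: "\<bar>CH_source f z - CH_source f x - (LBINT y:{x..z}. g y)\<bar> \<le> M / 2 * (z - x)" if xz: "x \<le> z" for x z
  proof -
    have i: "integrable lborel (\<lambda>y. (k z y - k x y - indicator {x..z} y) * g y)"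
      using ki[of z] ki[of x] gx[of x z] by (simp add: left_diff_distrib)
    have "CH_source f z - CH_source f x - (LBINT y:{x..z}. g y) = (LBINT y. (k z y - k x y - indicator {x..z} y) * g y)"
      unfolding src set_lebesgue_integral_def using ki[of z] ki[of x] gx[of x z] by (simp add: left_diff_distrib)
    also have "\<bar>\<dots>\<bar> \<le> (LBINT y. \<bar>(k z y - k x y - indicator {x..z} y) * g y\<bar>)" by (rule integral_abs_bound)
    also have "\<dots> \<le> (LBINT y. (z - x) / 2 * g y)"
    proof (rule integral_mono_AE)
      show "AE y in lborel. \<bar>(k z y - k x y - indicator {x..z} y) * g y\<bar> \<le> (z - x) / 2 * g y"
        using AE_lborel_singleton[of x] AE_lborel_singleton[of z]
      proof eventually_elim
        case (elim y)
        then show ?case using mult_right_mono[OF kernel_increment[OF xz, of y] g0[of y]] g0[of y]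
          by (simp add: abs_mult k_def)
      qed
    qed (use i gi in auto)
    also have "\<dots> \<le> (z - x) / 2 * M" using gi(2) xz by (simp add: mult_left_mono)
    finally show ?thesis by (simp add: mult.commute)
  qed

  have fi: "set_integrable lborel {x..z} (\<lambda>y. (f y)\<^sup>2)" for x z
    by (intro set_integrable_cts continuous_intros cf)
  have split: "(LBINT y:{x..z}. g y) = (LBINT y:{x..z}. (f y)\<^sup>2) + (Q z - Q x) / 2" if "x \<le> z" for x z
  proof -
    have "set_integrable lborel {x..z} (\<lambda>y. 1/2 * (v y)\<^sup>2)" by (intro set_integrable_mult_right primitiveD(2)[OF Q])
    from set_integral_add(2)[OF fi this] show ?thesis unfolding g_def using primitiveD(3)[OF Q that] by simp
  qed
  show "\<bar>CH_source f z - CH_source f x - (Q z - Q x) / 2\<bar> \<le> (U\<^sup>2 + M / 2) * (z - x)"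
    if xz: "x \<le> z" and U: "\<And>y. y \<in> {x..z} \<Longrightarrow> \<bar>f y\<bar> \<le> U"
  proof -
    have "0 \<le> (LBINT y:{x..z}. (f y)\<^sup>2)" unfolding set_lebesgue_integral_def by (rule integral_nonneg_AE) auto
    moreover have "(LBINT y:{x..z}. (f y)\<^sup>2) \<le> (LBINT y:{x..z}. U\<^sup>2)"
      by (intro set_integral_le_AE fi set_integrable_cts continuous_intros always_eventually)
         (use U in \<open>auto intro!: power2_le_iff_abs_le[THEN iffD2] intro: order_trans[OF abs_ge_zero]\<close>)
    moreover have "(LBINT y:{x..z}. U\<^sup>2) = U\<^sup>2 * (z - x)" using xz by (simp add: set_integral_const mult.commute)
    moreover have "(U\<^sup>2 + M / 2) * (z - x) = U\<^sup>2 * (z - x) + M / 2 * (z - x)" by (rule distrib_right)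
    ultimately show ?thesis using inc[OF xz] split[OF xz] unfolding abs_le_iff by linarith
  qed
  have gloc: "primitive (\<lambda>x. LBINT y:{..x}. g y) g"
    unfolding primitive_def
  proof (intro conjI allI impI)
    show "g \<in> borel_measurable borel" by measurable
    fix x z :: real assume xz: "x \<le> z"
    show "set_integrable lborel {x..z} g" using gx[of x z] by (simp add: set_integrable_def)
    have "(LBINT y:{..x} \<union> {x..z}. g y) = (LBINT y:{..x}. g y) + (LBINT y:{x..z}. g y)"
    proof (rule set_integral_Un_AE)
      show "AE y in lborel. \<not> (y \<in> {..x} \<and> y \<in> {x..z})" using AE_lborel_singleton[of x] by eventually_elim auto
      show "set_integrable lborel {..x} g" "set_integrable lborel {x..z} g"
        using integrable_mult_indicator[OF _ gi(1)] unfolding set_integrable_def by auto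
    qed auto
    moreover have "{..x} \<union> {x..z} = {..z}" using xz by auto
    ultimately show "(LBINT y:{x..z}. g y) = (LBINT y:{..z}. g y) - (LBINT y:{..x}. g y)" by simp
  qed
  have gpc: "continuous_on UNIV (\<lambda>x. LBINT y:{..x}. g y)" by (rule primitive_continuous[OF gloc])
  define r where "r x = CH_source f x - (LBINT y:{..x}. g y)" for x
  have rl: "\<bar>r z - r x\<bar> \<le> M / 2 * \<bar>z - x\<bar>" for x z
  proof (cases "x \<le> z")
    case True
    have "r z - r x = CH_source f z - CH_source f x - (LBINT y:{x..z}. g y)"
      using primitiveD(3)[OF gloc True] by (simp add: r_def)
    then show ?thesis using inc[OF True] True by simp
  next
    case False
    have "r z - r x = - (CH_source f x - CH_source f z - (LBINT y:{z..x}. g y))"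
      using primitiveD(3)[OF gloc, of z x] False by (simp add: r_def)
    then have "\<bar>r z - r x\<bar> = \<bar>CH_source f x - CH_source f z - (LBINT y:{z..x}. g y)\<bar>" by (simp only: abs_minus_cancel)
    then show ?thesis using inc[of z x] False by simp
  qed
  have "continuous_on UNIV r"
  proof (rule lipschitz_on_continuous_on)
    show "(M/2)-lipschitz_on UNIV r" using rl M by (intro lipschitz_onI) (auto simp: dist_real_def)
  qed
  from continuous_on_add[OF this gpc] show "continuous_on UNIV (CH_source f)" unfolding r_def by simp
qed

section \<open>Weak solutions tested on rectangles\<close>

text \<open>A smooth approximation of the indicator of a rectangle in space-time.\<close>

definition box_bump :: "real \<Rightarrow> real \<Rightarrow> nat \<Rightarrow> real \<Rightarrow> real \<Rightarrow> nat \<Rightarrow> real \<times> real \<Rightarrow> real" where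
  "box_bump s t n a b m = (\<lambda>p. plateau s t n (fst p) * plateau a b m (snd p))"

lemma box_bump_test_function:
  assumes "0 < s" "s \<le> t" "a \<le> b"
  shows "test_function ({0<..} \<times> UNIV) (box_bump s t n a b m)"
  unfolding test_function_def
proof (intro conjI allI exI[of _ "{s..t+1} \<times> {a..b+1}"] impI)
  fix k
  have "C_k k (\<lambda>p::real\<times>real. plateau s t n (fst p + 0))" by (intro C_k_affine plateau_smooth bounded_linear_fst)
  moreover have "C_k k (\<lambda>p::real\<times>real. plateau a b m (snd p + 0))" by (intro C_k_affine plateau_smooth bounded_linear_snd)
  ultimately show "C_k k (box_bump s t n a b m)" unfolding box_bump_def using C_k_mult by force
next
  fix p assume "p \<notin> {s..t+1} \<times> {a..b+1}"
  then show "box_bump s t n a b m p = 0" using assms plateau_outside_ge unfolding box_bump_def by (cases p) auto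
qed (use assms in \<open>auto intro!: compact_Times\<close>)

lemma deriv_box_bump:
  "deriv (\<lambda>s'. box_bump s t n a b m (s', x)) r = plateau' s t n r * plateau a b m x"
  "deriv (\<lambda>y. box_bump s t n a b m (r, y)) x = plateau s t n r * plateau' a b m x"
  unfolding box_bump_def
  by (auto intro!: DERIV_imp_deriv derivative_eq_intros plateau_deriv)

lemma bounded_box_integrable:
  fixes g :: "real \<times> real \<Rightarrow> real"
  assumes [measurable]: "g \<in> borel_measurable borel"
    and z: "\<And>p. p \<notin> {A..B} \<times> {C..D} \<Longrightarrow> g p = 0" and K: "\<And>p. p \<in> {A..B} \<times> {C..D} \<Longrightarrow> \<bar>g p\<bar> \<le> K"
  shows "integrable (lborel \<Otimes>\<^sub>M lborel) g"
proof (rule Bochner_Integration.integrable_bound)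
  show "integrable (lborel \<Otimes>\<^sub>M lborel) (\<lambda>(x, y). (indicator {A..B} x * K) * indicator {C..D} y :: real)"
    by (intro integrable_prod_mult integrable_mult_left integrable_real_indicator) (auto simp: emeasure_lborel_Icc_eq)
  show "g \<in> borel_measurable (lborel \<Otimes>\<^sub>M lborel)" by (simp add: lborel_prod)
  show "AE p in lborel \<Otimes>\<^sub>M lborel. norm (g p) \<le> norm (case p of (x, y) \<Rightarrow> (indicator {A..B} x * K) * indicator {C..D} y)"
  proof (intro always_eventually allI)
    fix p :: "real \<times> real"
    show "norm (g p) \<le> norm (case p of (x, y) \<Rightarrow> (indicator {A..B} x * K) * indicator {C..D} y)"
      using z[of p] K[of p] by (cases p) (auto simp: indicator_def)
  qed
qed

lemma param_integral_continuous:
  fixes k :: "real \<Rightarrow> real \<Rightarrow> real"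
  assumes "continuous_on UNIV (\<lambda>p. k (fst p) (snd p))"
  shows "continuous_on UNIV (\<lambda>x. LBINT t:{A..B}. k x t)"
proof -
  have "continuous_on (UNIV \<times> cbox A B) (\<lambda>(x, t). k x t)"
    using continuous_on_subset[OF assms, of "UNIV \<times> cbox A B"] by (simp add: case_prod_beta)
  then have "continuous_on UNIV (\<lambda>x. integral (cbox A B) (k x))" by (rule integral_continuous_on_param)
  moreover have "(LBINT t:{A..B}. k x t) = integral (cbox A B) (k x)" for x
  proof -
    have "continuous_on {A..B} (\<lambda>t. (\<lambda>p. k (fst p) (snd p)) (x, t))"
      by (rule continuous_on_compose2[OF assms]) (auto intro!: continuous_intros)
    then have "set_integrable lborel {A..B} (k x)" by (intro borel_integrable_atLeastAtMost') simp
    then show ?thesis using set_borel_integral_eq_integral(2) by simp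
  qed
  ultimately show ?thesis by simp
qed

locale weak_solution =
  fixes u :: "real \<Rightarrow> real \<Rightarrow> real" and u0 :: "real \<Rightarrow> real" and M :: real
  assumes sol: "CH_weak_solution u0 u" and M: "0 \<le> M"
    and energy: "AE t in lborel. 0 \<le> t \<longrightarrow> (\<integral>\<^sup>+x. ennreal ((u t x)\<^sup>2 + 1/2 * (weak_deriv (u t) x)\<^sup>2) \<partial>lebesgue) \<le> ennreal M"
    and slopes: "\<And>t. 0 \<le> t \<Longrightarrow> \<exists>v. primitive (u t) v \<and> (AE x in lebesgue. weak_deriv (u t) x = v x)
        \<and> integrable lborel (\<lambda>x. (v x)\<^sup>2) \<and> (LBINT x. (v x)\<^sup>2) \<le> 2 * M"
begin

text \<open>Values at negative times are replaced by the initial ones, so that the function is continuous on the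
  whole plane and Borel measurable.\<close>

definition ue :: "real \<Rightarrow> real \<Rightarrow> real" where "ue t x = u (max t 0) x"

lemma ue_eq: "0 \<le> t \<Longrightarrow> ue t x = u t x" by (simp add: ue_def)

lemma cont_u: "continuous_on ({0..} \<times> UNIV) (\<lambda>(t, x). u t x)"
  using sol unfolding CH_weak_solution_def by blast

lemma cont_ue: "continuous_on S (\<lambda>p. ue (fst p) (snd p))"
proof -
  have "continuous_on UNIV (\<lambda>p. (\<lambda>(t, x). u t x) (max (fst p) 0, snd p))"
    by (rule continuous_on_compose2[OF cont_u]) (auto intro!: continuous_intros)
  then show ?thesis unfolding ue_def using continuous_on_subset[OF _ subset_UNIV[of S]] by simp
qed

lemma cont_ue_x: "continuous_on S (ue t)"
proof -
  have "continuous_on S (\<lambda>x. (\<lambda>p. ue (fst p) (snd p)) (t, x))"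
    by (rule continuous_on_compose2[OF cont_ue[of UNIV]]) (auto intro!: continuous_intros)
  then show ?thesis by simp
qed

lemma cont_ue_t: "continuous_on S (\<lambda>t. ue t x)"
proof -
  have "continuous_on S (\<lambda>t. (\<lambda>p. ue (fst p) (snd p)) (t, x))"
    by (rule continuous_on_compose2[OF cont_ue[of UNIV]]) (auto intro!: continuous_intros)
  then show ?thesis by simp
qed

lemma ue_borel: "(\<lambda>p. ue (fst p) (snd p)) \<in> borel_measurable borel" "(\<lambda>t. ue t x) \<in> borel_measurable borel" "ue t \<in> borel_measurable borel"
  by (auto intro: borel_measurable_continuous_onI cont_ue cont_ue_x cont_ue_t)

lemma ue_bounded_on_box: "\<exists>K. \<forall>t\<in>{A..B}. \<forall>x\<in>{C..D}. \<bar>ue t x\<bar> \<le> K"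
proof -
  have "compact ((\<lambda>p. ue (fst p) (snd p)) ` ({A..B} \<times> {C..D}))"
    by (intro compact_continuous_image cont_ue compact_Times) auto
  then have "bounded ((\<lambda>p. ue (fst p) (snd p)) ` ({A..B} \<times> {C..D}))" by (rule compact_imp_bounded)
  then obtain K where K: "\<And>p. p \<in> {A..B} \<times> {C..D} \<Longrightarrow> norm (ue (fst p) (snd p)) \<le> K"
    unfolding bounded_iff by blast
  have "\<bar>ue t x\<bar> \<le> K" if "t \<in> {A..B}" "x \<in> {C..D}" for t x using K[of "(t, x)"] that by auto
  then show ?thesis by blast
qed

lemma ue_measurable [measurable (raw)]:
  assumes "f \<in> borel_measurable N" "g \<in> borel_measurable N"
  shows "(\<lambda>z. ue (f z) (g z)) \<in> borel_measurable N"
proof -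
  have "(\<lambda>z. (f z, g z)) \<in> N \<rightarrow>\<^sub>M borel" unfolding borel_prod[symmetric] using assms by measurable
  from measurable_compose[OF this ue_borel(1)] show ?thesis by simp
qed

definition src :: "real \<times> real \<Rightarrow> real" where "src p = CH_source (u (fst p)) (snd p)"

lemma weak_formulation:
  assumes "0 < s" "s \<le> t" "a \<le> b"
  shows "has_bochner_integral lebesgue (\<lambda>p. indicator ({0<..} \<times> UNIV) p *
     (ue (fst p) (snd p) * (plateau' s t n (fst p) * plateau a b m (snd p))
      + 1/2 * (ue (fst p) (snd p))\<^sup>2 * (plateau s t n (fst p) * plateau' a b m (snd p))
      + src p * (plateau s t n (fst p) * plateau a b m (snd p)))) 0"
proof -
  have op: "({0<..} \<times> UNIV :: (real \<times> real) set) \<inter> space lebesgue \<in> sets lebesgue"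
    by (auto intro!: lmeasurable_open sets_completionI_sets borel_open open_Times)
  have "has_bochner_integral (lebesgue_on ({0<..} \<times> UNIV))
          (\<lambda>(r, x). u r x * deriv (\<lambda>s'. box_bump s t n a b m (s', x)) r
                  + 1/2 * (u r x)\<^sup>2 * deriv (\<lambda>y. box_bump s t n a b m (r, y)) x
                  + CH_source (u r) x * box_bump s t n a b m (r, x)) 0"
    using sol box_bump_test_function[OF assms] unfolding CH_weak_solution_def by blast
  then have i: "integrable lebesgue (\<lambda>p. indicator ({0<..} \<times> UNIV) p *\<^sub>R (case p of (r, x) \<Rightarrow> u r x * deriv (\<lambda>s'. box_bump s t n a b m (s', x)) r
                  + 1/2 * (u r x)\<^sup>2 * deriv (\<lambda>y. box_bump s t n a b m (r, y)) x
                  + CH_source (u r) x * box_bump s t n a b m (r, x)))"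
    and e: "(LINT p|lebesgue. indicator ({0<..} \<times> UNIV) p *\<^sub>R (case p of (r, x) \<Rightarrow> u r x * deriv (\<lambda>s'. box_bump s t n a b m (s', x)) r
                  + 1/2 * (u r x)\<^sup>2 * deriv (\<lambda>y. box_bump s t n a b m (r, y)) x
                  + CH_source (u r) x * box_bump s t n a b m (r, x))) = 0"
    unfolding has_bochner_integral_iff integrable_restrict_space[OF op] integral_restrict_space[OF op] by auto
  have eq: "indicator ({0<..} \<times> UNIV) p *\<^sub>R (case p of (r, x) \<Rightarrow> u r x * deriv (\<lambda>s'. box_bump s t n a b m (s', x)) r
                  + 1/2 * (u r x)\<^sup>2 * deriv (\<lambda>y. box_bump s t n a b m (r, y)) x
                  + CH_source (u r) x * box_bump s t n a b m (r, x))
      = indicator ({0<..} \<times> UNIV) p *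
     (ue (fst p) (snd p) * (plateau' s t n (fst p) * plateau a b m (snd p))
      + 1/2 * (ue (fst p) (snd p))\<^sup>2 * (plateau s t n (fst p) * plateau' a b m (snd p))
      + src p * (plateau s t n (fst p) * plateau a b m (snd p)))" for p
    unfolding deriv_box_bump by (cases p) (auto simp: indicator_def src_def ue_def box_bump_def)
  show ?thesis using i e unfolding eq has_bochner_integral_iff by blast
qed

text \<open>Measurability of the source in space and time is not part of the notion of solution. It is contained in
  the integrability of the weak formulation, from which the other two terms can be subtracted; test
  functions that exhaust the half plane then remove the cut-off.\<close>

lemma src_measurable: "(\<lambda>p. indicator ({0<..} \<times> UNIV) p * src p) \<in> borel_measurable lebesgue"
proof (rule borel_measurable_LIMSEQ_real)
  define cut where "cut n p = plateau (1 / real (Suc n)) (real (Suc n)) n (fst p) * plateau (- real n) (real n) n (snd p)" for n and p :: "real \<times> real"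
  let ?I = "indicator ({0<..} \<times> UNIV) :: real \<times> real \<Rightarrow> real"
  show "(\<lambda>p. ?I p * (src p * cut n p)) \<in> borel_measurable lebesgue" for n
  proof -
    let ?s = "1 / real (Suc n)" let ?t = "real (Suc n)"
    have "?s \<le> 1" "1 \<le> ?t" by auto
    then have st: "0 < ?s" "?s \<le> ?t" by (simp, rule order_trans)
    define R where "R = (\<lambda>p::real\<times>real. ue (fst p) (snd p) * (plateau' ?s ?t n (fst p) * plateau (- real n) (real n) n (snd p))
      + 1/2 * (ue (fst p) (snd p))\<^sup>2 * (plateau ?s ?t n (fst p) * plateau' (- real n) (real n) n (snd p)))"
    have "has_bochner_integral lebesgue (\<lambda>p. ?I p * (R p + src p * cut n p)) 0"
      using weak_formulation[OF st, of "- real n" "real n" n n] unfolding R_def cut_def by simp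
    then have 1: "(\<lambda>p. ?I p * (R p + src p * cut n p)) \<in> borel_measurable lebesgue"
      unfolding has_bochner_integral_iff by auto
    have "(\<lambda>p. ?I p * R p) \<in> borel_measurable borel"
    proof (intro borel_measurable_times borel_measurable_indicator borel_open open_Times)
      show "R \<in> borel_measurable borel" unfolding R_def borel_prod[symmetric] by measurable
    qed auto
    then have "(\<lambda>p. ?I p * R p) \<in> borel_measurable lebesgue" by (intro measurable_completion) simp
    from borel_measurable_diff[OF 1 this] show ?thesis by (simp add: distrib_left)
  qed
  fix p :: "real \<times> real"
  show "(\<lambda>n. ?I p * (src p * cut n p)) \<longlonglongrightarrow> ?I p * src p"
  proof (cases "0 < fst p")
    case True
    have "\<forall>\<^sub>F n in sequentially. 1 / real (Suc n) < fst p / 2"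
      using LIMSEQ_inverse_real_of_nat[THEN order_tendstoD(2), of "fst p / 2"] True by (simp add: inverse_eq_divide)
    moreover have "\<forall>\<^sub>F n in sequentially. max (fst p) \<bar>snd p\<bar> + 1 \<le> real n"
      using eventually_ge_at_top[of "nat \<lceil>max (fst p) \<bar>snd p\<bar> + 1\<rceil>"] by eventually_elim linarith
    ultimately have "\<forall>\<^sub>F n in sequentially. cut n p = 1"
    proof eventually_elim
      case (elim n)
      have n1: "1 / real (Suc n) \<le> 1" by simp
      have "plateau (1 / real (Suc n)) (real (Suc n)) n (fst p) = 1"
        by (rule plateau_inside) (use elim in auto)
      moreover have "plateau (- real n) (real n) n (snd p) = 1"
      proof (rule plateau_inside)
        have "- snd p \<le> max (fst p) \<bar>snd p\<bar>" "snd p \<le> max (fst p) \<bar>snd p\<bar>"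
          by (auto simp: max_def)
        then have "- real n + 1 / real (Suc n) \<le> snd p" "snd p \<le> real n" using elim(2) n1 by argo+
        then show "snd p \<in> {- real n + 1 / real (Suc n)..real n}" by simp
      qed
      ultimately show ?case by (simp add: cut_def)
    qed
    then show ?thesis by (intro tendsto_eventually) (auto elim!: eventually_mono)
  next
    case False
    then show ?thesis by (cases p) (auto simp: indicator_def)
  qed
qed

end

context weak_solution begin

lemma src_section:
  "AE t in lborel. 0 \<le> t \<longrightarrow> continuous_on UNIV (CH_source (u t)) \<and> (\<forall>x. \<bar>src (t, x)\<bar> \<le> M / 2)"
  using energy
proof eventually_elim
  case (elim t)
  show ?case
  proof
    assume t: "0 \<le> t"
    obtain v where v: "primitive (u t) v" "AE x in lebesgue. weak_deriv (u t) x = v x" "integrable lborel (\<lambda>x. (v x)\<^sup>2)"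
      using slopes[OF t] by blast
    have [measurable]: "v \<in> borel_measurable borel" by (rule primitiveD(1)[OF v(1)])
    obtain Q where "primitive Q (\<lambda>x. (v x)\<^sup>2)" using primitive_of_integrable[OF v(3)] by auto
    from CH_source_props(1,3)[OF v(1,2) elim[rule_format, OF t] M this]
    show "continuous_on UNIV (CH_source (u t)) \<and> (\<forall>x. \<bar>src (t, x)\<bar> \<le> M / 2)" by (simp add: src_def)
  qed
qed

lemma AE_fst:
  assumes "AE t in lborel. P (t::real)" shows "AE p in lborel \<Otimes>\<^sub>M (lborel :: real measure). P (fst p)"
proof -
  obtain N where N: "N \<in> null_sets lborel" "{t \<in> space lborel. \<not> P t} \<subseteq> N"
    using assms unfolding eventually_ae_filter by blast
  have "N \<times> (UNIV :: real set) \<in> null_sets (lborel \<Otimes>\<^sub>M lborel)"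
    using N(1) by (intro lborel.times_in_null_sets1) auto
  then show ?thesis by (rule AE_I') (use N(2) in \<open>auto simp: space_pair_measure\<close>)
qed

lemma src_borel_version:
  obtains Fb where "Fb \<in> borel_measurable borel" "\<And>p. \<bar>Fb p\<bar> \<le> M / 2"
    "AE p in lborel \<Otimes>\<^sub>M lborel. 0 < fst p \<longrightarrow> Fb p = src p"
proof -
  obtain F0 where F0[measurable]: "F0 \<in> borel_measurable lborel"
    and ae: "AE p in lborel. indicator ({0<..} \<times> UNIV) p * src p = F0 p"
    using completion_ex_borel_measurable_real[OF src_measurable] by blast
  define Fb where "Fb p = max (- (M / 2)) (min (M / 2) (F0 p))" for p
  have "Fb \<in> borel_measurable borel" using F0 unfolding Fb_def by measurable
  moreover have "\<bar>Fb p\<bar> \<le> M / 2" for p using M by (auto simp: Fb_def abs_le_iff)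
  moreover have "AE p in lborel \<Otimes>\<^sub>M lborel. 0 < fst p \<longrightarrow> Fb p = src p"
    using ae[folded lborel_prod] AE_fst[OF src_section]
  proof eventually_elim
    case (elim p)
    show ?case
    proof
      assume p: "0 < fst p"
      then have "F0 p = src p" using elim(1) by (cases p) (auto simp: indicator_def)
      moreover have "\<bar>src p\<bar> \<le> M / 2" using elim(2) p by (cases p) auto
      ultimately show "Fb p = src p" by (auto simp: Fb_def abs_le_iff)
    qed
  qed
  ultimately show ?thesis by (rule that)
qed

end

text \<open>A bounded Borel version of the source, for use with Fubini's theorem on products of Lebesgue--Borel
  measure.\<close>

locale weak_solution_src = weak_solution +
  fixes Fb :: "real \<times> real \<Rightarrow> real"
  assumes Fb_borel: "Fb \<in> borel_measurable borel" and Fb_bound: "\<And>p. \<bar>Fb p\<bar> \<le> M / 2"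
    and Fb_eq: "AE p in lborel \<Otimes>\<^sub>M lborel. 0 < fst p \<longrightarrow> Fb p = src p"
begin

lemma Fb_sections: "AE t in lborel. 0 < t \<longrightarrow> (AE x in lborel. Fb (t, x) = CH_source (u t) x)"
  using lborel_pair.AE_pair[OF Fb_eq] by eventually_elim (auto simp: src_def)

lemma Fb_measurable [measurable (raw)]:
  assumes "f \<in> borel_measurable N" "g \<in> borel_measurable N"
  shows "(\<lambda>z. Fb (f z, g z)) \<in> borel_measurable N"
proof -
  have "(\<lambda>z. (f z, g z)) \<in> N \<rightarrow>\<^sub>M borel" unfolding borel_prod[symmetric] using assms by measurable
  from measurable_compose[OF this Fb_borel] show ?thesis by simp
qed

lemma Fb_measurable_prod [measurable]: "Fb \<in> borel_measurable (borel \<Otimes>\<^sub>M borel)"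
  unfolding borel_prod by (rule Fb_borel)

lemma Fb_Icc_integrable: "set_integrable lborel {A..B} (\<lambda>x. Fb (t, x))"
proof (rule bounded_Icc_integrable)
  show "\<bar>Fb (t, x)\<bar> \<le> M / 2" for x by (rule Fb_bound)
qed measurable

lemma plateau_abs_le: "a \<le> b \<Longrightarrow> \<bar>plateau a b n x\<bar> \<le> 1"
  using plateau_range(1)[of a b n x] plateau_range(2)[of a b n x] by auto

lemma plateau'_bounded: "\<exists>K. \<forall>x. \<bar>plateau' a b n x\<bar> \<le> K"
proof -
  obtain C where C: "\<forall>x. bump x \<le> C" using bump_le by blast
  have "\<bar>plateau' a b n x\<bar> \<le> real (Suc n) * C + real (Suc n) * C" for x
    unfolding plateau'_def using C bump_nonneg
    by (intro order_trans[OF abs_triangle_ineq4] add_mono) (auto simp: abs_mult simp del: of_nat_Suc)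
  then show ?thesis by blast
qed



lemma double_integral_zero:
  assumes st: "0 < s" "s \<le> t" and ab: "a \<le> b"
  shows "integrable (lborel \<Otimes>\<^sub>M lborel) (\<lambda>p. (ue (fst p) (snd p) * plateau' s t n (fst p) + Fb p * plateau s t n (fst p)) * plateau a b m (snd p))"
    "integrable (lborel \<Otimes>\<^sub>M lborel) (\<lambda>p. ((ue (fst p) (snd p))\<^sup>2 / 2 * plateau s t n (fst p)) * plateau' a b m (snd p))"
    "(LINT p|(lborel \<Otimes>\<^sub>M lborel). ((ue (fst p) (snd p))\<^sup>2 / 2 * plateau s t n (fst p)) * plateau' a b m (snd p))
     = - (LINT p|(lborel \<Otimes>\<^sub>M lborel). (ue (fst p) (snd p) * plateau' s t n (fst p) + Fb p * plateau s t n (fst p)) * plateau a b m (snd p))"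
proof -
  let ?p = "plateau s t n" and ?p' = "plateau' s t n" and ?q = "plateau a b m" and ?q' = "plateau' a b m"
  define g1 where "g1 = (\<lambda>p. (ue (fst p) (snd p) * ?p' (fst p) + Fb p * ?p (fst p)) * ?q (snd p))"
  define g2 where "g2 = (\<lambda>p. ((ue (fst p) (snd p))\<^sup>2 / 2 * ?p (fst p)) * ?q' (snd p))"
  have m: "g1 \<in> borel_measurable borel" "g2 \<in> borel_measurable borel"
    unfolding g1_def g2_def borel_prod[symmetric] by measurable
  obtain K where K: "\<And>r x. r \<in> {s..t+1} \<Longrightarrow> x \<in> {a..b+1} \<Longrightarrow> \<bar>ue r x\<bar> \<le> K" using ue_bounded_on_box by blast
  have K0: "0 \<le> K" using K[of s a] st ab by auto
  obtain K1 where K1: "\<And>x. \<bar>?p' x\<bar> \<le> K1" using plateau'_bounded by blast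
  obtain K2 where K2: "\<And>x. \<bar>?q' x\<bar> \<le> K2" using plateau'_bounded by blast
  note p1 = plateau_abs_le[OF st(2), of n] plateau_abs_le[OF ab, of m]
  have z: "g1 p = 0" "g2 p = 0" if "p \<notin> {s..t+1} \<times> {a..b+1}" for p
    using that plateau_outside_ge[OF st(2)] plateau_outside_ge[OF ab] plateau'_outside_ge[OF st(2)] plateau'_outside_ge[OF ab]
    unfolding g1_def g2_def by (cases p; auto)+
  have b1: "\<bar>g1 p\<bar> \<le> (K * K1 + M / 2 * 1) * 1" if "p \<in> {s..t+1} \<times> {a..b+1}" for p
  proof -
    have "\<bar>ue (fst p) (snd p) * ?p' (fst p)\<bar> \<le> K * K1"
      unfolding abs_mult using K[of "fst p" "snd p"] K1[of "fst p"] K0 that by (intro mult_mono) auto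
    moreover have "\<bar>Fb p * ?p (fst p)\<bar> \<le> M / 2 * 1"
      unfolding abs_mult using Fb_bound[of p] p1 M by (intro mult_mono) auto
    ultimately have "\<bar>ue (fst p) (snd p) * ?p' (fst p) + Fb p * ?p (fst p)\<bar> \<le> K * K1 + M / 2 * 1"
      using abs_triangle_ineq[of "ue (fst p) (snd p) * ?p' (fst p)" "Fb p * ?p (fst p)"] by linarith
    then show ?thesis unfolding g1_def abs_mult using p1 by (intro mult_mono) auto
  qed
  have b2: "\<bar>g2 p\<bar> \<le> (K\<^sup>2 / 2 * 1) * K2" if "p \<in> {s..t+1} \<times> {a..b+1}" for p
  proof -
    have "(ue (fst p) (snd p))\<^sup>2 \<le> K\<^sup>2" using K[of "fst p" "snd p"] K0 that by (intro power2_le_iff_abs_le[THEN iffD2]) auto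
    then show ?thesis unfolding g2_def abs_mult using p1 K2 by (intro mult_mono) auto
  qed
  have i1: "integrable (lborel \<Otimes>\<^sub>M lborel) g1" by (rule bounded_box_integrable[OF m(1) z(1) b1])
  have i2: "integrable (lborel \<Otimes>\<^sub>M lborel) g2" by (rule bounded_box_integrable[OF m(2) z(2) b2])
  let ?W = "\<lambda>p. indicator ({0<..} \<times> UNIV) p *
     (ue (fst p) (snd p) * (?p' (fst p) * ?q (snd p)) + 1/2 * (ue (fst p) (snd p))\<^sup>2 * (?p (fst p) * ?q' (snd p))
      + src p * (?p (fst p) * ?q (snd p)))"
  have W: "integrable lebesgue ?W" "(LINT p|lebesgue. ?W p) = 0"
    using weak_formulation[OF st ab, of n m] unfolding has_bochner_integral_iff by auto
  have ae: "AE p in lebesgue. ?W p = g1 p + g2 p"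
  proof (rule AE_completion)
    show "AE p in lborel. ?W p = g1 p + g2 p"
      using Fb_eq[unfolded lborel_prod]
    proof eventually_elim
      case (elim p)
      show ?case
      proof (cases "0 < fst p")
        case True
        then show ?thesis using elim unfolding g1_def g2_def by (cases p) (auto simp: indicator_def algebra_simps)
      next
        case False
        then have "p \<notin> {s..t+1} \<times> {a..b+1}" using st by (cases p) auto
        then show ?thesis using z False by (cases p) (auto simp: indicator_def)
      qed
    qed
  qed
  have "0 = (LINT p|lebesgue. ?W p)" using W(2) by (rule sym)
  also have "\<dots> = (LINT p|lebesgue. g1 p + g2 p)"
  proof (rule integral_cong_AE[OF _ _ ae])
    show "?W \<in> borel_measurable lebesgue" using W(1) by (rule borel_measurable_integrable)
    show "(\<lambda>p. g1 p + g2 p) \<in> borel_measurable lebesgue"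
      using m by (intro measurable_completion) simp
  qed
  also have "\<dots> = (LINT p|lborel. g1 p + g2 p)" by (rule integral_completion) (use m in auto)
  also have "\<dots> = (LINT p|(lborel \<Otimes>\<^sub>M lborel). g1 p) + (LINT p|(lborel \<Otimes>\<^sub>M lborel). g2 p)"
    unfolding lborel_prod[symmetric] by (rule Bochner_Integration.integral_add[OF i1 i2])
  finally have e: "(LINT p|(lborel \<Otimes>\<^sub>M lborel). g2 p) = - (LINT p|(lborel \<Otimes>\<^sub>M lborel). g1 p)" by simp
  from i1 i2 e show "integrable (lborel \<Otimes>\<^sub>M lborel) (\<lambda>p. (ue (fst p) (snd p) * plateau' s t n (fst p) + Fb p * plateau s t n (fst p)) * plateau a b m (snd p))"
    "integrable (lborel \<Otimes>\<^sub>M lborel) (\<lambda>p. ((ue (fst p) (snd p))\<^sup>2 / 2 * plateau s t n (fst p)) * plateau' a b m (snd p))"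
    "(LINT p|(lborel \<Otimes>\<^sub>M lborel). ((ue (fst p) (snd p))\<^sup>2 / 2 * plateau s t n (fst p)) * plateau' a b m (snd p))
     = - (LINT p|(lborel \<Otimes>\<^sub>M lborel). (ue (fst p) (snd p) * plateau' s t n (fst p) + Fb p * plateau s t n (fst p)) * plateau a b m (snd p))"
    unfolding g1_def g2_def by auto
qed

lemma LINT_pair_snd:
  fixes g :: "real \<times> real \<Rightarrow> real"
  assumes "integrable (lborel \<Otimes>\<^sub>M lborel) g"
  shows "(LINT p|(lborel \<Otimes>\<^sub>M lborel). g p) = (LBINT x. (LBINT t. g (t, x)))"
  using lborel_pair.integral_snd[of "\<lambda>t x. g (t, x)"] assms by simp



text \<open>First the plateau in space is sharpened while the one in time is kept. This is an increment
  statement in the space variable for the function \<open>f\<close> of \<open>x\<close> below, whose weak derivative is \<open>g\<close>.\<close>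

lemma time_tested_balance:
  assumes st: "0 < s" "s \<le> t" and ab: "a \<le> b"
  shows "(LBINT r. (LBINT x:{a..b}. ue r x) * plateau' s t n r)
     = - (LBINT r. ((ue r a)\<^sup>2 / 2 - (ue r b)\<^sup>2 / 2 + (LBINT x:{a..b}. Fb (r, x))) * plateau s t n r)"
proof -
  let ?p = "plateau s t n" and ?p' = "plateau' s t n"
  define f where "f x = (LBINT r. (ue r x)\<^sup>2 / 2 * ?p r)" for x
  define g where "g x = (LBINT r. ue r x * ?p' r + Fb (r, x) * ?p r)" for x
  have f_set: "f x = (LBINT r:{s..t+1}. (ue r x)\<^sup>2 / 2 * ?p r)" for x
    unfolding f_def set_lebesgue_integral_def
    by (intro Bochner_Integration.integral_cong) (use plateau_outside_ge[OF st(2)] in \<open>auto simp: indicator_def\<close>)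
  have cf: "continuous_on UNIV f" unfolding f_set
  proof (rule param_integral_continuous)
    have "continuous_on UNIV (\<lambda>p. (\<lambda>q. ue (fst q) (snd q)) (snd p, fst p))"
      by (rule continuous_on_compose2[OF cont_ue[of UNIV]]) (auto intro!: continuous_intros)
    then show "continuous_on UNIV (\<lambda>p. (ue (snd p) (fst p))\<^sup>2 / 2 * ?p (snd p))"
      by (intro continuous_intros continuous_on_compose2[OF plateau_continuous(1)[of UNIV]]) auto
  qed
  have gm[measurable]: "g \<in> borel_measurable borel"
  proof -
    have "(\<lambda>q. ue (snd q) (fst q) * ?p' (snd q) + Fb (snd q, fst q) * ?p (snd q)) \<in> borel_measurable (borel \<Otimes>\<^sub>M lborel)"
      by measurable
    then show ?thesis unfolding g_def
      by (intro lborel.borel_measurable_lebesgue_integral) (simp add: case_prod_beta)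
  qed
  obtain K1 where K1: "\<And>x. \<bar>?p' x\<bar> \<le> K1" using plateau'_bounded by blast
  obtain K where K: "\<And>r x. r \<in> {s..t+1} \<Longrightarrow> x \<in> {a..b+1} \<Longrightarrow> \<bar>ue r x\<bar> \<le> K" using ue_bounded_on_box by blast
  have K0: "0 \<le> K" using K[of s a] st ab by auto
  have gb: "\<bar>ue r x * ?p' r + Fb (r, x) * ?p r\<bar> \<le> K * K1 + M / 2 * 1" if "r \<in> {s..t+1}" "x \<in> {a..b+1}" for r x
  proof -
    have "\<bar>ue r x * ?p' r\<bar> \<le> K * K1"
      unfolding abs_mult using K[of r x] K1[of r] K0 that by (intro mult_mono) auto
    moreover have "\<bar>Fb (r, x) * ?p r\<bar> \<le> M / 2 * 1"
      unfolding abs_mult using Fb_bound[of "(r, x)"] plateau_abs_le[OF st(2), of n r] M by (intro mult_mono) auto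
    ultimately show ?thesis
      using abs_triangle_ineq[of "ue r x * ?p' r" "Fb (r, x) * ?p r"] by linarith
  qed
  have gz: "ue r x * ?p' r + Fb (r, x) * ?p r = 0" if "r \<notin> {s..t+1}" for r x
    using plateau_outside_ge[OF st(2) that] plateau'_outside_ge[OF st(2) that] by simp
  have "\<bar>g x\<bar> \<le> (K * K1 + M / 2 * 1) * (t + 1 - s)" if x: "x \<in> {a..b+1}" for x
  proof -
    have "g x = (LBINT r:{s..t+1}. ue r x * ?p' r + Fb (r, x) * ?p r)"
      unfolding g_def set_lebesgue_integral_def
      by (intro Bochner_Integration.integral_cong) (use gz in \<open>auto simp: indicator_def\<close>)
    then show ?thesis
      using Icc_integral_abs_le[of "\<lambda>r. ue r x * ?p' r + Fb (r, x) * ?p r" s "t+1" "K * K1 + M / 2 * 1"] gb[OF _ x] st by simp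
  qed
  then have gi: "set_integrable lborel {a..b+1} g" by (rule bounded_Icc_integrable[OF gm])
  have weak: "(LBINT x. f x * plateau' a b m x) = - (LBINT x. g x * plateau a b m x)" for m
  proof -
    note D = double_integral_zero[OF st ab, of n m]
    have "(LBINT x. f x * plateau' a b m x) = (LINT p|(lborel \<Otimes>\<^sub>M lborel). ((ue (fst p) (snd p))\<^sup>2 / 2 * ?p (fst p)) * plateau' a b m (snd p))"
      unfolding LINT_pair_snd[OF D(2)] f_def by simp
    also have "\<dots> = - (LBINT x. g x * plateau a b m x)"
      unfolding D(3) LINT_pair_snd[OF D(1)] g_def by simp
    finally show ?thesis .
  qed
  have inc: "(LBINT x:{a..b}. g x) = f b - f a"
    by (rule weak_identity_imp_increment[OF cf gm gi ab weak])
  \<comment> \<open>with the time integral outermost again, the plateau in time becomes the test function\<close>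
  define G where "G r x = indicator {a..b} x * (ue r x * ?p' r + Fb (r, x) * ?p r)" for r x
  have Gi: "integrable (lborel \<Otimes>\<^sub>M lborel) (case_prod G)"
  proof (rule bounded_box_integrable[of _ s "t+1" a b])
    have "(\<lambda>q. indicator {a..b} (snd q) * (ue (fst q) (snd q) * ?p' (fst q) + Fb q * ?p (fst q))) \<in> borel_measurable borel"
      unfolding borel_prod[symmetric] by measurable
    moreover have "case_prod G = (\<lambda>q. indicator {a..b} (snd q) * (ue (fst q) (snd q) * ?p' (fst q) + Fb q * ?p (fst q)))"
      by (auto simp: G_def fun_eq_iff)
    ultimately show "case_prod G \<in> borel_measurable borel" by simp
    show "\<bar>case_prod G p\<bar> \<le> K * K1 + M / 2 * 1" if "p \<in> {s..t+1} \<times> {a..b}" for p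
      using gb[of "fst p" "snd p"] that by (cases p) (auto simp: G_def)
    show "case_prod G p = 0" if "p \<notin> {s..t+1} \<times> {a..b}" for p
      using gz[of "fst p" "snd p"] that by (cases p) (auto simp: G_def indicator_def)
  qed
  have "(LBINT x:{a..b}. g x) = (LBINT x. (LBINT r. G r x))"
    unfolding set_lebesgue_integral_def g_def G_def by simp
  also have "\<dots> = (LBINT r. (LBINT x. G r x))" by (rule lborel_pair.Fubini_integral[OF Gi])
  also have "\<dots> = (LBINT r. (LBINT x:{a..b}. ue r x) * ?p' r + (LBINT x:{a..b}. Fb (r, x)) * ?p r)"
  proof (rule Bochner_Integration.integral_cong[OF refl])
    fix r
    have "(LBINT x. G r x) = (LBINT x:{a..b}. ue r x * ?p' r + Fb (r, x) * ?p r)"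
      unfolding G_def set_lebesgue_integral_def by simp
    also have "\<dots> = (LBINT x:{a..b}. ue r x * ?p' r) + (LBINT x:{a..b}. Fb (r, x) * ?p r)"
      by (intro set_integral_add set_integrable_mult_left set_integrable_cts cont_ue_x Fb_Icc_integrable)
    finally show "(LBINT x. G r x) = (LBINT x:{a..b}. ue r x) * ?p' r + (LBINT x:{a..b}. Fb (r, x)) * ?p r" by simp
  qed
  finally have eq1: "(LBINT r. (LBINT x:{a..b}. ue r x) * ?p' r + (LBINT x:{a..b}. Fb (r, x)) * ?p r) = f b - f a"
    using inc by simp
  have cm: "continuous_on UNIV (\<lambda>r. LBINT x:{a..b}. ue r x)" by (rule param_integral_continuous) (rule cont_ue)
  have i1: "integrable lborel (\<lambda>r. (LBINT x:{a..b}. ue r x) * ?p' r)"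
    by (rule integrable_compact_support(1)[of _ s "t+1"])
       (use plateau'_outside_ge[OF st(2)] in \<open>auto intro!: continuous_intros cm plateau_continuous\<close>)
  have iF: "integrable lborel (\<lambda>r. (LBINT x. G r x))"
    using lborel_pair.integrable_fst'[OF Gi] by simp
  have i2: "integrable lborel (\<lambda>r. (LBINT x:{a..b}. Fb (r, x)) * ?p r)"
  proof -
    have "(LBINT x. G r x) - (LBINT x:{a..b}. ue r x) * ?p' r = (LBINT x:{a..b}. Fb (r, x)) * ?p r" for r
    proof -
      have "(LBINT x. G r x) = (LBINT x:{a..b}. ue r x * ?p' r + Fb (r, x) * ?p r)"
        unfolding G_def set_lebesgue_integral_def by simp
      also have "\<dots> = (LBINT x:{a..b}. ue r x * ?p' r) + (LBINT x:{a..b}. Fb (r, x) * ?p r)"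
        by (intro set_integral_add set_integrable_mult_left set_integrable_cts cont_ue_x Fb_Icc_integrable)
      finally show ?thesis by simp
    qed
    with Bochner_Integration.integrable_diff[OF iF i1] show ?thesis by simp
  qed
  have i3: "integrable lborel (\<lambda>r. (ue r c)\<^sup>2 / 2 * ?p r)" for c
    by (rule integrable_compact_support(1)[of _ s "t+1"])
       (use plateau_outside_ge[OF st(2)] in \<open>auto intro!: continuous_intros cont_ue_t plateau_continuous\<close>)
  have "(LBINT r. ((ue r a)\<^sup>2 / 2 - (ue r b)\<^sup>2 / 2 + (LBINT x:{a..b}. Fb (r, x))) * ?p r)
      = f a - f b + (LBINT r. (LBINT x:{a..b}. Fb (r, x)) * ?p r)"
    unfolding f_def left_diff_distrib distrib_right using i2 i3[of a] i3[of b] by simp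
  moreover have "(LBINT r. (LBINT x:{a..b}. ue r x) * ?p' r) + (LBINT r. (LBINT x:{a..b}. Fb (r, x)) * ?p r) = f b - f a"
    using eq1 Bochner_Integration.integral_add[OF i1 i2] by simp
  ultimately show ?thesis by simp
qed

end

section \<open>Evolution of the mollified slope\<close>

text \<open>The difference \<open>D\<close> of the two sides, as a function of the upper limit, satisfies
  \<open>\<bar>D y - D x\<bar> \<le> e K (y - x)\<close>, where \<open>e\<close> is the oscillation of \<open>g' \<circ> W\<close> on \<open>[x, y]\<close>: the increment of \<open>g \<circ> W\<close> is
  \<open>g'(W z)\<close> times the increment of \<open>W\<close> for some \<open>z\<close> in between. So \<open>D\<close> has derivative zero everywhere,
  although \<open>W\<close> is only Lipschitz.\<close>

lemma chain_rule_increment: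
  fixes W R :: "real \<Rightarrow> real"
  assumes [measurable]: "R \<in> borel_measurable borel" and K: "\<And>r. r \<in> {0..T} \<Longrightarrow> \<bar>R r\<bar> \<le> K" and T: "0 < T"
    and W: "\<And>s t. 0 \<le> s \<Longrightarrow> s \<le> t \<Longrightarrow> t \<le> T \<Longrightarrow> W t - W s = (LBINT r:{s..t}. R r)"
    and Wm[measurable]: "W \<in> borel_measurable borel"
    and g: "\<And>x. (g has_real_derivative g' x) (at x)" "continuous_on UNIV g'" and g'b: "\<And>x. \<bar>g' x\<bar> \<le> G"
  shows "(LBINT r:{0..T}. g' (W r) * R r) = g (W T) - g (W 0)"
proof -
  have K0: "0 \<le> K" using K[of 0] T by (auto intro: order_trans[OF abs_ge_zero])
  have [measurable]: "g' \<in> borel_measurable borel" using g(2) by (rule borel_measurable_continuous_onI)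
  have lip: "\<bar>W y - W x\<bar> \<le> K * \<bar>y - x\<bar>" if xy: "x \<in> {0..T}" "y \<in> {0..T}" for x y
  proof -
    have *: "\<bar>W y - W x\<bar> \<le> K * \<bar>y - x\<bar>" if "0 \<le> x" "x \<le> y" "y \<le> T" for x y
      using Icc_integral_abs_le[of R x y K] K W[OF that] that by auto
    show ?thesis using *[of x y] *[of y x] xy by (cases "x \<le> y") (auto simp: abs_minus_commute)
  qed
  have Wc: "continuous_on {0..T} W"
    by (rule lipschitz_on_continuous_on[of K]) (use lip K0 in \<open>auto intro!: lipschitz_onI simp: dist_real_def abs_minus_commute\<close>)
  have gi: "set_integrable lborel {x..y} (\<lambda>r. g' (W r) * R r)" if "0 \<le> x" "y \<le> T" for x y
  proof (rule bounded_Icc_integrable)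
    fix r assume "r \<in> {x..y}"
    then have "\<bar>g' (W r)\<bar> * \<bar>R r\<bar> \<le> G * K" using g'b K[of r] that order_trans[OF abs_ge_zero g'b] by (intro mult_mono) auto
    then show "\<bar>g' (W r) * R r\<bar> \<le> G * K" by (simp add: abs_mult)
  qed measurable
  define I where "I t = (LBINT r:{0..t}. g' (W r) * R r)" for t
  have I_inc: "I y - I x = (LBINT r:{x..y}. g' (W r) * R r)" if "0 \<le> x" "x \<le> y" "y \<le> T" for x y
  proof -
    have "(LBINT r:{0..x} \<union> {x..y}. g' (W r) * R r) = I x + (LBINT r:{x..y}. g' (W r) * R r)"
      unfolding I_def
    proof (rule set_integral_Un_AE)
      show "AE r in lborel. \<not> (r \<in> {0..x} \<and> r \<in> {x..y})" using AE_lborel_singleton[of x] by eventually_elim auto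
    qed (use gi that in auto)
    moreover have "{0..x} \<union> {x..y} = {0..y}" using that by auto
    ultimately show ?thesis by (simp add: I_def)
  qed
  \<comment> \<open>It remains to see that this function is constant.\<close>
  define D where "D t = g (W t) - I t" for t
  have inc: "\<bar>D y - D x\<bar> \<le> e * K * (y - x)"
    if xy: "0 \<le> x" "x < y" "y \<le> T" and e: "\<And>r z. r \<in> {x..y} \<Longrightarrow> z \<in> {x..y} \<Longrightarrow> \<bar>g' (W z) - g' (W r)\<bar> \<le> e" for x y e
  proof -
    have e0: "0 \<le> e" using e[of x x] xy by simp
    obtain z where z: "z \<in> {x..y}" "g (W y) - g (W x) = g' (W z) * (W y - W x)"
    proof -
      have "\<exists>\<xi>. min (W x) (W y) \<le> \<xi> \<and> \<xi> \<le> max (W x) (W y) \<and> g (W y) - g (W x) = g' \<xi> * (W y - W x)"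
      proof (cases "W x" "W y" rule: linorder_cases)
        case less
        then obtain \<xi> where "W x < \<xi>" "\<xi> < W y" "g (W y) - g (W x) = (W y - W x) * g' \<xi>"
          using MVT2[of "W x" "W y" g g'] g(1) by blast
        then show ?thesis by (intro exI[of _ \<xi>]) (auto simp: mult.commute)
      next
        case greater
        then obtain \<xi> where "W y < \<xi>" "\<xi> < W x" "g (W x) - g (W y) = (W x - W y) * g' \<xi>"
          using MVT2[of "W y" "W x" g g'] g(1) by blast
        then show ?thesis by (intro exI[of _ \<xi>]) (auto simp: algebra_simps)
      qed (auto intro: exI[of _ "W x"])
      then obtain \<xi> where xi: "min (W x) (W y) \<le> \<xi>" "\<xi> \<le> max (W x) (W y)" "g (W y) - g (W x) = g' \<xi> * (W y - W x)" by blast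
      have cxy: "continuous_on {x..y} W" by (rule continuous_on_subset[OF Wc]) (use xy in auto)
      have "\<exists>z. x \<le> z \<and> z \<le> y \<and> W z = \<xi>"
        using IVT'[of W x \<xi> y] IVT2'[of W y \<xi> x] cxy xi(1,2) xy by (cases "W x \<le> W y") (auto simp: min_def max_def)
      then show ?thesis using that xi(3) by auto
    qed
    have iR: "set_integrable lborel {x..y} (\<lambda>r. g' (W z) * R r)"
      using bounded_Icc_integrable[of R x y K] K xy by (intro set_integrable_mult_right) auto
    have "D y - D x = (LBINT r:{x..y}. g' (W z) * R r) - (LBINT r:{x..y}. g' (W r) * R r)"
      using z(2) I_inc[of x y] W[of x y] xy by (simp add: D_def)
    also have "\<dots> = (LBINT r:{x..y}. (g' (W z) - g' (W r)) * R r)"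
      using set_integral_diff(2)[OF iR gi[of x y]] xy by (simp add: left_diff_distrib)
    also have "\<bar>\<dots>\<bar> \<le> (e * K) * (y - x)"
    proof (rule Icc_integral_abs_le)
      fix r assume r: "r \<in> {x..y}"
      have "\<bar>g' (W z) - g' (W r)\<bar> * \<bar>R r\<bar> \<le> e * K" using e[OF r z(1)] K[of r] r xy e0 by (intro mult_mono) auto
      then show "\<bar>(g' (W z) - g' (W r)) * R r\<bar> \<le> e * K" by (simp add: abs_mult)
    qed (use xy in auto)
    finally show ?thesis .
  qed
  have crude: "\<bar>D y - D x\<bar> \<le> 2 * G * K * \<bar>y - x\<bar>" if "x \<in> {0..T}" "y \<in> {0..T}" for x y
  proof -
    have G2: "\<bar>g' p - g' q\<bar> \<le> 2 * G" for p q using g'b[of p] g'b[of q] by auto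
    consider "x < y" | "x = y" | "y < x" by linarith
    then show ?thesis
    proof cases
      case 1 then show ?thesis using inc[of x y "2 * G"] G2 that by auto
    next
      case 3 then show ?thesis using inc[of y x "2 * G"] G2 that by (auto simp: abs_minus_commute)
    qed simp
  qed
  have "0 \<le> 2 * G * K" using K0 order_trans[OF abs_ge_zero g'b] by simp
  then have Dc: "continuous_on {0..T} D"
    by (intro lipschitz_on_continuous_on[of "2 * G * K"] lipschitz_onI) (use crude in \<open>auto simp: dist_real_def abs_minus_commute\<close>)
  have "D T = D 0"
  proof (rule DERIV_isconst_end[OF T Dc])
    fix t assume t: "0 < t" "t < T"
    show "(D has_real_derivative 0) (at t)"
      unfolding DERIV_def
    proof (rule LIM_I)
      fix e :: real assume e: "0 < e"
      \<comment> \<open>The factor two accounts for the oscillation around the value at \<open>t\<close>; adding one avoids dividing by zero.\<close>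
      define e' where "e' = e / (2 * (K + 1))"
      have e': "e' > 0" "2 * e' * K < e" using e K0 by (auto simp: e'_def field_simps)
      have "isCont W t" using Wc t by (intro continuous_on_interior[OF Wc]) auto
      moreover have "isCont g' (W t)" using g(2) by (simp add: continuous_on_eq_continuous_at)
      ultimately have "isCont (\<lambda>r. g' (W r)) t" by (rule isCont_o2)
      then obtain d where d: "d > 0" "\<And>r. \<bar>r - t\<bar> < d \<Longrightarrow> \<bar>g' (W r) - g' (W t)\<bar> < e'"
        using e'(1) unfolding continuous_at_eps_delta dist_real_def by blast
      define d' where "d' = min d (min t (T - t))"
      have d': "d' > 0" using d t by (simp add: d'_def)
      have "norm ((D (t + h) - D t) / h - 0) < e" if h: "h \<noteq> 0" "norm (h - 0) < d'" for h
      proof -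
        have hb: "\<bar>h\<bar> < d" "\<bar>h\<bar> < t" "\<bar>h\<bar> < T - t" using h by (auto simp: d'_def)
        have osc: "\<bar>g' (W z) - g' (W r)\<bar> \<le> 2 * e'" if "\<bar>z - t\<bar> \<le> \<bar>h\<bar>" "\<bar>r - t\<bar> \<le> \<bar>h\<bar>" for z r
          using d(2)[of z] d(2)[of r] that hb by linarith
        have "\<bar>D (t + h) - D t\<bar> \<le> 2 * e' * K * \<bar>h\<bar>"
        proof (cases "h > 0")
          case True
          then have "\<bar>D (t + h) - D t\<bar> \<le> 2 * e' * K * (t + h - t)"
            using hb t by (intro inc osc) auto
          then show ?thesis using True by simp
        next
          case False
          then have "\<bar>D t - D (t + h)\<bar> \<le> 2 * e' * K * (t - (t + h))"
            using hb t h by (intro inc osc) auto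
          then show ?thesis using False by (simp add: abs_minus_commute)
        qed
        then have "\<bar>D (t + h) - D t\<bar> / \<bar>h\<bar> \<le> 2 * e' * K" using h by (simp add: pos_divide_le_eq)
        then show ?thesis using e'(2) by (simp add: abs_divide)
      qed
      then show "\<exists>s>0. \<forall>h. h \<noteq> 0 \<and> norm (h - 0) < s \<longrightarrow> norm ((D (t + h) - D t) / h - 0) < e"
        using d' by blast
    qed
  qed
  moreover have "I 0 = 0"
  proof -

    show ?thesis using I_inc[of 0 0] T by (simp add: I_def)
  qed
  ultimately show ?thesis by (simp add: D_def I_def)
qed

lemma var_interval_measurable:
  fixes k :: "'a \<times> real \<Rightarrow> real"
  assumes [measurable]: "k \<in> borel_measurable (N \<Otimes>\<^sub>M lborel)" "f \<in> borel_measurable N" "g \<in> borel_measurable N"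
  shows "(\<lambda>q. LBINT y:{f q..g q}. k (q, y)) \<in> borel_measurable N"
proof -
  have "(\<lambda>q. LBINT y. (if f q \<le> y \<and> y \<le> g q then k (q, y) else 0)) \<in> borel_measurable N"
    by (intro lborel.borel_measurable_lebesgue_integral) (simp add: case_prod_beta)
  moreover have "(LBINT y:{f q..g q}. k (q, y)) = (LBINT y. (if f q \<le> y \<and> y \<le> g q then k (q, y) else 0))" for q
    unfolding set_lebesgue_integral_def by (intro Bochner_Integration.integral_cong) (auto simp: indicator_def)
  ultimately show ?thesis by simp
qed

context weak_solution_src begin

text \<open>The rate of change of the integral of \<open>u\<close> over \<open>[a, b]\<close>.\<close>

definition flux :: "real \<Rightarrow> real \<Rightarrow> real \<Rightarrow> real" where
  "flux a b r = (ue r a)\<^sup>2 / 2 - (ue r b)\<^sup>2 / 2 + (LBINT x:{a..b}. Fb (r, x))"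

lemma flux_measurable [measurable (raw)]:
  assumes [measurable]: "f \<in> borel_measurable N" "g \<in> borel_measurable N" "t \<in> borel_measurable N"
  shows "(\<lambda>q. flux (f q) (g q) (t q)) \<in> borel_measurable N"
proof -
  have "(\<lambda>q. LBINT y:{f q..g q}. (\<lambda>p. Fb (t (fst p), snd p)) (q, y)) \<in> borel_measurable N"
    by (intro var_interval_measurable) measurable
  then show ?thesis unfolding flux_def by simp
qed

lemma Fb_interval_bound: "a \<le> b \<Longrightarrow> \<bar>LBINT x:{a..b}. Fb (r, x)\<bar> \<le> M / 2 * (b - a)"
proof (rule Icc_integral_abs_le)
  show "\<bar>Fb (r, x)\<bar> \<le> M / 2" for x by (rule Fb_bound)
qed measurable

lemma flux_bound:
  assumes "a \<le> b" "\<bar>ue r a\<bar> \<le> K" "\<bar>ue r b\<bar> \<le> K" "b - a \<le> 1"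
  shows "\<bar>flux a b r\<bar> \<le> K\<^sup>2 + M / 2"
proof -
  have "0 \<le> K" using assms(2) by linarith
  then have "(ue r a)\<^sup>2 \<le> K\<^sup>2" "(ue r b)\<^sup>2 \<le> K\<^sup>2" using assms by (auto intro!: power2_le_iff_abs_le[THEN iffD2])
  moreover have "\<bar>LBINT x:{a..b}. Fb (r, x)\<bar> \<le> M / 2 * 1"
    using order_trans[OF Fb_interval_bound[OF assms(1)] mult_left_mono[OF assms(4)]] M by simp
  moreover have "0 \<le> (ue r a)\<^sup>2" "0 \<le> (ue r b)\<^sup>2" by auto
  ultimately show ?thesis unfolding flux_def abs_le_iff by argo
qed

lemma flux_integrable: "a \<le> b \<Longrightarrow> set_integrable lborel {A..B} (flux a b)"
proof -
  assume ab: "a \<le> b"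

  have "set_integrable lborel {A..B} (\<lambda>r. (ue r a)\<^sup>2 / 2)" "set_integrable lborel {A..B} (\<lambda>r. (ue r b)\<^sup>2 / 2)"
    by (intro set_integrable_cts continuous_intros cont_ue_t; simp)+
  moreover have "set_integrable lborel {A..B} (\<lambda>r. LBINT x:{a..b}. Fb (r, x))"
  proof (rule bounded_Icc_integrable)
    show "(\<lambda>r. LBINT x:{a..b}. Fb (r, x)) \<in> borel_measurable borel"
      using var_interval_measurable[of "\<lambda>p. Fb (fst p, snd p)" borel "\<lambda>_. a" "\<lambda>_. b"] by simp
    show "\<bar>LBINT x:{a..b}. Fb (r, x)\<bar> \<le> M / 2 * (b - a)" for r by (rule Fb_interval_bound[OF ab])
  qed
  ultimately show ?thesis unfolding flux_def[abs_def] by (intro set_integral_add(1) set_integral_diff(1))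
qed

lemma balance_pos:
  assumes "0 < s" "s \<le> t" "a \<le> b"
  shows "(LBINT r:{s..t}. flux a b r) = (LBINT x:{a..b}. ue t x) - (LBINT x:{a..b}. ue s x)"
proof (rule weak_identity_imp_increment)
  show "continuous_on UNIV (\<lambda>r. LBINT x:{a..b}. ue r x)" by (rule param_integral_continuous) (rule cont_ue)
  show "flux a b \<in> borel_measurable borel" by measurable
  show "set_integrable lborel {s..t+1} (flux a b)" by (rule flux_integrable[OF assms(3)])
  show "(LBINT r. (LBINT x:{a..b}. ue r x) * plateau' s t n r) = - (LBINT r. flux a b r * plateau s t n r)" for n
    using time_tested_balance[OF assms, of n] unfolding flux_def .
qed (rule assms)

text \<open>The weak formulation only sees positive times; continuity of \<open>u\<close> up to \<open>t = 0\<close> includes the initial time,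
  which is essential for the comparison with the initial slope.\<close>

lemma balance:
  assumes st: "0 \<le> s" "s \<le> t" and ab: "a \<le> b"
  shows "(LBINT x:{a..b}. ue t x) - (LBINT x:{a..b}. ue s x) = (LBINT r:{s..t}. flux a b r)"
proof (cases "s = t")
  case True
  have "(LBINT r:{t..t}. flux a b r) = 0"
  proof -
    have "flux a b \<in> borel_measurable borel" by measurable
    then obtain H where "primitive H (flux a b)" using primitive_exists flux_integrable[OF ab] by blast
    from primitiveD(3)[OF this, of t t] show ?thesis by simp
  qed
  then show ?thesis using True by simp
next
  case False
  have "flux a b \<in> borel_measurable borel" by measurable
  then obtain H where H: "primitive H (flux a b)" using primitive_exists flux_integrable[OF ab] by blast
  define m where "m r = (LBINT x:{a..b}. ue r x)" for r
  have cm: "continuous_on UNIV m" unfolding m_def by (rule param_integral_continuous) (rule cont_ue)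
  have "m t - m r - (H t - H r) = 0" if "0 < r" "r \<le> t" for r
    using balance_pos[OF that ab] primitiveD(3)[OF H that(2)] by (simp add: m_def)
  moreover have "((\<lambda>r. m t - m r - (H t - H r)) \<longlongrightarrow> m t - m s - (H t - H s)) (at_right s)"
  proof -
    have "isCont m s" "isCont H s" using cm primitive_continuous[OF H, of UNIV] by (auto simp: continuous_on_eq_continuous_at)
    then have "(m \<longlongrightarrow> m s) (at_right s)" "(H \<longlongrightarrow> H s) (at_right s)"
      unfolding isCont_def by (auto intro: filterlim_mono[OF _ order_refl at_le])
    then show ?thesis by (intro tendsto_intros)
  qed
  moreover have "\<forall>\<^sub>F r in at_right s. 0 < r \<and> r \<le> t"
    using st False unfolding eventually_at_right_field by (intro exI[of _ t]) auto
  ultimately have "((\<lambda>r. 0::real) \<longlongrightarrow> m t - m s - (H t - H s)) (at_right s)"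
    by (elim Lim_transform_eventually) (auto elim!: eventually_mono)
  then have "m t - m s - (H t - H s) = 0"
    using tendsto_unique[OF trivial_limit_at_right_real _ tendsto_const] by metis
  then show ?thesis using primitiveD(3)[OF H st(2)] by (simp add: m_def)
qed

text \<open>The hat average of the slope, written with integrals of \<open>u\<close> so that it is defined and measurable jointly
  in space and time; \<open>slope_rate\<close> is its time derivative.\<close>

definition slope :: "real \<Rightarrow> real \<Rightarrow> real \<Rightarrow> real" where
  "slope h t x = ((LBINT y:{x..x+h}. ue t y) - (LBINT y:{x-h..x}. ue t y)) / h\<^sup>2"

definition slope_rate :: "real \<Rightarrow> real \<Rightarrow> real \<Rightarrow> real" where
  "slope_rate h t x = (flux x (x + h) t - flux (x - h) x t) / h\<^sup>2"

lemma slope_measurable [measurable (raw)]: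
  assumes [measurable]: "f \<in> borel_measurable N" "t \<in> borel_measurable N"
  shows "(\<lambda>q. slope h (t q) (f q)) \<in> borel_measurable N"
proof -
  have "(\<lambda>q. LBINT y:{f q..f q + h}. (\<lambda>p. ue (t (fst p)) (snd p)) (q, y)) \<in> borel_measurable N"
    "(\<lambda>q. LBINT y:{f q - h..f q}. (\<lambda>p. ue (t (fst p)) (snd p)) (q, y)) \<in> borel_measurable N"
    by (intro var_interval_measurable; measurable)+
  then show ?thesis unfolding slope_def by simp
qed

lemma slope_rate_measurable [measurable (raw)]:
  assumes [measurable]: "f \<in> borel_measurable N" "t \<in> borel_measurable N"
  shows "(\<lambda>q. slope_rate h (t q) (f q)) \<in> borel_measurable N"
  unfolding slope_rate_def by measurable

lemma slope_increment:
  assumes h: "0 < h" and st: "0 \<le> s" "s \<le> t"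
  shows "slope h t x - slope h s x = (LBINT r:{s..t}. slope_rate h r x)"
proof -
  have "(LBINT r:{s..t}. slope_rate h r x) = ((LBINT r:{s..t}. flux x (x + h) r) - (LBINT r:{s..t}. flux (x - h) x r)) / h\<^sup>2"
    unfolding slope_rate_def using h set_integral_diff(2)[OF flux_integrable[of x "x+h"] flux_integrable[of "x-h" x], of s t] by simp
  also have "(LBINT r:{s..t}. flux x (x + h) r) = (LBINT y:{x..x+h}. ue t y) - (LBINT y:{x..x+h}. ue s y)"
    using balance[OF st, of x "x+h"] h by simp
  also have "(LBINT r:{s..t}. flux (x - h) x r) = (LBINT y:{x-h..x}. ue t y) - (LBINT y:{x-h..x}. ue s y)"
    using balance[OF st, of "x-h" x] h by simp
  finally show ?thesis by (simp add: slope_def diff_divide_distrib)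
qed

lemma slope_eq_second_diff:
  assumes "0 < h" "\<And>x. (\<Phi> has_real_derivative ue t x) (at x)"
  shows "slope h t x = second_diff h \<Phi> x"
  using LBINT_FTC(2)[OF assms(2) cont_ue_x, of x "x+h"] LBINT_FTC(2)[OF assms(2) cont_ue_x, of "x-h" x] assms(1)
  by (simp add: slope_def second_diff_def)

lemma slope_rate_eq_second_diff:
  assumes h: "0 < h" and t: "0 < t" and Fb: "AE x in lborel. Fb (t, x) = CH_source (u t) x"
    and c: "continuous_on UNIV (CH_source (u t))" and \<Theta>: "\<And>x. (\<Theta> has_real_derivative CH_source (u t) x) (at x)"
  shows "slope_rate h t x = second_diff h \<Theta> x - second_diff h (\<lambda>x. (u t x)\<^sup>2 / 2) x"
proof -
  have cm[measurable]: "CH_source (u t) \<in> borel_measurable borel" using c by (rule borel_measurable_continuous_onI)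
  have "(LBINT x:{a..b}. Fb (t, x)) = \<Theta> b - \<Theta> a" if "a \<le> b" for a b
  proof -
    have "(LBINT x:{a..b}. Fb (t, x)) = (LBINT x:{a..b}. CH_source (u t) x)"
      unfolding set_lebesgue_integral_def
      by (rule integral_cong_AE) (use Fb in \<open>auto elim!: eventually_mono\<close>)
    then show ?thesis using LBINT_FTC(2)[OF \<Theta> c that] by simp
  qed
  from this[of x "x+h"] this[of "x-h" x]
  have "flux x (x + h) t - flux (x - h) x t = (\<Theta> (x + h) - 2 * \<Theta> x + \<Theta> (x - h))
      - ((u t (x + h))\<^sup>2 / 2 - 2 * ((u t x)\<^sup>2 / 2) + (u t (x - h))\<^sup>2 / 2)"
    using h t unfolding flux_def by (simp add: ue_eq)
  then show ?thesis unfolding slope_rate_def second_diff_def by (simp only: diff_divide_distrib)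
qed

end

section \<open>Growth of the negative slope energy\<close>

text \<open>A cut-off in space together with a bound \<open>U\<close> for the solution near its support on the time interval
  \<open>[0, 1]\<close>.\<close>

locale cutoff_solution = weak_solution_src +
  fixes \<psi> \<psi>' :: "real \<Rightarrow> real" and R D U :: real
  assumes \<psi>: "\<And>x. (\<psi> has_real_derivative \<psi>' x) (at x)" "continuous_on UNIV \<psi>'"
    and \<psi>_range: "\<And>x. 0 \<le> \<psi> x" "\<And>x. \<psi> x \<le> 1" and \<psi>': "\<And>x. \<bar>\<psi>' x\<bar> \<le> D"
    and \<psi>_ends: "\<psi> (-R) = 0" "\<psi> R = 0" and R: "0 < R"
    and U: "\<And>t x. t \<in> {0..1} \<Longrightarrow> x \<in> {-R-1..R+1} \<Longrightarrow> \<bar>ue t x\<bar> \<le> U"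
begin

text \<open>The constant \<open>bound\<close> of the fixed-time estimate, with the data that a weak solution provides.\<close>

definition growth :: real where
  "growth = (U * D + 1) * (2 * M) + 2 * R * (U\<^sup>2 + M / 2)\<^sup>2"

lemma cont_psi: "continuous_on S \<psi>" using \<psi>(1) by (metis DERIV_isCont continuous_at_imp_continuous_on)

lemma psi_borel [measurable]: "\<psi> \<in> borel_measurable borel"
  by (intro borel_measurable_continuous_onI cont_psi)

definition energy_rate :: "real \<Rightarrow> real \<Rightarrow> real \<Rightarrow> real" where
  "energy_rate \<epsilon> h r = (LBINT x:{-R..R}. \<psi> x * neg_sq' \<epsilon> (slope h r x) * slope_rate h r x)"

context fixes \<epsilon> :: real assumes eps: "0 < \<epsilon>" "\<epsilon> \<le> 1" begin

lemma neg_sq_borels: "neg_sq \<epsilon> \<in> borel_measurable borel" "neg_sq' \<epsilon> \<in> borel_measurable borel"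
  using neg_sq_borel[OF eps] by auto

lemma slope_rate_bound:
  assumes "0 < h" "h \<le> 1" "r \<in> {0..1}" "x \<in> {-R..R}"
  shows "\<bar>slope_rate h r x\<bar> \<le> 2 * (U\<^sup>2 + M / 2) / h\<^sup>2"
proof -
  have "\<bar>flux x (x + h) r\<bar> \<le> U\<^sup>2 + M / 2" "\<bar>flux (x - h) x r\<bar> \<le> U\<^sup>2 + M / 2"
    using assms by (auto intro!: flux_bound U)
  then have "\<bar>flux x (x + h) r - flux (x - h) x r\<bar> \<le> 2 * (U\<^sup>2 + M / 2)"
    using abs_triangle_ineq4[of "flux x (x + h) r" "flux (x - h) x r"] by argo
  then show ?thesis using assms(1) unfolding slope_rate_def abs_divide by (simp add: divide_right_mono)
qed

lemma neg_sq_increment: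
  assumes h: "0 < h" "h \<le> 1" and T: "0 < T" "T \<le> 1"
  shows "(LBINT x:{-R..R}. \<psi> x * neg_sq \<epsilon> (slope h T x)) - (LBINT x:{-R..R}. \<psi> x * neg_sq \<epsilon> (slope h 0 x))
     = (LBINT r:{0..T}. energy_rate \<epsilon> h r)"
    "set_integrable lborel {0..T} (energy_rate \<epsilon> h)"
proof -
  note [measurable] = neg_sq_borels
  define K where "K = 2 * (U\<^sup>2 + M / 2) / h\<^sup>2"
  have chain: "(LBINT r:{0..T}. neg_sq' \<epsilon> (slope h r x) * slope_rate h r x) = neg_sq \<epsilon> (slope h T x) - neg_sq \<epsilon> (slope h 0 x)"
    if x: "x \<in> {-R..R}" for x
  proof (rule chain_rule_increment[where K=K and G="1/\<epsilon>"])
    show "(\<lambda>r. slope_rate h r x) \<in> borel_measurable borel" by measurable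
    show "(\<lambda>r. slope h r x) \<in> borel_measurable borel" by measurable
    show "\<bar>slope_rate h r x\<bar> \<le> K" if "r \<in> {0..T}" for r
      unfolding K_def using that T x by (intro slope_rate_bound h) auto
    show "slope h t x - slope h s x = (LBINT r:{s..t}. slope_rate h r x)" if "0 \<le> s" "s \<le> t" "t \<le> T" for s t
      by (rule slope_increment[OF h(1) that(1,2)])
    show "\<bar>neg_sq' \<epsilon> w\<bar> \<le> 1 / \<epsilon>" for w by (rule neg_sq'_bounded[OF eps])
  qed (use T neg_sq_deriv[OF eps] neg_sq'_cont[OF eps] in auto)
  define G where "G x r = indicator {-R..R} x * (indicator {0..T} r * (\<psi> x * neg_sq' \<epsilon> (slope h r x) * slope_rate h r x))" for x r
  have Gb: "\<bar>\<psi> x * neg_sq' \<epsilon> (slope h r x) * slope_rate h r x\<bar> \<le> 1 * (1 / \<epsilon>) * K" if "x \<in> {-R..R}" "r \<in> {0..T}" for x r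
    unfolding abs_mult K_def using that T \<psi>_range[of x] neg_sq'_bounded[OF eps, of "slope h r x"] slope_rate_bound[OF h, of r x] eps
    by (intro mult_mono) auto
  have Gi: "integrable (lborel \<Otimes>\<^sub>M lborel) (case_prod G)"
  proof (rule bounded_box_integrable[of _ "-R" R 0 T])
    have "(\<lambda>q. indicator {-R..R} (fst q) * (indicator {0..T} (snd q) * (\<psi> (fst q) * neg_sq' \<epsilon> (slope h (snd q) (fst q)) * slope_rate h (snd q) (fst q)))) \<in> borel_measurable borel"
      unfolding borel_prod[symmetric] by measurable
    moreover have "case_prod G = (\<lambda>q. indicator {-R..R} (fst q) * (indicator {0..T} (snd q) * (\<psi> (fst q) * neg_sq' \<epsilon> (slope h (snd q) (fst q)) * slope_rate h (snd q) (fst q))))"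
      by (auto simp: G_def fun_eq_iff)
    ultimately show "case_prod G \<in> borel_measurable borel" by simp
    show "case_prod G p = 0" if "p \<notin> {-R..R} \<times> {0..T}" for p
      using that by (cases p) (auto simp: G_def indicator_def)
    show "\<bar>case_prod G p\<bar> \<le> 1 * (1 / \<epsilon>) * K" if "p \<in> {-R..R} \<times> {0..T}" for p
      using Gb[of "fst p" "snd p"] that by (cases p) (auto simp: G_def)
  qed
  have A: "(LBINT x. G x r) = indicator {0..T} r * energy_rate \<epsilon> h r" for r
    unfolding G_def energy_rate_def set_lebesgue_integral_def
    by (subst integral_mult_right_zero[symmetric]) (auto intro!: Bochner_Integration.integral_cong simp: ac_simps)
  have B: "(LBINT r. G x r) = indicator {-R..R} x * (\<psi> x * (neg_sq \<epsilon> (slope h T x) - neg_sq \<epsilon> (slope h 0 x)))" for x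
  proof (cases "x \<in> {-R..R}")
    case True
    have "(LBINT r. G x r) = \<psi> x * (LBINT r:{0..T}. neg_sq' \<epsilon> (slope h r x) * slope_rate h r x)"
      unfolding G_def set_lebesgue_integral_def using True
      by (subst integral_mult_right_zero[symmetric]) (auto intro!: Bochner_Integration.integral_cong simp: ac_simps)
    then show ?thesis using chain[OF True] True by simp
  qed (simp add: G_def)
  have ei: "set_integrable lborel {-R..R} (\<lambda>x. \<psi> x * neg_sq \<epsilon> (slope h t x))" for t
  proof (rule bounded_Icc_integrable)
    show "(\<lambda>x. \<psi> x * neg_sq \<epsilon> (slope h t x)) \<in> borel_measurable borel" by measurable
    show "\<bar>\<psi> x * neg_sq \<epsilon> (slope h t x)\<bar> \<le> 1 * (1 / \<epsilon>)" for x
      unfolding abs_mult using \<psi>_range[of x] neg_sq_nonneg[OF eps, of "slope h t x"] neg_sq_bounded[OF eps, of "slope h t x"]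
      by (intro mult_mono) auto
  qed
  have "(LBINT r:{0..T}. energy_rate \<epsilon> h r) = (LBINT r. (LBINT x. G x r))"
    unfolding A set_lebesgue_integral_def by simp
  also have "\<dots> = (LBINT x. (LBINT r. G x r))" by (rule lborel_pair.Fubini_integral[OF Gi])
  also have "\<dots> = (LBINT x:{-R..R}. \<psi> x * neg_sq \<epsilon> (slope h T x) - \<psi> x * neg_sq \<epsilon> (slope h 0 x))"
    unfolding B set_lebesgue_integral_def by (simp add: right_diff_distrib)
  also have "\<dots> = (LBINT x:{-R..R}. \<psi> x * neg_sq \<epsilon> (slope h T x)) - (LBINT x:{-R..R}. \<psi> x * neg_sq \<epsilon> (slope h 0 x))"
    by (rule set_integral_diff(2)[OF ei ei])
  finally show "(LBINT x:{-R..R}. \<psi> x * neg_sq \<epsilon> (slope h T x)) - (LBINT x:{-R..R}. \<psi> x * neg_sq \<epsilon> (slope h 0 x))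
     = (LBINT r:{0..T}. energy_rate \<epsilon> h r)" by simp
  have "integrable lborel (\<lambda>r. (LBINT x. G x r))"
    using lborel_pair.integrable_snd[OF Gi] by simp
  then show "set_integrable lborel {0..T} (energy_rate \<epsilon> h)" unfolding A set_integrable_def by simp
qed

text \<open>The bound of the fixed-time estimate at almost every time. Taking the maximum with \<open>growth\<close> turns an upper
  bound in the limit \<open>h \<rightarrow> 0\<close> into convergence, as dominated convergence requires.\<close>

lemma energy_rate_limit:
  "\<exists>C. AE r in lborel. r \<in> {0<..1} \<longrightarrow>
     (\<forall>h. 0 < h \<longrightarrow> h \<le> 1 \<longrightarrow> \<bar>energy_rate \<epsilon> h r\<bar> \<le> C) \<and>
     (\<forall>h. (\<forall>n. 0 < h n \<and> h n \<le> 1) \<longrightarrow> h \<longlonglongrightarrow> 0 \<longrightarrow> (\<lambda>n. max (energy_rate \<epsilon> (h n) r) growth) \<longlonglongrightarrow> growth)"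
proof -
  define C where "C = 1 / \<epsilon> * (2 * R * ((U\<^sup>2 + M / 2) + 1) + 4 * (2 * M)) + U * D * (2 * M)"
  have "AE r in lborel. r \<in> {0<..1} \<longrightarrow>
     (\<forall>h. 0 < h \<longrightarrow> h \<le> 1 \<longrightarrow> \<bar>energy_rate \<epsilon> h r\<bar> \<le> C) \<and>
     (\<forall>h. (\<forall>n. 0 < h n \<and> h n \<le> 1) \<longrightarrow> h \<longlonglongrightarrow> 0 \<longrightarrow> (\<lambda>n. max (energy_rate \<epsilon> (h n) r) growth) \<longlonglongrightarrow> growth)"
    using energy Fb_sections
  proof eventually_elim
    case (elim r)
    show ?case
    proof
      assume r: "r \<in> {0<..1}"
      then have r0: "0 \<le> r" "0 < r" "r \<in> {0..1}" by auto
      obtain v where v: "primitive (u r) v" "AE x in lebesgue. weak_deriv (u r) x = v x" "integrable lborel (\<lambda>x. (v x)\<^sup>2)"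
        "(LBINT x. (v x)\<^sup>2) \<le> 2 * M"
        using slopes[OF r0(1)] by blast
      have [measurable]: "v \<in> borel_measurable borel" by (rule primitiveD(1)[OF v(1)])
      have vi: "set_integrable lborel {x..y} (\<lambda>x. (v x)\<^sup>2)" for x y
        using integrable_mult_indicator[OF _ v(3), of "{x..y}"] by (simp add: set_integrable_def)
      obtain Q where Q: "primitive Q (\<lambda>x. (v x)\<^sup>2)" using primitive_of_integrable[OF v(3)] by auto
      note S = CH_source_props[OF v(1,2) elim(1)[rule_format, OF r0(1)] M Q]
      have cu: "continuous_on UNIV (u r)" by (rule primitive_continuous[OF v(1)])
      obtain \<Phi> where \<Phi>: "\<And>x. (\<Phi> has_real_derivative u r x) (at x)" using antiderivative_exists[OF cu] by blast
      obtain \<Psi> where \<Psi>: "\<And>x. (\<Psi> has_real_derivative Q x) (at x)" using antiderivative_exists[OF primitive_continuous[OF Q]] by blast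
      obtain \<Theta> where \<Theta>: "\<And>x. (\<Theta> has_real_derivative CH_source (u r) x) (at x)" using antiderivative_exists[OF S(3)] by blast
      have QE: "Q y - Q x \<le> 2 * M" for x y
      proof (cases "x \<le> y")
        case True
        have "(LBINT z:{x..y}. (v z)\<^sup>2) \<le> (LBINT z. (v z)\<^sup>2)"
          unfolding set_lebesgue_integral_def using vi[of x y] v(3) unfolding set_integrable_def
          by (intro integral_mono) (auto simp: indicator_def)
        then show ?thesis using primitiveD(3)[OF Q True] v(4) by simp
      next
        case False
        then show ?thesis using primitive_nonneg_mono[OF Q, of y x] M by simp
      qed
      have Ur: "\<bar>u r x\<bar> \<le> U" if "x \<in> {-R-1..R+1}" for x using U[OF r0(3) that] ue_eq[OF r0(1)] by simp
      interpret ft: frozen_time "u r" v Q "CH_source (u r)" \<Phi> \<Psi> \<Theta> \<psi> \<psi>' "2 * M" U "U\<^sup>2 + M / 2" D R \<epsilon>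
      proof
        show "\<bar>CH_source (u r) y - CH_source (u r) x - (Q y - Q x) / 2\<bar> \<le> (U\<^sup>2 + M / 2) * (y - x)"
          if "- R - 1 \<le> x" "x \<le> y" "y \<le> R + 1" for x y
          using that by (intro S(2) Ur) auto
      qed (use v(1) Q \<Phi> \<Psi> \<Theta> S(3) QE Ur \<psi> \<psi>_range \<psi>' \<psi>_ends R eps in auto)
      have ue_r: "ue r = u r" using ue_eq[OF r0(1)] by auto
      have ex: "energy_rate \<epsilon> h r = ft.rate h" if "0 < h" for h
        unfolding energy_rate_def ft.rate_def
        using slope_eq_second_diff[of h \<Phi> r] slope_rate_eq_second_diff[OF that r0(2) _ S(3) \<Theta>] elim(2) r0(2) \<Phi> that
        by (intro set_lebesgue_integral_cong) (auto simp: ue_r)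
      have gr: "ft.bound = growth" unfolding ft.bound_def growth_def by simp
      show "(\<forall>h. 0 < h \<longrightarrow> h \<le> 1 \<longrightarrow> \<bar>energy_rate \<epsilon> h r\<bar> \<le> C) \<and>
       (\<forall>h. (\<forall>n. 0 < h n \<and> h n \<le> 1) \<longrightarrow> h \<longlonglongrightarrow> 0 \<longrightarrow> (\<lambda>n. max (energy_rate \<epsilon> (h n) r) growth) \<longlonglongrightarrow> growth)"
      proof (intro conjI allI impI)
        fix h :: real assume "0 < h" "h \<le> 1"
        then show "\<bar>energy_rate \<epsilon> h r\<bar> \<le> C" using ft.rate_abs ex by (simp add: C_def ft.crude_bound_def)
      next
        fix h :: "nat \<Rightarrow> real" assume h: "\<forall>n. 0 < h n \<and> h n \<le> 1" "h \<longlonglongrightarrow> 0"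
        define e where "e n = (LBINT x:{-R..R}. ft.rem (h n) x)" for n
        have e0: "e \<longlonglongrightarrow> 0" unfolding e_def[abs_def] using h R by (intro ft.rem_tendsto) auto
        have up: "max (energy_rate \<epsilon> (h n) r) growth \<le> growth + \<bar>e n\<bar>" for n
        proof -
          have "energy_rate \<epsilon> (h n) r \<le> growth + e n" using ft.rate_le[of "h n"] h(1) ex[of "h n"] gr by (simp add: e_def)
          then show ?thesis by simp
        qed
        have lim: "(\<lambda>n. growth + \<bar>e n\<bar>) \<longlonglongrightarrow> growth" using tendsto_add[OF tendsto_const tendsto_rabs[OF e0], of growth] by simp
        show "(\<lambda>n. max (energy_rate \<epsilon> (h n) r) growth) \<longlonglongrightarrow> growth"
          by (rule tendsto_sandwich[OF _ _ tendsto_const lim]) (use up in auto)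
      qed
    qed
  qed
  then show ?thesis by blast
qed

lemma slope_energy_tendsto:
  assumes t: "0 \<le> t" and v: "primitive (u t) v" and h: "\<And>n. 0 < h n" "h \<longlonglongrightarrow> 0"
  shows "(\<lambda>n. LBINT x:{-R..R}. \<psi> x * neg_sq \<epsilon> (slope (h n) t x)) \<longlonglongrightarrow> (LBINT x:{-R..R}. \<psi> x * neg_sq \<epsilon> (v x))"
  unfolding set_lebesgue_integral_def
proof (rule integral_dominated_convergence[where w="\<lambda>x. indicator {-R..R} x * (1 / \<epsilon>)"])
  note [measurable] = neg_sq_borels primitiveD(1)[OF v]
  have ue_t: "ue t = u t" using ue_eq[OF t] by auto
  obtain \<Phi> where \<Phi>: "\<And>x. (\<Phi> has_real_derivative u t x) (at x)" using antiderivative_exists[OF primitive_continuous[OF v]] by blast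
  have sl: "slope (h n) t x = second_diff (h n) \<Phi> x" for n x using slope_eq_second_diff[OF h(1)[of n], of \<Phi> t x] \<Phi> by (simp add: ue_t)
  show "integrable lborel (\<lambda>x. indicator {-R..R} x * (1 / \<epsilon>))"
    by (rule integrable_Icc_const)
  show "(\<lambda>x. indicator {-R..R} x *\<^sub>R (\<psi> x * neg_sq \<epsilon> (v x))) \<in> borel_measurable lborel" by measurable
  show "(\<lambda>x. indicator {-R..R} x *\<^sub>R (\<psi> x * neg_sq \<epsilon> (slope (h n) t x))) \<in> borel_measurable lborel" for n by measurable
  show "AE x in lborel. (\<lambda>n. indicator {-R..R} x *\<^sub>R (\<psi> x * neg_sq \<epsilon> (slope (h n) t x))) \<longlonglongrightarrow> indicator {-R..R} x *\<^sub>R (\<psi> x * neg_sq \<epsilon> (v x))"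
    using primitive_AE_deriv[OF v]
  proof eventually_elim
    case (elim x)
    have "isCont (neg_sq \<epsilon>) (v x)" using neg_sq_deriv[OF eps] DERIV_isCont by blast
    from isCont_tendsto_compose[OF this second_diff_tendsto[OF \<Phi> elim h]]
    show ?case unfolding sl by (intro tendsto_intros)
  qed
  show "AE x in lborel. norm (indicator {-R..R} x *\<^sub>R (\<psi> x * neg_sq \<epsilon> (slope (h n) t x))) \<le> indicator {-R..R} x * (1 / \<epsilon>)" for n
  proof (intro always_eventually allI)
    fix x
    have "\<bar>\<psi> x\<bar> * \<bar>neg_sq \<epsilon> (slope (h n) t x)\<bar> \<le> 1 * (1 / \<epsilon>)"
      using \<psi>_range[of x] neg_sq_nonneg[OF eps, of "slope (h n) t x"] neg_sq_bounded[OF eps, of "slope (h n) t x"]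
      by (intro mult_mono) auto
    then show "norm (indicator {-R..R} x *\<^sub>R (\<psi> x * neg_sq \<epsilon> (slope (h n) t x))) \<le> indicator {-R..R} x * (1 / \<epsilon>)"
      by (simp add: indicator_def abs_mult)
  qed
qed

lemma truncated_energy_growth:
  assumes T: "0 < T" "T \<le> 1" and v: "primitive (u T) v" and v0: "primitive (u 0) v0"
  shows "(LBINT x:{-R..R}. \<psi> x * neg_sq \<epsilon> (v x)) \<le> (LBINT x:{-R..R}. \<psi> x * neg_sq \<epsilon> (v0 x)) + growth * T"
proof -
  define h where "h n = 1 / real (Suc n)" for n
  have h: "\<And>n. 0 < h n" "\<And>n. h n \<le> 1" "h \<longlonglongrightarrow> 0"
    using LIMSEQ_inverse_real_of_nat by (auto simp: h_def[abs_def] inverse_eq_divide)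
  obtain C where C: "AE r in lborel. r \<in> {0<..1} \<longrightarrow>
     (\<forall>h. 0 < h \<longrightarrow> h \<le> 1 \<longrightarrow> \<bar>energy_rate \<epsilon> h r\<bar> \<le> C) \<and>
     (\<forall>h. (\<forall>n. 0 < h n \<and> h n \<le> 1) \<longrightarrow> h \<longlonglongrightarrow> 0 \<longrightarrow> (\<lambda>n. max (energy_rate \<epsilon> (h n) r) growth) \<longlonglongrightarrow> growth)"
    using energy_rate_limit by blast
  have exm: "(\<lambda>r. indicator {0..T} r * energy_rate \<epsilon> (h n) r) \<in> borel_measurable borel" for n
    using neg_sq_increment(2)[OF h(1,2) T, of n] unfolding set_integrable_def by (auto dest: borel_measurable_integrable)
  have mm: "(\<lambda>r. indicator {0..T} r *\<^sub>R max (energy_rate \<epsilon> (h n) r) growth) \<in> borel_measurable borel" for n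
  proof -
    have "indicator {0..T} r *\<^sub>R max (energy_rate \<epsilon> (h n) r) growth = indicator {0..T} r * max (indicator {0..T} r * energy_rate \<epsilon> (h n) r) growth" for r :: real
      by (auto simp: indicator_def)
    moreover have "(\<lambda>r. indicator {0..T} r * max (indicator {0..T} r * energy_rate \<epsilon> (h n) r) growth) \<in> borel_measurable borel"
      using exm by measurable
    ultimately show ?thesis by (simp only:)
  qed
  have wi: "integrable lborel (\<lambda>r. indicator {0..T} r * (\<bar>C\<bar> + \<bar>growth\<bar>))"
    by (rule integrable_Icc_const)
  have bd: "AE r in lborel. norm (indicator {0..T} r *\<^sub>R max (energy_rate \<epsilon> (h n) r) growth) \<le> indicator {0..T} r * (\<bar>C\<bar> + \<bar>growth\<bar>)" for n
    using C AE_lborel_singleton[of 0]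
  proof eventually_elim
    case (elim r)
    show ?case
    proof (cases "r \<in> {0..T}")
      case True
      then have "r \<in> {0<..1}" using T elim(2) by auto
      then have "\<bar>energy_rate \<epsilon> (h n) r\<bar> \<le> C" using elim(1) h by blast
      then have "\<bar>max (energy_rate \<epsilon> (h n) r) growth\<bar> \<le> \<bar>C\<bar> + \<bar>growth\<bar>" by (cases "energy_rate \<epsilon> (h n) r \<le> growth") auto
      then show ?thesis using True by simp
    qed simp
  qed
  have lim: "(\<lambda>n. LBINT r. indicator {0..T} r *\<^sub>R max (energy_rate \<epsilon> (h n) r) growth) \<longlonglongrightarrow> (LBINT r. indicator {0..T} r *\<^sub>R growth)"
  proof (rule integral_dominated_convergence[OF _ _ wi _ bd])
    show "AE r in lborel. (\<lambda>n. indicator {0..T} r *\<^sub>R max (energy_rate \<epsilon> (h n) r) growth) \<longlonglongrightarrow> indicator {0..T} r *\<^sub>R growth"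
      using C AE_lborel_singleton[of 0]
    proof eventually_elim
      case (elim r)
      show ?case
      proof (cases "r \<in> {0..T}")
        case True
        then have "r \<in> {0<..1}" using T elim(2) by auto
        then have "(\<lambda>n. max (energy_rate \<epsilon> (h n) r) growth) \<longlonglongrightarrow> growth" using elim(1) h by blast
        then show ?thesis using True by simp
      qed simp
    qed
  qed (use mm in auto)
  have mi: "integrable lborel (\<lambda>r. indicator {0..T} r *\<^sub>R max (energy_rate \<epsilon> (h n) r) growth)" for n
    by (rule Bochner_Integration.integrable_bound[OF wi]) (use mm bd in \<open>auto elim!: eventually_mono intro: order_trans[OF _ abs_ge_self]\<close>)
  have le: "(LBINT x:{-R..R}. \<psi> x * neg_sq \<epsilon> (slope (h n) T x)) - (LBINT x:{-R..R}. \<psi> x * neg_sq \<epsilon> (slope (h n) 0 x))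
      \<le> (LBINT r. indicator {0..T} r *\<^sub>R max (energy_rate \<epsilon> (h n) r) growth)" for n
  proof -
    have "(LBINT r:{0..T}. energy_rate \<epsilon> (h n) r) \<le> (LBINT r. indicator {0..T} r *\<^sub>R max (energy_rate \<epsilon> (h n) r) growth)"
      unfolding set_lebesgue_integral_def
      using neg_sq_increment(2)[OF h(1,2) T, of n] mi unfolding set_integrable_def
      by (intro integral_mono) (auto simp: indicator_def)
    then show ?thesis unfolding neg_sq_increment(1)[OF h(1,2) T] .
  qed
  have "(LBINT x:{-R..R}. \<psi> x * neg_sq \<epsilon> (v x)) - (LBINT x:{-R..R}. \<psi> x * neg_sq \<epsilon> (v0 x)) \<le> (LBINT r. indicator {0..T} r *\<^sub>R growth)"
    by (rule LIMSEQ_le[OF tendsto_diff[OF slope_energy_tendsto[OF _ v h(1,3)] slope_energy_tendsto[OF _ v0 h(1,3)]] lim])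
       (use le T in auto)
  also have "\<dots> = growth * T" using T by simp
  finally show ?thesis by simp
qed

end

lemma neg_energy_growth:
  assumes T: "0 < T" "T \<le> 1" and v: "primitive (u T) v" "integrable lborel (\<lambda>x. (v x)\<^sup>2)"
    and v0: "primitive (u 0) v0" "integrable lborel (\<lambda>x. (v0 x)\<^sup>2)"
  shows "(LBINT x:{-R..R}. \<psi> x * (neg_part (v x))\<^sup>2) \<le> (LBINT x:{-R..R}. \<psi> x * (neg_part (v0 x))\<^sup>2) + growth * T"
proof -
  define e where "e n = 1 / real (Suc n)" for n
  have e: "\<And>n. 0 < e n" "\<And>n. e n \<le> 1" "e \<longlonglongrightarrow> 0"
    using LIMSEQ_inverse_real_of_nat by (auto simp: e_def[abs_def] inverse_eq_divide)
  have lim: "(\<lambda>n. LBINT x:{-R..R}. \<psi> x * neg_sq (e n) (w x)) \<longlonglongrightarrow> (LBINT x:{-R..R}. \<psi> x * (neg_part (w x))\<^sup>2)"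
    if [measurable]: "w \<in> borel_measurable borel" and w: "integrable lborel (\<lambda>x. (w x)\<^sup>2)" for w
    unfolding set_lebesgue_integral_def
  proof (rule integral_dominated_convergence[where w="\<lambda>x. (w x)\<^sup>2"])
    have [measurable]: "neg_sq (e n) \<in> borel_measurable borel" "neg_part \<in> borel_measurable borel" for n
      using neg_sq_borel[OF e(1,2)] by (auto intro!: borel_measurable_continuous_onI continuous_neg_part continuous_intros)
    show "(\<lambda>x. indicator {-R..R} x *\<^sub>R (\<psi> x * (neg_part (w x))\<^sup>2)) \<in> borel_measurable lborel" by measurable
    show "(\<lambda>x. indicator {-R..R} x *\<^sub>R (\<psi> x * neg_sq (e n) (w x))) \<in> borel_measurable lborel" for n by measurable
    show "AE x in lborel. (\<lambda>n. indicator {-R..R} x *\<^sub>R (\<psi> x * neg_sq (e n) (w x))) \<longlonglongrightarrow> indicator {-R..R} x *\<^sub>R (\<psi> x * (neg_part (w x))\<^sup>2)"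
    proof (intro always_eventually allI tendsto_intros)
      fix x
      have "(\<lambda>n. (neg_part (w x))\<^sup>2 / (1 + e n * (neg_part (w x))\<^sup>2)) \<longlonglongrightarrow> (neg_part (w x))\<^sup>2 / (1 + 0 * (neg_part (w x))\<^sup>2)"
        by (intro tendsto_intros e(3)) auto
      then show "(\<lambda>n. neg_sq (e n) (w x)) \<longlonglongrightarrow> (neg_part (w x))\<^sup>2" by (simp add: neg_sq_def)
    qed
    show "AE x in lborel. norm (indicator {-R..R} x *\<^sub>R (\<psi> x * neg_sq (e n) (w x))) \<le> (w x)\<^sup>2" for n
    proof (intro always_eventually allI)
      fix x
      have "\<bar>\<psi> x\<bar> * \<bar>neg_sq (e n) (w x)\<bar> \<le> 1 * (w x)\<^sup>2"
        using \<psi>_range[of x] neg_sq_nonneg[OF e(1,2), of n "w x"] order_trans[OF neg_sq_le_sq[OF e(1,2), of n "w x"] neg_part_sq_le]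
        by (intro mult_mono) auto
      then show "norm (indicator {-R..R} x *\<^sub>R (\<psi> x * neg_sq (e n) (w x))) \<le> (w x)\<^sup>2"
        by (simp add: indicator_def abs_mult)
    qed
  qed (rule w)
  show ?thesis
    by (rule LIMSEQ_le[OF lim[OF primitiveD(1)[OF v(1)] v(2)] tendsto_add[OF lim[OF primitiveD(1)[OF v0(1)] v0(2)] tendsto_const]])
       (use truncated_energy_growth[OF e(1,2) T v(1) v0(1)] in auto)
qed

end

section \<open>Semicontinuity at the initial time\<close>

lemma neg_part_borel [measurable]: "neg_part \<in> borel_measurable borel"
  by (auto intro!: borel_measurable_continuous_onI continuous_neg_part continuous_intros)

lemma primitive_neg_part_sq:
  assumes v: "primitive f v" and v2: "integrable lborel (\<lambda>x. (v x)\<^sup>2)"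
  obtains P where "primitive P (\<lambda>x. (neg_part (v x))\<^sup>2)"
proof (rule primitive_of_integrable)
  note [measurable] = primitiveD(1)[OF v]
  show "(\<lambda>x. (neg_part (v x))\<^sup>2) \<in> borel_measurable borel" by measurable
  show "integrable lborel (\<lambda>x. (neg_part (v x))\<^sup>2)"
    by (rule Bochner_Integration.integrable_bound[OF v2]) (auto intro!: always_eventually neg_part_sq_le)
qed (rule that)

lemma continuous_at_right_limit:
  fixes g :: "real \<Rightarrow> real"
  assumes "continuous_on UNIV g" shows "(g \<longlongrightarrow> g a) (at_right a)"
proof -
  have "isCont g a" using assms by (simp add: continuous_on_eq_continuous_at)
  then show ?thesis unfolding isCont_def by (rule filterlim_mono[OF _ order_refl at_le]) auto
qed

lemma neg_quotient_sq_le: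
  assumes v: "primitive f v" and P: "primitive P (\<lambda>x. (neg_part (v x))\<^sup>2)" and xy: "x < y"
  shows "(neg_part ((f y - f x) / (y - x)))\<^sup>2 \<le> (P y - P x) / (y - x)"
proof -
  note [measurable] = primitiveD(1)[OF v]
  have ni: "set_integrable lborel {a..b} (\<lambda>x. neg_part (v x))" for a b
    using primitiveD(2)[OF v, of a b] unfolding set_integrable_def
    by (rule Bochner_Integration.integrable_bound) (auto intro!: always_eventually simp: indicator_def neg_part_simps)
  then obtain n where n: "primitive n (\<lambda>x. neg_part (v x))" by (rule primitive_exists[rotated]) measurable
  have "- (f y - f x) \<le> n y - n x"
  proof -
    have "0 \<le> v z + neg_part (v z)" for z by (simp add: neg_part_def max_def)
    from primitive_nonneg_mono[OF primitive_add[OF v n] this, of x y] show ?thesis using xy by simp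
  qed
  moreover have "0 \<le> n y - n x" using primitive_nonneg_mono[OF n neg_part_simps(3), of x y] xy by simp
  ultimately have "neg_part ((f y - f x) / (y - x)) \<le> (n y - n x) / (y - x)"
    using xy unfolding neg_part_def by (auto simp: divide_right_mono minus_divide_left)
  from power_mono[OF this neg_part_simps(3), of 2] show ?thesis
    using quotient_sq_le[OF n P xy] by simp
qed

text \<open>Jensen's inequality for box averages of the slope. Only the part \<open>[c, d - h]\<close> is covered, since
  the averages look forward by \<open>h\<close>.\<close>

lemma neg_quotient_energy_le:
  assumes v: "primitive f v" and P: "primitive P (\<lambda>x. (neg_part (v x))\<^sup>2)" and h: "0 < h" and cd: "c \<le> d - h"
  shows "(LBINT x:{c..d - h}. (neg_part ((f (x + h) - f x) / h))\<^sup>2) \<le> (LBINT x:{c..d}. (neg_part (v x))\<^sup>2)"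
proof -
  have cP: "continuous_on UNIV P" and cf: "continuous_on UNIV f" by (rule primitive_continuous[OF P], rule primitive_continuous[OF v])
  obtain \<Xi> where \<Xi>: "\<And>x. (\<Xi> has_real_derivative P x) (at x)" using antiderivative_exists[OF cP] by blast
  have dq: "((\<lambda>x. (\<Xi> (x + h) - \<Xi> x) / h) has_real_derivative (P (x + h) - P x) / h) (at x)" for x
    by (intro DERIV_cdivide DERIV_diff \<Xi> DERIV_shift[THEN iffD1])
  have cq: "continuous_on UNIV (\<lambda>x. (P (x + h) - P x) / h)" "continuous_on UNIV (\<lambda>x. (neg_part ((f (x + h) - f x) / h))\<^sup>2)"
    using h by (auto intro!: continuous_intros continuous_on_compose2[OF cP] continuous_on_compose2[OF cf])
  have mono: "P x \<le> P y" if "x \<le> y" for x y by (rule primitive_nonneg_mono[OF P _ that]) auto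
  have "(neg_part ((f (x + h) - f x) / h))\<^sup>2 \<le> (P (x + h) - P x) / h" for x
    using neg_quotient_sq_le[OF v P, of x "x + h"] h by simp
  then have "(LBINT x:{c..d - h}. (neg_part ((f (x + h) - f x) / h))\<^sup>2) \<le> (LBINT x:{c..d - h}. (P (x + h) - P x) / h)"
    by (intro set_integral_le_AE set_integrable_cts cq always_eventually) auto
  also have "\<dots> = (\<Xi> d - \<Xi> (d - h)) / h - (\<Xi> (c + h) - \<Xi> c) / h"
    using LBINT_FTC(2)[OF dq cq(1) cd] by simp
  also have "\<dots> \<le> P d - P c"
  proof -
    obtain z1 where z1: "d - h < z1" "z1 < d" "\<Xi> d - \<Xi> (d - h) = h * P z1"
      using MVT2[of "d - h" d \<Xi> P] \<Xi> h by auto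
    obtain z2 where z2: "c < z2" "z2 < c + h" "\<Xi> (c + h) - \<Xi> c = h * P z2"
      using MVT2[of c "c + h" \<Xi> P] \<Xi> h by auto
    show ?thesis using mono[of z1 d] mono[of c z2] z1 z2 h by simp
  qed
  also have "\<dots> = (LBINT x:{c..d}. (neg_part (v x))\<^sup>2)" using primitiveD(3)[OF P, of c d] cd h by simp
  finally show ?thesis .
qed

lemma neg_energy_approx_below:
  assumes v: "primitive f v" and v2: "integrable lborel (\<lambda>x. (v x)\<^sup>2)" and cd: "c < d" and e: "0 < e"
  obtains h where "0 < h" "c \<le> d - h"
    "(LBINT x:{c..d}. (neg_part (v x))\<^sup>2) - e < (LBINT x:{c..d - h}. (neg_part ((f (x + h) - f x) / h))\<^sup>2)"
proof (rule ccontr)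
  assume none: "\<not> thesis"
  note [measurable] = primitiveD(1)[OF v]
  have cf: "continuous_on UNIV f" by (rule primitive_continuous[OF v])
  have [measurable]: "f \<in> borel_measurable borel" using cf by (rule borel_measurable_continuous_onI)
  define h where "h n = (d - c) / real (Suc n)" for n
  have h: "\<And>n. 0 < h n" "\<And>n. c \<le> d - h n" "h \<longlonglongrightarrow> 0"
  proof -
    show "0 < h n" for n using cd by (simp add: h_def)
    have "(d - c) / real (Suc n) \<le> (d - c) / 1" for n using cd by (intro divide_left_mono) auto
    then show "c \<le> d - h n" for n unfolding h_def by (simp add: algebra_simps)
    show "h \<longlonglongrightarrow> 0" using tendsto_mult_left[OF LIMSEQ_inverse_real_of_nat, of "d - c"]
      by (simp add: h_def[abs_def] divide_inverse)
  qed
  \<comment> \<open>If every step failed, Fatou's lemma would give less energy than there is.\<close>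
  define w where "w n x = indicator {c..d - h n} x * neg_part ((f (x + h n) - f x) / h n)" for n x
  define I where "I = (LBINT x:{c..d}. (neg_part (v x))\<^sup>2)"
  have wsq: "(w n x)\<^sup>2 = indicator {c..d - h n} x *\<^sub>R (neg_part ((f (x + h n) - f x) / h n))\<^sup>2" for n x
    by (simp add: w_def indicator_def)
  have "(LBINT x. (indicator {c..d} x * neg_part (v x))\<^sup>2) \<le> I - e"
  proof (rule L2_Fatou(2))
    show "w n \<in> borel_measurable borel" for n unfolding w_def by measurable
    show "(\<lambda>x. indicator {c..d} x * neg_part (v x)) \<in> borel_measurable borel" by measurable
    show "integrable lborel (\<lambda>x. (w n x)\<^sup>2)" for n
    proof -
      have "set_integrable lborel {c..d - h n} (\<lambda>x. (neg_part ((f (x + h n) - f x) / h n))\<^sup>2)"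
        using h(1)[of n] by (intro set_integrable_cts) (auto intro!: continuous_intros continuous_on_compose2[OF cf])
      then show ?thesis unfolding wsq set_integrable_def .
    qed
    show "\<forall>\<^sub>F n in sequentially. (LBINT x. (w n x)\<^sup>2) \<le> I - e"
    proof (intro always_eventually allI)
      fix n
      have "\<not> I - e < (LBINT x:{c..d - h n}. (neg_part ((f (x + h n) - f x) / h n))\<^sup>2)"
        using none that[OF h(1) h(2), of n] by (auto simp: I_def)
      then show "(LBINT x. (w n x)\<^sup>2) \<le> I - e" unfolding wsq set_lebesgue_integral_def by simp
    qed
    show "AE x in lborel. (\<lambda>n. w n x) \<longlonglongrightarrow> indicator {c..d} x * neg_part (v x)"
      using primitive_AE_deriv[OF v] AE_lborel_singleton[of d]
    proof eventually_elim
      case (elim x)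
      have "isCont neg_part (v x)"
        using continuous_neg_part[of UNIV "\<lambda>x. x"] by (simp add: continuous_on_eq_continuous_at continuous_on_id)
      from isCont_tendsto_compose[OF this quot_tendsto(1)[OF elim(1) h(1,3)]]
      have 1: "(\<lambda>n. neg_part ((f (x + h n) - f x) / h n)) \<longlonglongrightarrow> neg_part (v x)" .
      have 2: "(\<lambda>n. indicator {c..d - h n} x :: real) \<longlonglongrightarrow> indicator {c..d} x"
      proof (cases "x < d")
        case True
        have "\<forall>\<^sub>F n in sequentially. h n < d - x" using order_tendstoD(2)[OF h(3), of "d - x"] True by simp
        then have "\<forall>\<^sub>F n in sequentially. (indicator {c..d - h n} x :: real) = indicator {c..d} x"
          by eventually_elim (use True in \<open>auto simp: indicator_def\<close>)
        then show ?thesis by (rule tendsto_eventually)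
      next
        case False
        then have "(indicator {c..d - h n} x :: real) = indicator {c..d} x" for n
          using elim(2) h(1)[of n] by (auto simp: indicator_def)
        then show ?thesis by simp
      qed
      show ?case unfolding w_def by (rule tendsto_mult[OF 2 1])
    qed
  qed
  moreover have "(LBINT x. (indicator {c..d} x * neg_part (v x))\<^sup>2) = I"
    unfolding I_def set_lebesgue_integral_def by (intro Bochner_Integration.integral_cong) (auto simp: indicator_def)
  ultimately show False using e by simp
qed

context weak_solution begin

text \<open>The difference quotients at a fixed step depend continuously on time, unlike the slope.\<close>

lemma neg_energy_lsc:
  assumes v0: "primitive (u 0) v0" "integrable lborel (\<lambda>x. (v0 x)\<^sup>2)" and cd: "c < d" and e: "0 < e"
  shows "\<forall>\<^sub>F t in at_right 0. \<forall>v. primitive (u t) v \<longrightarrow> integrable lborel (\<lambda>x. (v x)\<^sup>2) \<longrightarrow>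
     (LBINT x:{c..d}. (neg_part (v0 x))\<^sup>2) - e < (LBINT x:{c..d}. (neg_part (v x))\<^sup>2)"
proof -
  obtain h where h: "0 < h" "c \<le> d - h"
    "(LBINT x:{c..d}. (neg_part (v0 x))\<^sup>2) - e < (LBINT x:{c..d - h}. (neg_part ((u 0 (x + h) - u 0 x) / h))\<^sup>2)"
    using neg_energy_approx_below[OF v0 cd e] by blast
  define J where "J t = (LBINT x:{c..d - h}. (neg_part ((ue t (x + h) - ue t x) / h))\<^sup>2)" for t
  have "continuous_on UNIV J" unfolding J_def
  proof (rule param_integral_continuous)
    have "continuous_on UNIV (\<lambda>p::real\<times>real. (\<lambda>q. ue (fst q) (snd q)) (fst p, snd p + h))"
      by (rule continuous_on_compose2[OF cont_ue[of UNIV]]) (auto intro!: continuous_intros)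
    then show "continuous_on UNIV (\<lambda>p. (neg_part ((ue (fst p) (snd p + h) - ue (fst p) (snd p)) / h))\<^sup>2)"
      using h(1) by (intro continuous_intros cont_ue) auto
  qed
  then have "(J \<longlongrightarrow> J 0) (at_right 0)"
    by (rule continuous_at_right_limit)
  moreover have "(LBINT x:{c..d}. (neg_part (v0 x))\<^sup>2) - e < J 0" using h(3) by (simp add: J_def ue_def)
  ultimately have "\<forall>\<^sub>F t in at_right 0. (LBINT x:{c..d}. (neg_part (v0 x))\<^sup>2) - e < J t" by (rule order_tendstoD(1))
  moreover have "\<forall>\<^sub>F t in at_right 0. (0::real) < t" by (rule eventually_at_right_less)
  ultimately show ?thesis
  proof eventually_elim
    case (elim t)
    show ?case
    proof (intro allI impI)
      fix v assume v: "primitive (u t) v" "integrable lborel (\<lambda>x. (v x)\<^sup>2)"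
      obtain P where "primitive P (\<lambda>x. (neg_part (v x))\<^sup>2)" using primitive_neg_part_sq[OF v] .
      from neg_quotient_energy_le[OF v(1) this h(1,2)]
      have "J t \<le> (LBINT x:{c..d}. (neg_part (v x))\<^sup>2)" using elim(2) by (simp add: J_def ue_eq)
      then show "(LBINT x:{c..d}. (neg_part (v0 x))\<^sup>2) - e < (LBINT x:{c..d}. (neg_part (v x))\<^sup>2)" using elim(1) by simp
    qed
  qed
qed

text \<open>The cut-off is a plateau that equals one on the interval enlarged by \<open>\<eta>\<close> and vanishes off the one enlarged
  by \<open>2\<eta>\<close>. The negative slope energy seen through it changes at a bounded rate, and the enlargement leaves
  room for the moving end points.\<close>

lemma neg_energy_usc:
  assumes v0: "primitive (u 0) v0" "integrable lborel (\<lambda>x. (v0 x)\<^sup>2)" and ab: "a \<le> b" and e: "0 < e"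
  shows "\<exists>\<eta>>0. \<forall>\<^sub>F t in at_right 0. \<forall>v. primitive (u t) v \<longrightarrow> integrable lborel (\<lambda>x. (v x)\<^sup>2) \<longrightarrow>
     (LBINT x:{a-\<eta>..b+\<eta>}. (neg_part (v x))\<^sup>2) < (LBINT x:{a..b}. (neg_part (v0 x))\<^sup>2) + e"
proof -
  obtain Fb where Fb: "Fb \<in> borel_measurable borel" "\<And>p. \<bar>Fb p\<bar> \<le> M / 2"
    "AE p in lborel \<Otimes>\<^sub>M lborel. 0 < fst p \<longrightarrow> Fb p = src p" using src_borel_version by blast
  interpret ws: weak_solution_src u u0 M Fb by unfold_locales (use Fb in auto)
  obtain P where P: "primitive P (\<lambda>x. (neg_part (v0 x))\<^sup>2)" using primitive_neg_part_sq[OF v0] .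
  have "continuous_on UNIV (\<lambda>\<eta>. P (b + 2 * \<eta>) - P (a - 2 * \<eta>))"
    by (auto intro!: continuous_intros continuous_on_compose2[OF primitive_continuous[OF P, of UNIV]])
  then have "((\<lambda>\<eta>. P (b + 2 * \<eta>) - P (a - 2 * \<eta>)) \<longlongrightarrow> P (b + 2 * 0) - P (a - 2 * 0)) (at_right 0)"
    by (rule continuous_at_right_limit)
  then have "\<forall>\<^sub>F \<eta> in at_right 0. P (b + 2 * \<eta>) - P (a - 2 * \<eta>) < P b - P a + e / 2"
    using e by (intro order_tendstoD(2)) auto
  moreover have "\<forall>\<^sub>F \<eta> in at_right 0. (0::real) < \<eta>" by (rule eventually_at_right_less)
  ultimately have "\<forall>\<^sub>F \<eta> in at_right 0. 0 < \<eta> \<and> P (b + 2 * \<eta>) - P (a - 2 * \<eta>) < P b - P a + e / 2"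
    by eventually_elim simp
  then obtain \<eta> where \<eta>: "0 < \<eta>" "P (b + 2 * \<eta>) - P (a - 2 * \<eta>) < P b - P a + e / 2"
    using eventually_happens trivial_limit_at_right_real by blast
  obtain N where N: "1 / real (Suc N) < \<eta>" using reals_Archimedean[OF \<eta>(1)] by (auto simp: inverse_eq_divide)
  define \<psi> where "\<psi> = plateau (a - 2 * \<eta>) (b + \<eta>) N"
  define R where "R = \<bar>a\<bar> + \<bar>b\<bar> + 2 * \<eta> + 1"
  have ab': "a - 2 * \<eta> \<le> b + \<eta>" using ab \<eta>(1) by simp
  have \<psi>1: "\<psi> x = 1" if "x \<in> {a - \<eta>..b + \<eta>}" for x
    unfolding \<psi>_def by (rule plateau_inside) (use that N in auto)
  have \<psi>0: "\<psi> x = 0" if "x \<notin> {a - 2 * \<eta>..b + 2 * \<eta>}" for x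
    unfolding \<psi>_def by (rule plateau_outside[OF ab']) (use that N in auto)
  obtain D where D: "\<And>x. \<bar>plateau' (a - 2 * \<eta>) (b + \<eta>) N x\<bar> \<le> D" using ws.plateau'_bounded by blast
  obtain U where U: "\<forall>t\<in>{0..1}. \<forall>x\<in>{-R-1..R+1}. \<bar>ue t x\<bar> \<le> U" using ue_bounded_on_box by blast
  have Rb: "- R < a - 2 * \<eta>" "b + 2 * \<eta> < R" "0 < R" unfolding R_def using \<eta>(1) by auto
  interpret cs: cutoff_solution u u0 M Fb \<psi> "plateau' (a - 2 * \<eta>) (b + \<eta>) N" R D U
  proof
    show "(\<psi> has_real_derivative plateau' (a - 2 * \<eta>) (b + \<eta>) N x) (at x)" for x unfolding \<psi>_def by (rule plateau_deriv)
    show "continuous_on UNIV (plateau' (a - 2 * \<eta>) (b + \<eta>) N)" by (rule plateau_continuous)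
    show "0 \<le> \<psi> x" "\<psi> x \<le> 1" for x unfolding \<psi>_def by (rule plateau_range(1)[OF ab'], rule plateau_range(2))
    show "\<psi> (- R) = 0" "\<psi> R = 0" using Rb by (auto intro!: \<psi>0)
  qed (use D U Rb in auto)
  have "((\<lambda>t. cs.growth * t) \<longlongrightarrow> cs.growth * 0) (at_right 0)" by (intro tendsto_intros)
  then have "\<forall>\<^sub>F t in at_right 0. cs.growth * t < e / 2" using e by (intro order_tendstoD(2)) auto
  moreover have "\<forall>\<^sub>F t in at_right 0. (0::real) < t" by (rule eventually_at_right_less)
  moreover have "\<forall>\<^sub>F t in at_right 0. t \<le> (1::real)" unfolding eventually_at_right_field by (intro exI[of _ 1]) auto
  ultimately have "\<forall>\<^sub>F t in at_right 0. \<forall>v. primitive (u t) v \<longrightarrow> integrable lborel (\<lambda>x. (v x)\<^sup>2) \<longrightarrow>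
     (LBINT x:{a-\<eta>..b+\<eta>}. (neg_part (v x))\<^sup>2) < (LBINT x:{a..b}. (neg_part (v0 x))\<^sup>2) + e"
  proof eventually_elim
    case (elim t)
    show ?case
    proof (intro allI impI)
      fix v assume v: "primitive (u t) v" "integrable lborel (\<lambda>x. (v x)\<^sup>2)"
      have si: "set_integrable lborel {A..B} (\<lambda>x. \<psi> x * (neg_part (w x))\<^sup>2)" "set_integrable lborel {A..B} (\<lambda>x. (neg_part (w x))\<^sup>2)"
        if w: "primitive f w" "integrable lborel (\<lambda>x. (w x)\<^sup>2)" for f w A B
      proof -
        obtain P' where P': "primitive P' (\<lambda>x. (neg_part (w x))\<^sup>2)" using primitive_neg_part_sq[OF w] .
        show "set_integrable lborel {A..B} (\<lambda>x. (neg_part (w x))\<^sup>2)" by (rule primitiveD(2)[OF P'])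
        then show "set_integrable lborel {A..B} (\<lambda>x. \<psi> x * (neg_part (w x))\<^sup>2)"
          using set_integrable_mult_continuous[OF primitiveD(1)[OF P'] _ cs.cont_psi] by (simp add: mult.commute)
      qed
      have "(LBINT x:{a-\<eta>..b+\<eta>}. (neg_part (v x))\<^sup>2) \<le> (LBINT x:{-R..R}. \<psi> x * (neg_part (v x))\<^sup>2)"
        unfolding set_lebesgue_integral_def
        using si[OF v, of "-R" R] si(2)[OF v, of "a-\<eta>" "b+\<eta>"] \<psi>1 cs.\<psi>_range(1) Rb \<eta>(1) unfolding set_integrable_def
        by (intro integral_mono) (auto simp: indicator_def)
      also have "\<dots> \<le> (LBINT x:{-R..R}. \<psi> x * (neg_part (v0 x))\<^sup>2) + cs.growth * t"
        by (rule cs.neg_energy_growth[OF elim(2,3) v v0])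
      finally have 1: "(LBINT x:{a-\<eta>..b+\<eta>}. (neg_part (v x))\<^sup>2) \<le> (LBINT x:{-R..R}. \<psi> x * (neg_part (v0 x))\<^sup>2) + cs.growth * t" .
      have "(LBINT x:{-R..R}. \<psi> x * (neg_part (v0 x))\<^sup>2) \<le> (LBINT x:{a-2*\<eta>..b+2*\<eta>}. (neg_part (v0 x))\<^sup>2)"
      proof -
        have "indicator {-R..R} x *\<^sub>R (\<psi> x * (neg_part (v0 x))\<^sup>2) \<le> indicator {a-2*\<eta>..b+2*\<eta>} x *\<^sub>R (neg_part (v0 x))\<^sup>2" for x
        proof (cases "x \<in> {a-2*\<eta>..b+2*\<eta>}")
          case True
          then show ?thesis using mult_right_mono[OF cs.\<psi>_range(2)[of x] zero_le_power2[of "neg_part (v0 x)"]] Rb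
            by (simp add: indicator_def)
        qed (use \<psi>0[of x] in auto)
        then show ?thesis unfolding set_lebesgue_integral_def
          using si[OF v0] unfolding set_integrable_def by (intro integral_mono) auto
      qed
      also have "\<dots> = P (b + 2 * \<eta>) - P (a - 2 * \<eta>)" using primitiveD(3)[OF P, of "a-2*\<eta>" "b+2*\<eta>"] ab \<eta>(1) by simp
      finally have 2: "(LBINT x:{-R..R}. \<psi> x * (neg_part (v0 x))\<^sup>2) \<le> P (b + 2 * \<eta>) - P (a - 2 * \<eta>)" .
      show "(LBINT x:{a-\<eta>..b+\<eta>}. (neg_part (v x))\<^sup>2) < (LBINT x:{a..b}. (neg_part (v0 x))\<^sup>2) + e"
        using 1 2 \<eta>(2) elim(1) primitiveD(3)[OF P ab] by argo
    qed
  qed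
  then show ?thesis using \<eta>(1) by blast
qed

end

lemma characteristic_tendsto:
  assumes "CH_characteristic u z0 z" shows "(z \<longlongrightarrow> z0) (at_right 0)"
proof -
  have "z 0 = z0" "(z has_real_derivative u 0 (z 0)) (at 0 within {0..})"
    using assms unfolding CH_characteristic_def by auto
  then have "(z \<longlongrightarrow> z0) (at 0 within {0..})"
    using DERIV_continuous continuous_within by blast
  then show ?thesis by (rule filterlim_mono[OF _ order_refl at_le]) auto
qed

theorem theorem2p6:
  fixes u :: "real \<Rightarrow> real \<Rightarrow> real" and u0 :: "real \<Rightarrow> real"
    and a b :: real and \<alpha> \<beta> :: "real \<Rightarrow> real"
  assumes "a \<le> b"
    and "CH_weak_solution u0 u"
    and "CH_characteristic u a \<alpha>"
    and "CH_characteristic u b \<beta>"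
  shows "((\<lambda>t. LINT x:{\<alpha> t..\<beta> t}|lebesgue. (neg_part (weak_deriv (u t) x))\<^sup>2)
           \<longlongrightarrow> (LINT x:{a..b}|lebesgue. (neg_part (weak_deriv (u 0) x))\<^sup>2)) (at_right 0)"
proof -
  obtain M where en: "0 \<le> M"
    "AE t in lborel. 0 \<le> t \<longrightarrow> (\<integral>\<^sup>+x. ennreal ((u t x)\<^sup>2 + 1/2 * (weak_deriv (u t) x)\<^sup>2) \<partial>lebesgue) \<le> ennreal M"
    "\<And>t. 0 \<le> t \<Longrightarrow> \<exists>v. primitive (u t) v \<and> (AE x in lebesgue. weak_deriv (u t) x = v x)
        \<and> integrable lborel (\<lambda>x. (v x)\<^sup>2) \<and> (LBINT x. (v x)\<^sup>2) \<le> 2 * M"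
    using weak_solution_H1[OF assms(2)] by blast
  interpret weak_solution u u0 M by unfold_locales (use assms(2) en in auto)
  obtain v where v: "\<And>t. 0 \<le> t \<Longrightarrow> primitive (u t) (v t)" "\<And>t. 0 \<le> t \<Longrightarrow> AE x in lebesgue. weak_deriv (u t) x = v t x"
    "\<And>t. 0 \<le> t \<Longrightarrow> integrable lborel (\<lambda>x. (v t x)\<^sup>2)"
    using en(3) by metis
  have eq: "(LINT x:{c..d}|lebesgue. (neg_part (weak_deriv (u t) x))\<^sup>2) = (LBINT x:{c..d}. (neg_part (v t x))\<^sup>2)"
    if t: "0 \<le> t" for t c d
  proof -
    note [measurable] = primitiveD(1)[OF v(1)[OF t]]
    have m: "(\<lambda>x. indicator {c..d} x *\<^sub>R (neg_part (v t x))\<^sup>2) \<in> borel_measurable lborel" by measurable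
    have ae: "AE x in lebesgue. indicator {c..d} x *\<^sub>R (neg_part (v t x))\<^sup>2 = indicator {c..d} x *\<^sub>R (neg_part (weak_deriv (u t) x))\<^sup>2"
      using v(2)[OF t] by eventually_elim simp
    have "(LINT x|lebesgue. indicator {c..d} x *\<^sub>R (neg_part (v t x))\<^sup>2) = (LINT x|lebesgue. indicator {c..d} x *\<^sub>R (neg_part (weak_deriv (u t) x))\<^sup>2)"
      using m by (intro integral_cong_AE ae borel_measurable_AE[OF _ ae] measurable_completion) auto
    then show ?thesis unfolding set_lebesgue_integral_def using integral_completion[OF m] by simp
  qed
  define I where "I t = (LBINT x:{\<alpha> t..\<beta> t}. (neg_part (v t x))\<^sup>2)" for t
  define L where "L = (LBINT x:{a..b}. (neg_part (v 0 x))\<^sup>2)"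
  have pos: "\<forall>\<^sub>F t in at_right 0. (0::real) < t" by (rule eventually_at_right_less)
  note \<alpha> = characteristic_tendsto[OF assms(3)] and \<beta> = characteristic_tendsto[OF assms(4)]
  obtain P where P: "primitive P (\<lambda>x. (neg_part (v 0 x))\<^sup>2)" using primitive_neg_part_sq[OF v(1,3)] by blast
  have mono_dom: "(LBINT x:{c..d}. (neg_part (v t x))\<^sup>2) \<le> (LBINT x:{c'..d'}. (neg_part (v t x))\<^sup>2)"
    if t: "0 \<le> t" and "c' \<le> c" "d \<le> d'" for t c d c' d'
  proof -
    obtain P where P: "primitive P (\<lambda>x. (neg_part (v t x))\<^sup>2)" using primitive_neg_part_sq[OF v(1,3)[OF t]] by blast
    show ?thesis unfolding set_lebesgue_integral_def
      using primitiveD(2)[OF P, of c d] primitiveD(2)[OF P, of c' d'] that unfolding set_integrable_def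
      by (intro integral_mono) (auto simp: indicator_def)
  qed
  have "(I \<longlongrightarrow> L) (at_right 0)"
  proof (rule order_tendstoI)
    fix y assume "L < y"
    then obtain \<eta> where \<eta>: "\<eta> > 0" and up: "\<forall>\<^sub>F t in at_right 0. \<forall>w. primitive (u t) w \<longrightarrow> integrable lborel (\<lambda>x. (w x)\<^sup>2) \<longrightarrow>
     (LBINT x:{a-\<eta>..b+\<eta>}. (neg_part (w x))\<^sup>2) < L + (y - L)"
      using neg_energy_usc[OF v(1)[OF order_refl] v(3)[OF order_refl] assms(1), of "y - L"] unfolding L_def by auto
    have "\<forall>\<^sub>F t in at_right 0. a - \<eta> < \<alpha> t" "\<forall>\<^sub>F t in at_right 0. \<beta> t < b + \<eta>"
      using \<eta> order_tendstoD(1)[OF \<alpha>, of "a - \<eta>"] order_tendstoD(2)[OF \<beta>, of "b + \<eta>"] by auto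
    with up pos show "\<forall>\<^sub>F t in at_right 0. I t < y"
    proof eventually_elim
      case (elim t)
      have "I t \<le> (LBINT x:{a-\<eta>..b+\<eta>}. (neg_part (v t x))\<^sup>2)"
        unfolding I_def using elim by (intro mono_dom) auto
      also have "\<dots> < y" using elim(1) v(1,3)[of t] elim(2) by auto
      finally show ?case .
    qed
  next
    fix y assume y: "y < L"
    show "\<forall>\<^sub>F t in at_right 0. y < I t"
    \<comment> \<open>If \<open>a = b\<close>, the two characteristics may spread in either order, but there is no energy to be preserved.\<close>
    proof (cases "a = b")
      case True
      then have "L = 0" using primitiveD(3)[OF P, of a b] by (simp add: L_def)
      have "0 \<le> I t" for t unfolding I_def set_lebesgue_integral_def by (rule integral_nonneg_AE) auto
      then show ?thesis using y \<open>L = 0\<close> by (intro always_eventually) (auto intro: less_le_trans)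
    next
      case False
      then have ab: "a < b" using assms(1) by simp
      have "continuous_on UNIV (\<lambda>\<eta>. P (b - \<eta>) - P (a + \<eta>))"
        by (auto intro!: continuous_intros continuous_on_compose2[OF primitive_continuous[OF P, of UNIV]])
      then have "((\<lambda>\<eta>. P (b - \<eta>) - P (a + \<eta>)) \<longlongrightarrow> P (b - 0) - P (a + 0)) (at_right 0)"
        by (rule continuous_at_right_limit)
      moreover have "L = P (b - 0) - P (a + 0)" using primitiveD(3)[OF P assms(1)] by (simp add: L_def)
      ultimately have "\<forall>\<^sub>F \<eta> in at_right 0. y < P (b - \<eta>) - P (a + \<eta>)" using y by (intro order_tendstoD(1)) auto
      moreover have "\<forall>\<^sub>F \<eta> in at_right 0. \<eta> < (b - a) / 2"
        unfolding eventually_at_right_field using ab by (intro exI[of _ "(b - a) / 2"]) auto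
      ultimately have "\<forall>\<^sub>F \<eta> in at_right 0. 0 < \<eta> \<and> \<eta> < (b - a) / 2 \<and> y < P (b - \<eta>) - P (a + \<eta>)"
        using pos by eventually_elim simp
      then obtain \<eta> where \<eta>: "0 < \<eta>" "\<eta> < (b - a) / 2" "y < P (b - \<eta>) - P (a + \<eta>)"
        using eventually_happens trivial_limit_at_right_real by blast
      have cd: "a + \<eta> < b - \<eta>" using \<eta>(2) by (simp add: field_simps)
      have Lcd: "(LBINT x:{a+\<eta>..b-\<eta>}. (neg_part (v 0 x))\<^sup>2) = P (b - \<eta>) - P (a + \<eta>)"
        using primitiveD(3)[OF P, of "a+\<eta>" "b-\<eta>"] cd by simp
      have low: "\<forall>\<^sub>F t in at_right 0. \<forall>w. primitive (u t) w \<longrightarrow> integrable lborel (\<lambda>x. (w x)\<^sup>2) \<longrightarrow>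
         y < (LBINT x:{a+\<eta>..b-\<eta>}. (neg_part (w x))\<^sup>2)"
        using neg_energy_lsc[OF v(1)[OF order_refl] v(3)[OF order_refl] cd, of "P (b - \<eta>) - P (a + \<eta>) - y"] \<eta>(3) unfolding Lcd by simp
      have "\<forall>\<^sub>F t in at_right 0. \<alpha> t < a + \<eta>" "\<forall>\<^sub>F t in at_right 0. b - \<eta> < \<beta> t"
        using \<eta>(1) order_tendstoD(2)[OF \<alpha>, of "a + \<eta>"] order_tendstoD(1)[OF \<beta>, of "b - \<eta>"] by auto
      with low pos show ?thesis
      proof eventually_elim
        case (elim t)
        have "y < (LBINT x:{a+\<eta>..b-\<eta>}. (neg_part (v t x))\<^sup>2)" using elim(1) v(1,3)[of t] elim(2) by auto
        also have "\<dots> \<le> I t" unfolding I_def using elim by (intro mono_dom) auto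
        finally show ?case .
      qed
    qed
  qed
  then have "(I \<longlongrightarrow> (LINT x:{a..b}|lebesgue. (neg_part (weak_deriv (u 0) x))\<^sup>2)) (at_right 0)"
    by (simp add: L_def eq)
  then show ?thesis
    by (rule Lim_transform_eventually) (use pos in \<open>eventually_elim, simp add: I_def eq\<close>)
qed

end
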